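(* Let $A$ be a self-adjoint positive-definite operator in a separable Hilbert space $H$ ($A=A^*\ge\mu_0E$ with $\mu_0>0$, $E$ the identity), let $K\in L(W_2^3(R_+;H;A),H_{3/2})$ with operator norm $\kappa=\|K\|_{W_2^3(R_+;H;A)\to H_{3/2}}<1$, and let $A_1,A_2,A_3$ be linear, in general unbounded, operators in $H$ such that the operators $B_j=A_jA^{-j}$, $j=1,2,3$, are bounded in $H$. Put $$C_0(\kappa)=(1-\kappa)^{-1/2},\qquad C_1(\kappa)=\frac{2^{1/3}}{3^{1/2}}\left(1+\frac{3\kappa^{2/3}}{2^{1/3}}\right)^{1/2}(1-\kappa)^{-1/2},\qquad C_2(\kappa)=\frac{2^{1/3}}{3^{1/2}}\cdot\frac{1+3^{1/2}\kappa^{2/3}}{(1-\kappa)^{1/2}},$$ and suppose that $$\alpha(\kappa)=\sum_{j=0}^{2}C_j(\kappa)\,\|B_{3-j}\|_{H\to H}<1.$$ Then the boundary value problem $$u'''(t)-A^3u(t)+\sum_{j=1}^{3}A_ju^{(3-j)}(t)=f(t),\quad t\in R_+,\qquad u(0)=0,\quad u'(0)-Ku=0,$$ is regularly solvable.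
   Context: $R_+=(0;+\infty)$. For $\gamma\ge0$, $H_\gamma=D(A^\gamma)$ is the Hilbert space with inner product $(x,y)_\gamma=(A^\gamma x,A^\gamma y)$; $H_0=H$. $L_2(R_+;H)$ is the Hilbert space of measurable functions $f:R_+\to H$, square-integrable in the sense of Bochner, with norm $\left(\int_0^\infty\|f(t)\|_H^2dt\right)^{1/2}$. $W_2^3(R_+;H;A)$ is the Hilbert space of functions $u$ with $u(t)\in D(A^3)$ for almost every $t$, $u'''\in L_2(R_+;H)$ and $A^3u\in L_2(R_+;H)$, with norm $\|u\|_{W_2^3(R_+;H;A)}=\left(\|u'''\|^2_{L_2(R_+;H)}+\|A^3u\|^2_{L_2(R_+;H)}\right)^{1/2}$; derivatives are in the sense of distributions. By the trace theorem, $u\mapsto u(0)$ and $u\mapsto u'(0)$ are continuous from $W_2^3(R_+;H;A)$ to $H_{5/2}$ and $H_{3/2}$ respectively. $L(X,Y)$ is the space of bounded linear operators from $X$ to $Y$. A regular solution of the equation is a function $u\in W_2^3(R_+;H;A)$ satisfying it almost everywhere in $R_+$. The boundary value problem is called regularly solvable if for any $f\in L_2(R_+;H)$ there is a regular solution $u$ of the equation which satisfies the boundary conditions in the sense $\lim_{t\to0}\|u(t)\|_{H_{5/2}}=0$, $\lim_{t\to0}\|u'(t)-Ku\|_{H_{3/2}}=0$, and the inequality $\|u\|_{W_2^3(R_+;H;A)}\le \mathrm{const}\,\|f\|_{L_2(R_+;H)}$ holds (with a constant independent of $f$). *)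

theory Defs
  imports "HOL-Analysis.Analysis"
begin

text \<open>
  The Hilbert space is a type of sort {real_inner, banach, second_countable_topology}
  (complete and separable).  A complex Hilbert space is covered by restricting scalars and using
  the real part of its inner product: norms, adjoints, self-adjointness, square roots, linearity
  and boundedness of complex-linear operators are unaffected by this.

  An unbounded operator is a partial function; its domain is \<open>dom T\<close>, and the composite
  \<open>S \<circ>\<^sub>m T\<close> has the natural domain of all \<open>x \<in> dom T\<close> whose image lies in \<open>dom S\<close>.
\<close>

section \<open>Unbounded operators\<close>

abbreviation ap :: "('a \<rightharpoonup> 'b) \<Rightarrow> 'a \<Rightarrow> 'b"
  where "ap T x \<equiv> the (T x)"

definition linear_op :: "('h::real_vector \<rightharpoonup> 'h) \<Rightarrow> bool" where
  "linear_op T \<longleftrightarrow> subspace (dom T)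
     \<and> (\<forall>x\<in>dom T. \<forall>y\<in>dom T. ap T (x + y) = ap T x + ap T y)
     \<and> (\<forall>c. \<forall>x\<in>dom T. ap T (c *\<^sub>R x) = c *\<^sub>R ap T x)"

definition adjoint_op :: "('h::real_inner \<rightharpoonup> 'h) \<Rightarrow> ('h \<rightharpoonup> 'h)" where
  "adjoint_op T y =
     (if \<exists>z. \<forall>x\<in>dom T. ap T x \<bullet> y = x \<bullet> z
      then Some (THE z. \<forall>x\<in>dom T. ap T x \<bullet> y = x \<bullet> z) else None)"

definition self_adjoint :: "('h::real_inner \<rightharpoonup> 'h) \<Rightarrow> bool" where
  "self_adjoint T \<longleftrightarrow> linear_op T \<and> closure (dom T) = UNIV \<and> adjoint_op T = T"

text \<open>\<open>T \<ge> \<mu> E\<close>\<close>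

definition op_ge :: "('h::real_inner \<rightharpoonup> 'h) \<Rightarrow> real \<Rightarrow> bool" where
  "op_ge T \<mu> \<longleftrightarrow> (\<forall>x\<in>dom T. ap T x \<bullet> x \<ge> \<mu> * (x \<bullet> x))"

definition op_inv :: "('h \<rightharpoonup> 'h) \<Rightarrow> ('h \<rightharpoonup> 'h)" where
  "op_inv T y = (if \<exists>x. T x = Some y then Some (THE x. T x = Some y) else None)"

primrec op_pow :: "('h \<rightharpoonup> 'h) \<Rightarrow> nat \<Rightarrow> ('h \<rightharpoonup> 'h)" where
  "op_pow T 0 = Some"
| "op_pow T (Suc n) = T \<circ>\<^sub>m op_pow T n"

text \<open>A nonnegative self-adjoint operator has exactly one nonnegative self-adjoint square root.\<close>

definition op_sqrt :: "('h::real_inner \<rightharpoonup> 'h) \<Rightarrow> ('h \<rightharpoonup> 'h)" where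
  "op_sqrt A = (SOME S. self_adjoint S \<and> op_ge S 0 \<and> S \<circ>\<^sub>m S = A)"

text \<open>
  \<open>half_pow A n\<close> is the fractional power of order \<open>n/2\<close>, that is, the \<open>n\<close>-th power of the square
  root; \<open>H_half A n\<close> and \<open>H_norm A n\<close> are the corresponding space and norm for \<open>\<gamma> = n/2\<close>.
\<close>

definition half_pow :: "('h::real_inner \<rightharpoonup> 'h) \<Rightarrow> nat \<Rightarrow> ('h \<rightharpoonup> 'h)" where
  "half_pow A n = op_pow (op_sqrt A) n"

definition H_half :: "('h::real_inner \<rightharpoonup> 'h) \<Rightarrow> nat \<Rightarrow> 'h set" where
  "H_half A n = dom (half_pow A n)"

definition H_norm :: "('h::real_inner \<rightharpoonup> 'h) \<Rightarrow> nat \<Rightarrow> 'h \<Rightarrow> real" where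
  "H_norm A n x = norm (ap (half_pow A n) x)"

definition bounded_op :: "('h::real_normed_vector \<rightharpoonup> 'h) \<Rightarrow> bool" where
  "bounded_op B \<longleftrightarrow> dom B = UNIV \<and> bounded_linear (ap B)"

section \<open>Functions on the half-line\<close>

text \<open>
  Elements of the function spaces are represented by functions on the whole real line, whose
  values outside the open half-line and on null sets are irrelevant.
\<close>

abbreviation Rplus :: "real measure" where
  "Rplus \<equiv> lebesgue_on {0<..}"

definition L2 :: "(real \<Rightarrow> 'h::{real_inner,banach,second_countable_topology}) set" where
  "L2 = {f. f \<in> borel_measurable Rplus \<and> integrable Rplus (\<lambda>t. (norm (f t))\<^sup>2)}"

definition L2_norm :: "(real \<Rightarrow> 'h::{real_inner,banach,second_countable_topology}) \<Rightarrow> real" where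
  "L2_norm f = sqrt (LINT t|Rplus. (norm (f t))\<^sup>2)"

definition loc_integrable ::
    "(real \<Rightarrow> 'h::{real_inner,banach,second_countable_topology}) \<Rightarrow> bool" where
  "loc_integrable u \<longleftrightarrow> (\<forall>a b. 0 < a \<longrightarrow> integrable (lebesgue_on {a..b}) u)"

definition test_function :: "(real \<Rightarrow> real) \<Rightarrow> bool" where
  "test_function \<phi> \<longleftrightarrow> (\<forall>n t. (deriv ^^ n) \<phi> field_differentiable (at t))
     \<and> (\<exists>a b. 0 < a \<and> (\<forall>t. t \<notin> {a..b} \<longrightarrow> \<phi> t = 0))"

text \<open>\<open>v\<close> is the \<open>n\<close>-th derivative of \<open>u\<close> in the sense of distributions on the half-line.\<close>

definition has_weak_deriv ::
    "nat \<Rightarrow> (real \<Rightarrow> 'h) \<Rightarrow> (real \<Rightarrow> 'h::{real_inner,banach,second_countable_topology}) \<Rightarrow> bool" where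
  "has_weak_deriv n u v \<longleftrightarrow> loc_integrable u \<and> loc_integrable v
     \<and> (\<forall>\<phi>. test_function \<phi> \<longrightarrow>
          (LINT t|Rplus. (deriv ^^ n) \<phi> t *\<^sub>R u t) = (-1) ^ n *\<^sub>R (LINT t|Rplus. \<phi> t *\<^sub>R v t))"

text \<open>Determined by \<open>u\<close> up to equality almost everywhere on the half-line.\<close>

definition weak_deriv ::
    "nat \<Rightarrow> (real \<Rightarrow> 'h) \<Rightarrow> (real \<Rightarrow> 'h::{real_inner,banach,second_countable_topology})" where
  "weak_deriv n u = (SOME v. has_weak_deriv n u v)"

section \<open>The space \<open>W\<^sub>2\<^sup>3(R\<^sub>+; H; A)\<close> and operators defined on it\<close>

definition W23 ::
    "('h::{real_inner,banach,second_countable_topology} \<rightharpoonup> 'h) \<Rightarrow> (real \<Rightarrow> 'h) set" where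
  "W23 A = {u. (AE t in Rplus. u t \<in> dom (op_pow A 3))
     \<and> (\<exists>v\<in>L2. has_weak_deriv 3 u v) \<and> (\<lambda>t. ap (op_pow A 3) (u t)) \<in> L2}"

definition W23_norm ::
    "('h::{real_inner,banach,second_countable_topology} \<rightharpoonup> 'h) \<Rightarrow> (real \<Rightarrow> 'h) \<Rightarrow> real" where
  "W23_norm A u =
     sqrt ((L2_norm (weak_deriv 3 u))\<^sup>2 + (L2_norm (\<lambda>t. ap (op_pow A 3) (u t)))\<^sup>2)"

text \<open>
  Bounded linear operators from \<open>W23 A\<close> to \<open>H\<^sub>3\<^sub>/\<^sub>2\<close>.  Linearity and boundedness force \<open>K\<close> to
  respect equality almost everywhere, so \<open>K\<close> acts on equivalence classes.  In the operator norm,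
  elements of norm zero contribute \<open>0 / 0 = 0\<close>.
\<close>

definition bounded_W_H :: "('h::{real_inner,banach,second_countable_topology} \<rightharpoonup> 'h)
    \<Rightarrow> ((real \<Rightarrow> 'h) \<Rightarrow> 'h) \<Rightarrow> bool" where
  "bounded_W_H A K \<longleftrightarrow> (\<forall>u\<in>W23 A. K u \<in> H_half A 3)
     \<and> (\<forall>u\<in>W23 A. \<forall>v\<in>W23 A. K (\<lambda>t. u t + v t) = K u + K v)
     \<and> (\<forall>c. \<forall>u\<in>W23 A. K (\<lambda>t. c *\<^sub>R u t) = c *\<^sub>R K u)
     \<and> (\<exists>c. \<forall>u\<in>W23 A. H_norm A 3 (K u) \<le> c * W23_norm A u)"

definition norm_W_H :: "('h::{real_inner,banach,second_countable_topology} \<rightharpoonup> 'h)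
    \<Rightarrow> ((real \<Rightarrow> 'h) \<Rightarrow> 'h) \<Rightarrow> real" where
  "norm_W_H A K = (SUP u\<in>W23 A. H_norm A 3 (K u) / W23_norm A u)"

section \<open>The boundary value problem\<close>

text \<open>The derivatives of order 1 and 2 exist for every element of \<open>W23 A\<close>.\<close>

definition regular_solution ::
    "('h::{real_inner,banach,second_countable_topology} \<rightharpoonup> 'h) \<Rightarrow> (nat \<Rightarrow> 'h \<rightharpoonup> 'h)
     \<Rightarrow> (real \<Rightarrow> 'h) \<Rightarrow> (real \<Rightarrow> 'h) \<Rightarrow> bool" where
  "regular_solution A A' f u \<longleftrightarrow> u \<in> W23 A
     \<and> (AE t in Rplus. (\<forall>j\<in>{1..3}. weak_deriv (3 - j) u t \<in> dom (A' j))
          \<and> weak_deriv 3 u t - ap (op_pow A 3) (u t)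
              + (\<Sum>j=1..3. ap (A' j) (weak_deriv (3 - j) u t)) = f t)"

text \<open>
  Pointwise values of \<open>u\<close> and \<open>u'\<close> are those of their continuous representatives \<open>v\<close> and \<open>v'\<close>
  on the half-line, which are unique.
\<close>

definition boundary_conditions ::
    "('h::{real_inner,banach,second_countable_topology} \<rightharpoonup> 'h)
     \<Rightarrow> ((real \<Rightarrow> 'h) \<Rightarrow> 'h) \<Rightarrow> (real \<Rightarrow> 'h) \<Rightarrow> bool" where
  "boundary_conditions A K u \<longleftrightarrow> (\<exists>v v'.
       (AE t in Rplus. v t = u t) \<and> continuous_on {0<..} v
     \<and> has_weak_deriv 1 u v' \<and> continuous_on {0<..} v'
     \<and> (\<forall>t>0. v t \<in> H_half A 5) \<and> ((\<lambda>t. H_norm A 5 (v t)) \<longlongrightarrow> 0) (at_right 0)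
     \<and> (\<forall>t>0. v' t \<in> H_half A 3) \<and> ((\<lambda>t. H_norm A 3 (v' t - K u)) \<longlongrightarrow> 0) (at_right 0))"

definition regularly_solvable ::
    "('h::{real_inner,banach,second_countable_topology} \<rightharpoonup> 'h) \<Rightarrow> (nat \<Rightarrow> 'h \<rightharpoonup> 'h)
     \<Rightarrow> ((real \<Rightarrow> 'h) \<Rightarrow> 'h) \<Rightarrow> bool" where
  "regularly_solvable A A' K \<longleftrightarrow> (\<exists>c. \<forall>f\<in>L2. \<exists>u.
     regular_solution A A' f u \<and> boundary_conditions A K u \<and> W23_norm A u \<le> c * L2_norm f)"

definition C0 :: "real \<Rightarrow> real" where
  "C0 \<kappa> = (1 - \<kappa>) powr (-1/2)"

definition C1 :: "real \<Rightarrow> real" where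
  "C1 \<kappa> = 2 powr (1/3) / 3 powr (1/2)
     * (1 + 3 * \<kappa> powr (2/3) / 2 powr (1/3)) powr (1/2) * (1 - \<kappa>) powr (-1/2)"

definition C2 :: "real \<Rightarrow> real" where
  "C2 \<kappa> = 2 powr (1/3) / 3 powr (1/2)
     * ((1 + 3 powr (1/2) * \<kappa> powr (2/3)) / (1 - \<kappa>) powr (1/2))"

end

theory Submission
  imports Defs
begin

text \<open>
  With \<open>B = A\<^bsup>-1/2\<^esup>\<close>, a bounded injective symmetric operator, everything is expressed through powers of
  \<open>B\<close>, so that no spectral theorem is needed. For \<open>u\<close> with \<open>u(0) = 0\<close>, integration by parts gives
  \<open>\<parallel>u''' - A\<^sup>3u\<parallel>\<^sup>2 = \<parallel>u'''\<parallel>\<^sup>2 + \<parallel>A\<^sup>3u\<parallel>\<^sup>2 - \<parallel>A\<^bsup>3/2\<^esup>u'(0)\<parallel>\<^sup>2\<close>, together with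
  \<open>\<parallel>A\<^sup>2u'\<parallel>\<^sup>2 \<le> \<parallel>A\<^sup>3u\<parallel> \<parallel>Au''\<parallel>\<close> and
  \<open>\<parallel>Au''\<parallel>\<^sup>2 \<le> \<parallel>A\<^sup>2u'\<parallel> \<parallel>u'''\<parallel> + \<parallel>A\<^bsup>3/2\<^esup>u'(0)\<parallel> (2 \<parallel>Au''\<parallel> \<parallel>u'''\<parallel>)\<^bsup>1/2\<^esup>\<close>; these inequalities
  yield the constants of the theorem. The map \<open>u \<mapsto> (u''' - A\<^sup>3u, A\<^bsup>3/2\<^esup>u'(0))\<close> is thus bounded below on the
  closure of a space of regular functions, and it has dense range by comparison with the scalar
  equation \<open>u''' - c\<^sup>3u = f\<close>; hence it is bijective. The boundary operator \<open>K\<close> (relative bound \<open>\<kappa> < 1\<close>)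
  and then the lower order terms (relative bound \<open>\<alpha>(\<kappa>) < 1\<close>) are added
    by the contraction principle.
\<close>

section \<open>Hilbert space preliminaries\<close>

text \<open>For a general element of the space only A^(3-k) u^(k) is square-integrable, so A cannot
  be moved freely across inner products. Regular functions are therefore described by A^3 u^(k), so
  that every weight, half-integer ones included, is a bounded power of B. The closure is taken in a
  norm that also contains the sup norms of the two continuous functions, so that boundary values
  survive the limit. The energy identity makes u |-> (u''' - A^3 u, A^(3/2) u'(0)) isometric for the
  norm of W, hence K perturbs it with relative bound \<kappa>. The main obstacle is the dense range:
  the problem is a family of scalar equations over the spectrum of A, and in place of superposing
  them, commutation of A^(-3) with a skew-symmetric third derivative is exploited. The factor
  2^(1/3) / 3^(1/2) is the cube root of the maximum of a d^2 under a^2 + d^2 = 1, \<kappa>^(2/3) is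
  the cube root of \<kappa>^2, and (1 - \<kappa>)^(-1/2) comes from 1 - \<kappa>^2 \<ge> 1 -
  \<kappa>.\<close>

lemma norm_diff_sq_parallelogram:
  fixes a b :: "'a::real_inner"
  shows "(norm (a - b))\<^sup>2 = 2 * (norm a)\<^sup>2 + 2 * (norm b)\<^sup>2 - (norm (a + b))\<^sup>2"
  by (simp add: power2_norm_eq_inner inner_simps inner_commute)

text \<open>Midpoints of points of V stay in V, so by the parallelogram law a minimizing sequence is
  Cauchy; completeness and closedness give the limit.\<close>

lemma subspace_closest_point:
  fixes V :: "'a::{real_inner,banach} set"
  assumes V: "subspace V" "closed V"
  obtains v where "v \<in> V" "\<And>w. w \<in> V \<Longrightarrow> norm (x - v) \<le> norm (x - w)"
proof -
  define d where "d = infdist x V"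
  have ne: "V \<noteq> {}" using subspace_0[OF V(1)] by auto
  have d_le: "d \<le> norm (x - w)" if "w \<in> V" for w
    using infdist_le[OF that, of x] by (simp add: d_def dist_norm)
  have d0: "0 \<le> d" by (simp add: d_def infdist_nonneg)
  \<comment> \<open>The slack is put on the squared distance, because the parallelogram law then
    bounds squared gaps by 2/(m+1) + 2/(n+1), with d cancelling.\<close>
  have "\<exists>w\<in>V. (norm (x - w))\<^sup>2 < d\<^sup>2 + 1 / real (Suc n)" for n
  proof -
    have "d < sqrt (d\<^sup>2 + 1 / real (Suc n))"
      by (rule real_less_rsqrt) simp
    then have "(INF a\<in>V. dist x a) < sqrt (d\<^sup>2 + 1 / real (Suc n))"
      using ne by (simp add: d_def infdist_def)
    then obtain w where w: "w \<in> V" "dist x w < sqrt (d\<^sup>2 + 1 / real (Suc n))"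
      by (subst (asm) cINF_less_iff) (auto intro!: bdd_belowI2[where m = 0] ne)
    have "(dist x w)\<^sup>2 < (sqrt (d\<^sup>2 + 1 / real (Suc n)))\<^sup>2"
      using w(2) by (intro power_strict_mono) auto
    then show ?thesis using w(1) by (auto simp: dist_norm add_nonneg_nonneg)
  qed
  then obtain v where v: "\<And>n. v n \<in> V"
    "\<And>n. (norm (x - v n))\<^sup>2 < d\<^sup>2 + 1 / real (Suc n)"
    by metis
  have key: "(norm (v m - v n))\<^sup>2 \<le> 2 / real (Suc m) + 2 / real (Suc n)" for m n
  proof -
    have "(1/2) *\<^sub>R (v m + v n) \<in> V"
      using V(1) v(1) by (intro subspace_scale subspace_add) auto
    from d_le[OF this] have "d\<^sup>2 \<le> (norm (x - (1/2) *\<^sub>R (v m + v n)))\<^sup>2"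
      using d0 by (intro power_mono) auto
    moreover have "(x - v m) + (x - v n) = 2 *\<^sub>R (x - (1/2) *\<^sub>R (v m + v n))"
      by (simp add: algebra_simps flip: scaleR_2)
    then have "norm ((x - v m) + (x - v n)) = 2 * norm (x - (1/2) *\<^sub>R (v m + v n))"
      by (metis abs_numeral norm_scaleR)
    ultimately have "4 * d\<^sup>2 \<le> (norm ((x - v m) + (x - v n)))\<^sup>2"
      by (simp add: power_mult_distrib)
    moreover have "(norm (v m - v n))\<^sup>2 = (norm ((x - v m) - (x - v n)))\<^sup>2"
      by (simp add: norm_minus_commute)
    ultimately show ?thesis
      using norm_diff_sq_parallelogram[of "x - v m" "x - v n"] v(2)[of m] v(2)[of n] by simp
  qed
  have "Cauchy v"
  proof (rule metric_CauchyI)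
    fix e :: real assume e: "e > 0"
    then obtain N where N: "4 / e\<^sup>2 < real N" using reals_Archimedean2 by blast
    have "dist (v m) (v n) < e" if "m \<ge> N" "n \<ge> N" for m n
    proof -
      have *: "2 / real (Suc k) < e\<^sup>2 / 2" if "k \<ge> N" for k
      proof -
        have "4 / e\<^sup>2 < real (Suc k)" using N that by linarith
        then show ?thesis using e by (simp add: field_simps)
      qed
      have "(norm (v m - v n))\<^sup>2 < e\<^sup>2" using key[of m n] *[OF that(1)] *[OF that(2)] by linarith
      then show ?thesis using e by (simp add: dist_norm power_less_imp_less_base)
    qed
    then show "\<exists>M. \<forall>m\<ge>M. \<forall>n\<ge>M. dist (v m) (v n) < e" by blast
  qed
  then obtain l where l: "v \<longlonglongrightarrow> l" using convergent_eq_Cauchy by blast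
  have "l \<in> V" using closed_sequentially[OF V(2) _ l] v(1) by blast
  moreover have "norm (x - l) \<le> norm (x - w)" if w: "w \<in> V" for w
  proof -
    have "(\<lambda>n. (norm (x - v n))\<^sup>2) \<longlonglongrightarrow> (norm (x - l))\<^sup>2"
      by (intro tendsto_intros l)
    moreover have "(\<lambda>n. d\<^sup>2 + 1 / real (Suc n)) \<longlonglongrightarrow> d\<^sup>2 + 0"
      by (intro tendsto_intros LIMSEQ_inverse_real_of_nat[unfolded inverse_eq_divide])
    ultimately have "(norm (x - l))\<^sup>2 \<le> d\<^sup>2"
      using v(2) by (intro LIMSEQ_le) (auto intro: less_imp_le)
    also have "\<dots> \<le> (norm (x - w))\<^sup>2" using d_le[OF w] d0 by (intro power_mono)
    finally show ?thesis by (rule power2_le_imp_le) simp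
  qed
  ultimately show ?thesis using that by blast
qed

lemma subspace_closure:
  fixes V :: "'a::real_normed_vector set"
  assumes V: "subspace V"
  shows "subspace (closure V)"
  unfolding subspace_def
proof (intro conjI ballI allI)
  show "0 \<in> closure V" using subspace_0[OF V] closure_subset by blast
  fix x assume "x \<in> closure V"
  then obtain f where f: "\<And>n. f n \<in> V" "f \<longlonglongrightarrow> x" unfolding closure_sequential
    by blast
  show "c *\<^sub>R x \<in> closure V" for c
    unfolding closure_sequential using f subspace_scale[OF V]
    by (intro exI[of _ "\<lambda>n. c *\<^sub>R f n"]) (auto intro!: tendsto_intros)
  fix y assume "y \<in> closure V"
  then obtain g where g: "\<And>n. g n \<in> V" "g \<longlonglongrightarrow> y" unfolding closure_sequential
    by blast
  show "x + y \<in> closure V"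
    unfolding closure_sequential using f g subspace_add[OF V]
    by (intro exI[of _ "\<lambda>n. f n + g n"]) (auto intro!: tendsto_intros)
qed

text \<open>The residual of the closest point in the closure is orthogonal to V. Density claims
  below are checked in this form: no nonzero vector may be orthogonal to the range.\<close>

lemma dense_if_orthogonal_trivial:
  fixes V :: "'a::{real_inner,banach} set"
  assumes V: "subspace V"
    and orth: "\<And>z. (\<And>v. v \<in> V \<Longrightarrow> z \<bullet> v = 0) \<Longrightarrow> z = 0"
  shows "closure V = UNIV"
proof -
  have "x \<in> closure V" for x
  proof -
    have sub: "subspace (closure V)" using V by (rule subspace_closure)
    obtain v where v: "v \<in> closure V"
      "\<And>w. w \<in> closure V \<Longrightarrow> norm (x - v) \<le> norm (x - w)"
      using subspace_closest_point[OF sub closed_closure] by blast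
    have "(x - v) \<bullet> w = 0" if w: "w \<in> V" for w
    proof (cases "w = 0")
      case False
      \<comment> \<open>This t minimizes norm ((x - v) - t w); the square drops by the last term
        below unless w is orthogonal to x - v.\<close>
      define t where "t = ((x - v) \<bullet> w) / (w \<bullet> w)"
      have "v + t *\<^sub>R w \<in> closure V"
        using v(1) w sub closure_subset[of V] by (intro subspace_add subspace_scale) auto
      then have "(norm (x - v))\<^sup>2 \<le> (norm ((x - v) - t *\<^sub>R w))\<^sup>2"
        using v(2) by (intro power_mono) (auto simp: algebra_simps)
      also have "\<dots> = (norm (x - v))\<^sup>2 - ((x - v) \<bullet> w)\<^sup>2 / (w \<bullet> w)"
        using False unfolding power2_norm_eq_inner t_def
        by (simp add: inner_simps inner_commute field_simps power2_eq_square)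
      finally show ?thesis using False by (simp add: divide_le_0_iff field_simps)
    qed simp
    then have "x - v = 0" using orth by blast
    then show ?thesis using v(1) by simp
  qed
  then show ?thesis by auto
qed

section \<open>Injective symmetric operators and their inverses\<close>

text \<open>The bounded operators whose inverse is self-adjoint:
  \<open>self_adjoint_of_inverse\<close> goes one way, \<open>self_adjoint_inverse\<close> the other
  for operators bounded below by a positive constant.\<close>

definition inj_sym :: "('a::real_inner \<Rightarrow> 'a) \<Rightarrow> bool" where
  "inj_sym B \<longleftrightarrow> bounded_linear B \<and> (\<forall>x y. B x \<bullet> y = x \<bullet> B y) \<and> (\<forall>x. B x = 0 \<longrightarrow> x = 0)"

lemma inj_symD:
  assumes "inj_sym B"
  shows "bounded_linear B" "B x \<bullet> y = x \<bullet> B y" "B x = 0 \<Longrightarrow> x = 0"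
    "B x = B y \<longleftrightarrow> x = y"
proof -
  show bl: "bounded_linear B" and "B x \<bullet> y = x \<bullet> B y"
    and 0: "\<And>x. B x = 0 \<Longrightarrow> x = 0"
    using assms by (auto simp: inj_sym_def)
  interpret bounded_linear B by (fact bl)
  show "B x = B y \<longleftrightarrow> x = y" using 0[of "x - y"] by (auto simp: diff)
qed

lemma inj_sym_funpow: "inj_sym B \<Longrightarrow> inj_sym (B ^^ n)"
proof (induction n)
  case 0
  then show ?case by (simp add: inj_sym_def bounded_linear_ident)
next
  case (Suc n)
  then have IH: "inj_sym (B ^^ n)" and B: "inj_sym B" by auto
  have "bounded_linear (\<lambda>x. B ((B ^^ n) x))"
    by (rule bounded_linear_compose[OF inj_symD(1)[OF B] inj_symD(1)[OF IH]])
  moreover have "B ((B ^^ n) x) \<bullet> y = x \<bullet> B ((B ^^ n) y)" for x y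
    using inj_symD(2)[OF B, of "(B ^^ n) x" y] inj_symD(2)[OF IH, of x "B y"] funpow_swap1[of B n y] by simp
  moreover have "\<forall>x. B ((B ^^ n) x) = 0 \<longrightarrow> x = 0"
    using inj_symD(3)[OF B] inj_symD(3)[OF IH] by blast
  ultimately show ?case unfolding inj_sym_def funpow.simps o_def by blast
qed

text \<open>By symmetry a vector z orthogonal to the range satisfies B z . B z = z . B (B z) = 0,
  and B is injective.\<close>

lemma inj_sym_range_dense:
  fixes B :: "'a::{real_inner,banach} \<Rightarrow> 'a"
  assumes B: "inj_sym B"
  shows "closure (range B) = UNIV"
proof (rule dense_if_orthogonal_trivial)
  interpret bounded_linear B using B by (rule inj_symD)
  show "subspace (range B)" by (rule subspace_UNIV[THEN linear_subspace_image[OF linear]])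
  fix z assume *: "\<And>v. v \<in> range B \<Longrightarrow> z \<bullet> v = 0"
  have "B z \<bullet> B z = z \<bullet> B (B z)" using inj_symD(2)[OF B] by blast
  then have "B z = 0" using * by simp
  then show "z = 0" using inj_symD(3)[OF B] by blast
qed

lemma dense_orthogonal_eq:
  fixes x y :: "'a::real_inner"
  assumes "closure D = UNIV" "\<And>d. d \<in> D \<Longrightarrow> d \<bullet> x = d \<bullet> y"
  shows "x = y"
proof -
  have "closed {d. d \<bullet> x = d \<bullet> y}" by (intro closed_Collect_eq continuous_intros)
  then have "closure D \<subseteq> {d. d \<bullet> x = d \<bullet> y}" using assms(2)
    by (intro closure_minimal) auto
  then have "(x - y) \<bullet> x = (x - y) \<bullet> y" using assms(1) by auto
  then have "(x - y) \<bullet> (x - y) = 0" by (simp add: inner_simps)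
  then show ?thesis by simp
qed

text \<open>Density of the domain makes the adjoint single-valued, so the definite description in
  \<open>adjoint_op\<close> can be replaced by its defining property.\<close>

lemma adjoint_op_Some_iff:
  fixes T :: "'a::real_inner \<rightharpoonup> 'a"
  assumes "closure (dom T) = UNIV"
  shows "adjoint_op T y = Some z \<longleftrightarrow> (\<forall>x\<in>dom T. ap T x \<bullet> y = x \<bullet> z)"
proof -
  have uniq: "z = z'" if "\<forall>x\<in>dom T. ap T x \<bullet> y = x \<bullet> z"
    "\<forall>x\<in>dom T. ap T x \<bullet> y = x \<bullet> z'" for z z'
    using that by (intro dense_orthogonal_eq[OF assms]) auto
  have "(THE z. \<forall>x\<in>dom T. ap T x \<bullet> y = x \<bullet> z) = z"
    if "\<forall>x\<in>dom T. ap T x \<bullet> y = x \<bullet> z" for z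
    by (rule the_equality) (use that uniq in blast)+
  then show ?thesis unfolding adjoint_op_def by (smt (verit) option.inject option.distinct(1))
qed

lemma linear_opD:
  assumes "linear_op T" "T x = Some a" "T y = Some b"
  shows "T (x + y) = Some (a + b)" "T (c *\<^sub>R x) = Some (c *\<^sub>R a)" "T (x - y) = Some (a - b)"
proof -
  have plus: "T (x + y) = Some (a + b)" if "T x = Some a" "T y = Some b" for x y a b
  proof -
    have "x + y \<in> dom T" using assms(1) that unfolding linear_op_def
      by (metis domI subspace_add)
    moreover have "ap T (x + y) = a + b" using assms(1) that unfolding linear_op_def
      by (metis domI option.sel)
    ultimately show ?thesis by (metis domD option.sel)
  qed
  have scale: "T (c *\<^sub>R x) = Some (c *\<^sub>R a)" if "T x = Some a" for x a c
  proof -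
    have "c *\<^sub>R x \<in> dom T" using assms(1) that unfolding linear_op_def
      by (metis domI subspace_scale)
    moreover have "ap T (c *\<^sub>R x) = c *\<^sub>R a" using assms(1) that unfolding linear_op_def
      by (metis domI option.sel)
    ultimately show ?thesis by (metis domD option.sel)
  qed
  show "T (x + y) = Some (a + b)" "T (c *\<^sub>R x) = Some (c *\<^sub>R a)"
    using plus scale assms by auto
  show "T (x - y) = Some (a - b)"
    using plus[OF assms(2) scale[OF assms(3), of "-1"]] by simp
qed

lemma linear_opD0: "linear_op T \<Longrightarrow> T 0 = Some 0"
  unfolding linear_op_def by (metis domD option.sel scale_zero_left subspace_0)

text \<open>R is everywhere defined and inverts T on both sides. Domains of unbounded operators
  thereby become ranges of bounded ones, and powers of T turn into powers of R.\<close>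

definition graph_inv :: "('a \<rightharpoonup> 'a) \<Rightarrow> ('a \<Rightarrow> 'a) \<Rightarrow> bool" where
  "graph_inv T R \<longleftrightarrow> (\<forall>x y. T x = Some y \<longleftrightarrow> x = R y)"

lemma graph_inv_op_pow: "graph_inv T R \<Longrightarrow> graph_inv (op_pow T n) (R ^^ n)"
proof (induction n)
  case (Suc n)
  then have IH: "\<And>x y. op_pow T n x = Some y \<longleftrightarrow> x = (R ^^ n) y"
    and T: "\<And>x y. T x = Some y \<longleftrightarrow> x = R y" by (auto simp: graph_inv_def)
  show ?case unfolding graph_inv_def
    by (simp add: map_comp_Some_iff IH T funpow_swap1)
qed (simp add: graph_inv_def)

lemma graph_inv_op_inv: "graph_inv T R \<Longrightarrow> op_inv T = (\<lambda>y. Some (R y))"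
  by (auto simp: graph_inv_def op_inv_def)

lemma graph_inv_dom: "graph_inv T R \<Longrightarrow> dom T = range R"
  unfolding graph_inv_def dom_def by auto

lemma graph_inv_ap: "graph_inv T R \<Longrightarrow> ap T (R y) = y"
  unfolding graph_inv_def by (metis option.sel)

text \<open>The form bound gives \<mu> |x| \<le> |A x| by Cauchy-Schwarz, hence injectivity and a
  closed range; the orthogonal complement of the range is the kernel of the adjoint, which is A
  itself, so the range is everything.\<close>

lemma self_adjoint_inverse:
  fixes A :: "'a::{real_inner,banach} \<rightharpoonup> 'a"
  assumes A: "self_adjoint A" and \<mu>: "\<mu> > 0" "op_ge A \<mu>"
  obtains R where "inj_sym R" "graph_inv A R" "\<And>x. 0 \<le> x \<bullet> R x"
proof -
  have lin: "linear_op A" and dense: "closure (dom A) = UNIV" and adj: "adjoint_op A = A"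
    using A by (auto simp: self_adjoint_def)
  have sym: "A y = Some z \<longleftrightarrow> (\<forall>x\<in>dom A. ap A x \<bullet> y = x \<bullet> z)"
    for y z
    using adjoint_op_Some_iff[OF dense] adj by metis
  have lower: "\<mu> * norm x \<le> norm y" if "A x = Some y" for x y
  proof (cases "x = 0")
    case False
    have "\<mu> * (x \<bullet> x) \<le> y \<bullet> x" using \<mu>(2) that unfolding op_ge_def
      by (metis domI option.sel)
    also have "\<dots> \<le> norm y * norm x" by (rule norm_cauchy_schwarz)
    finally show ?thesis using False
      by (simp add: power2_norm_eq_inner[symmetric] power2_eq_square)
  qed (use \<mu>(1) in simp)
  define V where "V = {y. \<exists>x. A x = Some y}"
  have inj: "x = x'" if "A x = Some y" "A x' = Some y" for x x' y
    using lower[OF linear_opD(3)[OF lin that]] \<mu>(1) by (simp add: mult_le_0_iff)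
  have subV: "subspace V"
    unfolding subspace_def V_def using linear_opD0[OF lin] linear_opD(1,2)[OF lin] by blast
  have "closure V = UNIV"
  proof (rule dense_if_orthogonal_trivial[OF subV])
    fix z assume z: "\<And>v. v \<in> V \<Longrightarrow> z \<bullet> v = 0"
    have "A z = Some 0" unfolding sym
    proof
      fix x assume "x \<in> dom A"
      then have "ap A x \<in> V" unfolding V_def by (auto simp: dom_def)
      from z[OF this] show "ap A x \<bullet> z = x \<bullet> 0" by (simp add: inner_commute)
    qed
    from lower[OF this] show "z = 0" using \<mu>(1) by (simp add: mult_le_0_iff)
  qed
  moreover have "closed V" unfolding closed_sequential_limits
  proof (intro allI impI)
    fix y l assume "(\<forall>n. y n \<in> V) \<and> y \<longlonglongrightarrow> l"
    then have y: "\<And>n. y n \<in> V" and l: "y \<longlonglongrightarrow> l" by auto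
    from y obtain x where x: "\<And>n. A (x n) = Some (y n)" unfolding V_def by (auto, metis)
    have "Cauchy x"
    proof (rule metric_CauchyI)
      fix e :: real assume "e > 0"
      then obtain M where M: "\<And>m n. m \<ge> M \<Longrightarrow> n \<ge> M \<Longrightarrow> dist (y m) (y n) < \<mu> * e"
        using LIMSEQ_imp_Cauchy[OF l] \<mu>(1) unfolding Cauchy_def
        by (metis mult_pos_pos)
      have "dist (x m) (x n) < e" if "m \<ge> M" "n \<ge> M" for m n
      proof -
        have "\<mu> * dist (x m) (x n) < \<mu> * e"
          using lower[OF linear_opD(3)[OF lin x x], of m n] M[OF that] by (simp add: dist_norm)
        then show ?thesis using \<mu>(1) by simp
      qed
      then show "\<exists>M. \<forall>m\<ge>M. \<forall>n\<ge>M. dist (x m) (x n) < e" by blast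
    qed
    then obtain w where w: "x \<longlonglongrightarrow> w" using convergent_eq_Cauchy by blast
    \<comment> \<open>The graph is closed because A is its own adjoint: the defining relation passes
      to the limit.\<close>
    have "A w = Some l" unfolding sym
    proof
      fix z assume "z \<in> dom A"
      then obtain a where a: "A z = Some a" by blast
      have "a \<bullet> x n = z \<bullet> y n" for n
        using x[of n, unfolded sym] a by (metis domI option.sel)
      moreover have "(\<lambda>n. a \<bullet> x n) \<longlonglongrightarrow> a \<bullet> w"
        "(\<lambda>n. z \<bullet> y n) \<longlonglongrightarrow> z \<bullet> l"
        by (intro tendsto_intros w l)+
      ultimately show "ap A z \<bullet> w = z \<bullet> l" using a LIMSEQ_unique by simp
    qed
    then show "l \<in> V" by (auto simp: V_def)
  qed
  ultimately have surj: "\<exists>x. A x = Some y" for y using closure_closed[of V] by (auto simp: V_def)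
  then obtain R where R: "\<And>y. A (R y) = Some y" by metis
  have gr: "graph_inv A R" unfolding graph_inv_def using R inj by metis
  have "bounded_linear R"
  proof (rule bounded_linear_intro[where K = "1 / \<mu>"])
    show "R (x + y) = R x + R y" for x y using linear_opD(1)[OF lin R R] R inj by metis
    show "R (c *\<^sub>R x) = c *\<^sub>R R x" for c x using linear_opD(2)[OF lin R R] R inj by metis
    show "norm (R x) \<le> norm x * (1 / \<mu>)" for x using lower[OF R, of x] \<mu>(1)
      by (simp add: field_simps)
  qed
  moreover have "R x \<bullet> y = x \<bullet> R y" for x y
  proof -
    have "x \<bullet> R y = R x \<bullet> y" using R[of y, unfolded sym] R[of x] by (metis domI option.sel)
    then show ?thesis by simp
  qed
  moreover have "x = 0" if "R x = 0" for x using R[of x] linear_opD0[OF lin] that by simp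
  moreover have "0 \<le> x \<bullet> R x" for x
  proof -
    have "\<mu> * (R x \<bullet> R x) \<le> x \<bullet> R x" using \<mu>(2) R[of x] unfolding op_ge_def
      by (metis domI option.sel)
    then show ?thesis using \<mu>(1) by (smt (verit) inner_ge_zero mult_nonneg_nonneg)
  qed
  ultimately have "inj_sym R" "\<And>x. 0 \<le> x \<bullet> R x" unfolding inj_sym_def by blast+
  then show ?thesis using that gr by blast
qed

text \<open>On \<open>range B\<close> the adjoint relation reads w . y = B w . z for all w, which by
  symmetry of B says y = B z, that is, T y = z.\<close>

lemma self_adjoint_of_inverse:
  fixes B :: "'a::{real_inner,banach} \<Rightarrow> 'a"
  assumes B: "inj_sym B" and T: "graph_inv T B"
  shows "self_adjoint T"
proof -
  interpret bounded_linear B using B by (rule inj_symD)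
  have dom: "dom T = range B" using T by (rule graph_inv_dom)
  have ap: "ap T (B x) = x" for x using T by (rule graph_inv_ap)
  have "linear_op T" unfolding linear_op_def dom
    using ap by (auto simp: linear_subspace_image[OF linear subspace_UNIV] simp flip: add scaleR)
  moreover have dense: "closure (dom T) = UNIV" unfolding dom using B by (rule inj_sym_range_dense)
  moreover have "adjoint_op T = T"
  proof -
    have "adjoint_op T y = Some z \<longleftrightarrow> T y = Some z" for y z
    proof -
      have "adjoint_op T y = Some z \<longleftrightarrow> (\<forall>w. w \<bullet> y = B w \<bullet> z)"
        unfolding adjoint_op_Some_iff[OF dense] dom using ap by auto
      also have "\<dots> \<longleftrightarrow> (\<forall>w. w \<bullet> y = w \<bullet> B z)"
        using inj_symD(2)[OF B] by simp
      also have "\<dots> \<longleftrightarrow> y = B z" using dense_orthogonal_eq[of UNIV y "B z"] by auto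
      finally show ?thesis using T by (simp add: graph_inv_def)
    qed
    then show ?thesis by (intro ext) (metis not_None_eq)
  qed
  ultimately show ?thesis by (simp add: self_adjoint_def)
qed


section \<open>Square roots of bounded positive operators\<close>

text \<open>The iteration \<open>X \<mapsto> (C + X\<^sup>2) / 2\<close> converges to \<open>1 - (1 - C)\<^bsup>1/2\<^esup>\<close>; its increments are dominated
  in norm by those of the scalar iteration with \<open>C = 1\<close>.\<close>

primrec sqrt_iter :: "('a::real_normed_vector \<Rightarrow>\<^sub>L 'a) \<Rightarrow> nat \<Rightarrow> ('a \<Rightarrow>\<^sub>L 'a)" where
  "sqrt_iter C 0 = 0"
| "sqrt_iter C (Suc n) = (1/2) *\<^sub>R (C + (sqrt_iter C n o\<^sub>L sqrt_iter C n))"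

primrec sqrt_majorant :: "nat \<Rightarrow> real" where
  "sqrt_majorant 0 = 0"
| "sqrt_majorant (Suc n) = (1 + (sqrt_majorant n)\<^sup>2) / 2"

lemma sqrt_majorant_bounds: "0 \<le> sqrt_majorant n" "sqrt_majorant n \<le> 1"
proof (induction n)
  case (Suc n)
  { case 1 then show ?case by simp }
  { case 2 then show ?case using Suc power_le_one[of "sqrt_majorant n" 2] by simp }
qed auto

lemma sqrt_majorant_mono: "sqrt_majorant n \<le> sqrt_majorant (Suc n)"
proof -
  have "0 \<le> (1 - sqrt_majorant n)\<^sup>2" by simp
  then show ?thesis by (simp add: power2_eq_square algebra_simps)
qed

lemma blinfun_compose_simps:
  "(A + B) o\<^sub>L C = (A o\<^sub>L C) + (B o\<^sub>L C)"
    "A o\<^sub>L (B + C) = (A o\<^sub>L B) + (A o\<^sub>L C)"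
  "(A - B) o\<^sub>L C = (A o\<^sub>L C) - (B o\<^sub>L C)"
    "A o\<^sub>L (B - C) = (A o\<^sub>L B) - (A o\<^sub>L C)"
  "(r *\<^sub>R A) o\<^sub>L C = r *\<^sub>R (A o\<^sub>L C)"
    "A o\<^sub>L (r *\<^sub>R C) = r *\<^sub>R (A o\<^sub>L C)"
  by (auto intro!: blinfun_eqI simp: blinfun.bilinear_simps)

text \<open>Stated for any D commuting with C, so that applying it first to C and then to an iterate
  makes all iterates commute with each other.\<close>

lemma sqrt_iter_commute:
  assumes "D o\<^sub>L C = C o\<^sub>L D"
  shows "D o\<^sub>L sqrt_iter C n = sqrt_iter C n o\<^sub>L D"
proof (induction n)
  case (Suc n)
  have "D o\<^sub>L (sqrt_iter C n o\<^sub>L sqrt_iter C n) = (sqrt_iter C n o\<^sub>L sqrt_iter C n) o\<^sub>L D"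
    using Suc by (auto intro!: blinfun_eqI dest!: arg_cong[of _ _ blinfun_apply] simp: fun_eq_iff)
  then show ?case by (simp add: blinfun_compose_simps assms)
qed simp

lemma sqrt_iter_norm:
  assumes "norm C \<le> 1"
  shows "norm (sqrt_iter C n) \<le> sqrt_majorant n"
proof (induction n)
  case (Suc n)
  have "norm (sqrt_iter C n o\<^sub>L sqrt_iter C n) \<le> norm (sqrt_iter C n) * norm (sqrt_iter C n)"
    by (rule norm_blinfun_compose)
  also have "\<dots> \<le> (sqrt_majorant n)\<^sup>2"
    unfolding power2_eq_square using Suc by (intro mult_mono) (auto simp: sqrt_majorant_bounds)
  finally have "norm (C + (sqrt_iter C n o\<^sub>L sqrt_iter C n)) \<le> 1 + (sqrt_majorant n)\<^sup>2"
    using assms by (intro norm_triangle_le) linarith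
  then show ?case by simp
qed simp

lemma blinfun_diff_square:
  fixes X Y :: "'a::real_normed_vector \<Rightarrow>\<^sub>L 'a"
  assumes "X o\<^sub>L Y = Y o\<^sub>L X"
  shows "(X - Y) o\<^sub>L (X + Y) = (X o\<^sub>L X) - (Y o\<^sub>L Y)"
proof -
  have "(X - Y) o\<^sub>L (X + Y) = ((X o\<^sub>L X) + (X o\<^sub>L Y)) - ((Y o\<^sub>L X) + (Y o\<^sub>L Y))"
    by (simp add: blinfun_compose_simps)
  then show ?thesis using assms by simp
qed

text \<open>Commuting iterates allow X^2 - Y^2 = (X - Y)(X + Y); the same factorization of the
  scalar increments turns the product of norms into the next scalar increment.\<close>

lemma sqrt_iter_increment:
  assumes "norm C \<le> 1"
  shows "norm (sqrt_iter C (Suc n) - sqrt_iter C n) \<le> sqrt_majorant (Suc n) - sqrt_majorant n"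
proof (induction n)
  case 0
  then show ?case using assms by simp
next
  case (Suc n)
  define X Y where "X = sqrt_iter C (Suc n)" and "Y = sqrt_iter C n"
  define x y where "x = sqrt_majorant (Suc n)" and "y = sqrt_majorant n"
  have "C o\<^sub>L X = X o\<^sub>L C" unfolding X_def by (rule sqrt_iter_commute) simp
  then have comm: "X o\<^sub>L Y = Y o\<^sub>L X" unfolding Y_def by (intro sqrt_iter_commute) simp
  have "sqrt_iter C (Suc (Suc n)) - X = (1/2) *\<^sub>R ((C + (X o\<^sub>L X)) - (C + (Y o\<^sub>L Y)))"
    unfolding X_def Y_def by (simp only: sqrt_iter.simps scaleR_diff_right)
  also have "(C + (X o\<^sub>L X)) - (C + (Y o\<^sub>L Y)) = (X - Y) o\<^sub>L (X + Y)"
    using blinfun_diff_square[OF comm] by simp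
  finally have "norm (sqrt_iter C (Suc (Suc n)) - X) = norm ((X - Y) o\<^sub>L (X + Y)) / 2" by simp
  also have "\<dots> \<le> norm (X - Y) * norm (X + Y) / 2"
    by (intro divide_right_mono norm_blinfun_compose) auto
  also have "\<dots> \<le> (x - y) * (x + y) / 2"
  proof -
    have "norm (X - Y) \<le> x - y" using Suc by (simp add: X_def Y_def x_def y_def)
    moreover have "norm (X + Y) \<le> x + y" unfolding X_def Y_def x_def y_def
      by (intro norm_triangle_mono sqrt_iter_norm assms)
    ultimately show ?thesis
      using sqrt_majorant_mono[of n]
        by (intro divide_right_mono mult_mono) (auto simp: x_def y_def simp del: sqrt_majorant.simps)
  qed
  also have "\<dots> = sqrt_majorant (Suc (Suc n)) - sqrt_majorant (Suc n)"
    unfolding sqrt_majorant.simps(2)[of "Suc n"] x_def[symmetric]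
    unfolding x_def sqrt_majorant.simps(2)[of n] y_def[symmetric]
    by (simp add: field_simps power2_eq_square)
  finally show ?case by (simp only: X_def)
qed

text \<open>The scalar iteration is monotone and bounded, and its telescoping increments dominate,
  so the operator iteration is Cauchy. The limit equation says (1 - Y)^2 = 1 - C.\<close>

lemma sqrt_iter_convergent:
  fixes C :: "'a::banach \<Rightarrow>\<^sub>L 'a"
  assumes "norm C \<le> 1"
  obtains Y where "sqrt_iter C \<longlonglongrightarrow> Y" "norm Y \<le> 1"
    "2 *\<^sub>R Y = C + (Y o\<^sub>L Y)"
proof -
  have diff: "norm (sqrt_iter C m - sqrt_iter C n) \<le> sqrt_majorant m - sqrt_majorant n" if "n \<le> m"
    for m n
    using that
  proof (induction m rule: dec_induct)
    case (step k)
    have "sqrt_iter C (Suc k) - sqrt_iter C n = (sqrt_iter C (Suc k) - sqrt_iter C k) + (sqrt_iter C k - sqrt_iter C n)"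
      by (simp del: sqrt_iter.simps)
    then show ?case
      using norm_triangle_ineq[of "sqrt_iter C (Suc k) - sqrt_iter C k" "sqrt_iter C k - sqrt_iter C n"]
        step sqrt_iter_increment[OF assms, of k] by (simp del: sqrt_iter.simps sqrt_majorant.simps)
  qed simp
  have "convergent sqrt_majorant"
    by (intro Bseq_mono_convergent BseqI'[of _ 1])
       (auto intro: lift_Suc_mono_le[of sqrt_majorant] simp: sqrt_majorant_bounds sqrt_majorant_mono simp del: sqrt_majorant.simps)
  then have C: "Cauchy sqrt_majorant" by (rule convergent_Cauchy)
  have "Cauchy (sqrt_iter C)"
  proof (rule metric_CauchyI)
    fix e :: real assume "e > 0"
    then obtain M where M: "\<And>m n. m \<ge> M \<Longrightarrow> n \<ge> M \<Longrightarrow> dist (sqrt_majorant m) (sqrt_majorant n) < e"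
      using C unfolding Cauchy_def by metis
    have le: "dist (sqrt_iter C m) (sqrt_iter C n) < e" if "n \<ge> M" "n \<le> m" for m n
      using M[of m n] diff[OF that(2)] that by (simp add: dist_norm)
    have "dist (sqrt_iter C m) (sqrt_iter C n) < e" if "m \<ge> M" "n \<ge> M" for m n
      using le[of n m] le[of m n] that by (cases "n \<le> m") (auto simp: dist_commute)
    then show "\<exists>M. \<forall>m\<ge>M. \<forall>n\<ge>M. dist (sqrt_iter C m) (sqrt_iter C n) < e"
      by blast
  qed
  then obtain Y where Y: "sqrt_iter C \<longlonglongrightarrow> Y" using convergent_eq_Cauchy by blast
  have "norm Y \<le> 1"
    using sqrt_iter_norm[OF assms] sqrt_majorant_bounds(2)
    by (intro LIMSEQ_le_const2[OF tendsto_norm[OF Y]]) (meson order_trans)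
  moreover have "2 *\<^sub>R Y = C + (Y o\<^sub>L Y)"
  proof -
    have "(\<lambda>n. 2 *\<^sub>R sqrt_iter C (Suc n)) \<longlonglongrightarrow> 2 *\<^sub>R Y"
      by (intro tendsto_intros LIMSEQ_Suc Y)
    moreover have "(\<lambda>n. 2 *\<^sub>R sqrt_iter C (Suc n)) = (\<lambda>n. C + (sqrt_iter C n o\<^sub>L sqrt_iter C n))"
      by simp
    moreover have "(\<lambda>n. C + (sqrt_iter C n o\<^sub>L sqrt_iter C n)) \<longlonglongrightarrow> C + (Y o\<^sub>L Y)"
      by (intro tendsto_intros bounded_bilinear.tendsto[OF bounded_bilinear_blinfun_compose] Y)
    ultimately show ?thesis using LIMSEQ_unique by metis
  qed
  ultimately show ?thesis using that Y by blast
qed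

lemma sqrt_iter_symmetric:
  fixes C :: "'a::real_inner \<Rightarrow>\<^sub>L 'a"
  assumes "\<And>x y. C x \<bullet> y = x \<bullet> C y"
  shows "sqrt_iter C n x \<bullet> y = x \<bullet> sqrt_iter C n y"
  by (induction n arbitrary: x y) (auto simp: blinfun.bilinear_simps inner_simps assms)

text \<open>Scaling by a norm bound M turns R into M (1 - C) with C a contraction; then B = M^(1/2)
  (1 - Y).\<close>

lemma bounded_positive_sqrt:
  fixes R :: "'a::{real_inner,banach} \<Rightarrow> 'a"
  assumes R: "bounded_linear R" and sym: "\<And>x y. R x \<bullet> y = x \<bullet> R y"
    and pos: "\<And>x. 0 \<le> x \<bullet> R x"
  obtains B where "bounded_linear B" "\<And>x y. B x \<bullet> y = x \<bullet> B y"
    "\<And>x. 0 \<le> x \<bullet> B x" "\<And>x. B (B x) = R x"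
proof -
  interpret R: bounded_linear R by (fact R)
  obtain M where M: "M > 0" "\<And>x. norm (R x) \<le> norm x * M" using R.pos_bounded by blast
  \<comment> \<open>Positivity tested at x - R x / M. It replaces the spectral bound in showing that
    1 - R / M is a contraction.\<close>
  have ineq: "(norm (R x))\<^sup>2 \<le> M * (x \<bullet> R x)" for x
  proof -
    let ?z = "x - (1 / M) *\<^sub>R R x"
    have "0 \<le> ?z \<bullet> R ?z" by (rule pos)
    also have "\<dots> = x \<bullet> R x - 2 / M * (norm (R x))\<^sup>2 + (R x \<bullet> R (R x)) / M\<^sup>2"
      unfolding power2_norm_eq_inner
      using sym[of x "R x"] M(1)
      by (simp add: R.diff R.scaleR inner_simps power2_eq_square field_simps)
    also have "R x \<bullet> R (R x) \<le> norm (R x) * (norm (R x) * M)"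
      using norm_cauchy_schwarz[of "R x" "R (R x)"] M(2)[of "R x"]
      by (meson mult_left_mono norm_ge_zero order_trans)
    finally have "0 \<le> x \<bullet> R x - 2 / M * (norm (R x))\<^sup>2 + norm (R x) * (norm (R x) * M) / M\<^sup>2"
      using M(1) by (simp add: divide_right_mono)
    then show ?thesis using M(1) by (simp add: field_simps power2_eq_square)
  qed
  have bl: "bounded_linear (\<lambda>x. x - (1 / M) *\<^sub>R R x)"
    by (intro bounded_linear_intros R)
  define C where "C = Blinfun (\<lambda>x. x - (1 / M) *\<^sub>R R x)"
  have C: "C x = x - (1 / M) *\<^sub>R R x" for x
    unfolding C_def using bl by (simp add: bounded_linear_Blinfun_apply)
  have "norm (C x) \<le> 1 * norm x" for x
  proof -
    have "(norm (C x))\<^sup>2 = (norm x)\<^sup>2 - 2 / M * (x \<bullet> R x) + (norm (R x))\<^sup>2 / M\<^sup>2"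
      unfolding C power2_norm_eq_inner by (simp add: inner_simps power2_eq_square inner_commute)
    also have "\<dots> \<le> (norm x)\<^sup>2 - 2 / M * (x \<bullet> R x) + M * (x \<bullet> R x) / M\<^sup>2"
      using ineq[of x] by (simp add: divide_right_mono)
    also have "\<dots> = (norm x)\<^sup>2 - (x \<bullet> R x) / M" using M(1)
      by (simp add: field_simps power2_eq_square)
    also have "\<dots> \<le> (norm x)\<^sup>2" using pos[of x] M(1) by simp
    finally show ?thesis by (simp add: power2_le_iff_abs_le)
  qed
  then have "norm C \<le> 1" by (intro norm_blinfun_bound) auto
  then obtain Y where Y: "sqrt_iter C \<longlonglongrightarrow> Y" "norm Y \<le> 1"
    "2 *\<^sub>R Y = C + (Y o\<^sub>L Y)"
    by (rule sqrt_iter_convergent)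
  have Yl: "(\<lambda>n. sqrt_iter C n x) \<longlonglongrightarrow> Y x" for x
    by (intro tendsto_intros Y(1))
  have Ysym: "Y x \<bullet> y = x \<bullet> Y y" for x y
  proof -
    have "(\<lambda>n. sqrt_iter C n x \<bullet> y) \<longlonglongrightarrow> Y x \<bullet> y"
      "(\<lambda>n. x \<bullet> sqrt_iter C n y) \<longlonglongrightarrow> x \<bullet> Y y"
      by (intro tendsto_intros Yl)+
    moreover have "sqrt_iter C n x \<bullet> y = x \<bullet> sqrt_iter C n y" for n
      by (rule sqrt_iter_symmetric) (simp add: C inner_simps sym)
    ultimately show ?thesis using LIMSEQ_unique by auto
  qed
  define B where "B = (\<lambda>x. sqrt M *\<^sub>R (x - Y x))"
  have "bounded_linear B" unfolding B_def by (intro bounded_linear_intros)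
  moreover have "B x \<bullet> y = x \<bullet> B y" for x y by (simp add: B_def inner_simps Ysym)
  moreover have "0 \<le> x \<bullet> B x" for x
  proof -
    have "x \<bullet> Y x \<le> norm x * norm (Y x)" by (rule norm_cauchy_schwarz)
    also have "\<dots> \<le> norm x * norm x"
      using norm_blinfun[of Y x] mult_right_mono[OF Y(2) norm_ge_zero, of x]
      by (intro mult_left_mono) auto
    finally show ?thesis using M(1)
      by (simp add: B_def inner_simps power2_norm_eq_inner[symmetric] power2_eq_square)
  qed
  moreover have "B (B x) = R x" for x
  proof -
    have "2 *\<^sub>R Y x = C x + Y (Y x)" using arg_cong[OF Y(3), of "\<lambda>Z. blinfun_apply Z x"]
      by (simp add: blinfun.bilinear_simps)
    then have "Y (Y x) = 2 *\<^sub>R Y x - x + (1 / M) *\<^sub>R R x" by (simp add: C algebra_simps)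
    then have *: "x - Y x - Y (x - Y x) = (1 / M) *\<^sub>R R x"
      by (simp add: blinfun.bilinear_simps scaleR_2)
    have "B (B x) = (sqrt M * sqrt M) *\<^sub>R (x - Y x - Y (x - Y x))"
      by (simp add: B_def blinfun.bilinear_simps scaleR_diff_right)
    also have "\<dots> = R x" unfolding * using M(1) by simp
    finally show ?thesis .
  qed
  ultimately show ?thesis using that by blast
qed

section \<open>Powers of the inverse square root\<close>

text \<open>\<open>op_sqrt\<close> is a choice among nonnegative self-adjoint roots. The root S0
  inverting C only shows that there is one; B is then read off from the chosen root itself, whose
  square is the bijective operator A.\<close>

lemma inverse_sqrt_exists:
  fixes A :: "'a::{real_inner,banach} \<rightharpoonup> 'a"
  assumes A: "self_adjoint A" and \<mu>: "\<mu> > 0" "op_ge A \<mu>"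
  obtains B where "inj_sym B" "graph_inv (op_sqrt A) B" "graph_inv A (\<lambda>x. B (B x))"
proof -
  obtain R where R: "inj_sym R" "graph_inv A R" "\<And>x. 0 \<le> x \<bullet> R x"
    using self_adjoint_inverse[OF assms] by blast
  obtain C where C: "bounded_linear C" "\<And>x y. C x \<bullet> y = x \<bullet> C y"
    "\<And>x. 0 \<le> x \<bullet> C x" "\<And>x. C (C x) = R x"
    using bounded_positive_sqrt[OF inj_symD(1,2)[OF R(1)] R(3)] by blast
  interpret C: bounded_linear C by (fact C(1))
  have "x = 0" if "C x = 0" for x using C(4)[of x] that C.zero inj_symD(3)[OF R(1)] by simp
  then have Csym: "inj_sym C" unfolding inj_sym_def using C(1,2) by blast
  define S0 where "S0 = (\<lambda>x. if x \<in> range C then Some (inv C x) else None)"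
  have "inj C" using inj_symD(4)[OF Csym] by (auto intro: injI)
  then have S0: "graph_inv S0 C" unfolding graph_inv_def S0_def by (auto simp: inv_f_f)
  have "S0 \<circ>\<^sub>m S0 = A"
  proof
    fix x
    have "(S0 \<circ>\<^sub>m S0) x = Some y \<longleftrightarrow> A x = Some y" for y
      using S0 R(2) C(4) by (auto simp: graph_inv_def map_comp_Some_iff)
    then show "(S0 \<circ>\<^sub>m S0) x = A x" by (metis not_None_eq)
  qed
  moreover have "self_adjoint S0" using self_adjoint_of_inverse[OF Csym S0] .
  moreover have "op_ge S0 0" unfolding op_ge_def graph_inv_dom[OF S0]
    using graph_inv_ap[OF S0] C(3) by auto
  ultimately have "\<exists>S. self_adjoint S \<and> op_ge S 0 \<and> S \<circ>\<^sub>m S = A" by blast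
  from someI_ex[OF this] have S: "self_adjoint (op_sqrt A)" "op_sqrt A \<circ>\<^sub>m op_sqrt A = A"
    unfolding op_sqrt_def by auto
  define T where "T = op_sqrt A"
  have lin: "linear_op T" and dense: "closure (dom T) = UNIV" and adj: "adjoint_op T = T"
    using S(1) by (auto simp: self_adjoint_def T_def)
  have TT: "(\<exists>w. T x = Some w \<and> T w = Some y) \<longleftrightarrow> x = R y" for x y
  proof -
    have "(T \<circ>\<^sub>m T) x = Some y \<longleftrightarrow> x = R y" using S(2) R(2)
      by (simp add: T_def graph_inv_def)
    then show ?thesis by (simp add: map_comp_Some_iff)
  qed
  have "\<exists>z. T z = Some y" for y using TT[of "R y" y] by blast
  then obtain B where B: "\<And>y. T (B y) = Some y" by metis
  \<comment> \<open>T x = T x' makes x - x' a zero of T, hence of the square of T, so x - x' = R 0 =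
    0.\<close>
  have inj: "x = x'" if "T x = Some y" "T x' = Some y" for x x' y
  proof -
    have "T (x - x') = Some 0" using linear_opD(3)[OF lin that] by simp
    then have "x - x' = R 0" using TT[of "x - x'" 0] linear_opD0[OF lin] by blast
    then show ?thesis using linear_simps(3)[OF inj_symD(1)[OF R(1)]] by simp
  qed
  have gr: "graph_inv T B" unfolding graph_inv_def using B inj by metis
  have BB: "B (B y) = R y" for y using TT[of "B (B y)" y] B by blast
  have symB: "B x \<bullet> y = x \<bullet> B y" for x y
  proof -
    have "\<forall>v\<in>dom T. ap T v \<bullet> B y = v \<bullet> y"
      using B[of y] adjoint_op_Some_iff[OF dense, of "B y" y] adj by simp
    then have "x \<bullet> B y = B x \<bullet> y" using B[of x] by (metis domI option.sel)
    then show ?thesis by simp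
  qed
  obtain M where M: "M > 0" "\<And>x. norm (R x) \<le> norm x * M"
    using bounded_linear.pos_bounded[OF inj_symD(1)[OF R(1)]] by blast
  have "bounded_linear B"
  proof (rule bounded_linear_intro[where K = "sqrt M"])
    show "B (x + y) = B x + B y" for x y using linear_opD(1)[OF lin B B] B inj by metis
    show "B (c *\<^sub>R x) = c *\<^sub>R B x" for c x using linear_opD(2)[OF lin B B] B inj by metis
    show "norm (B x) \<le> norm x * sqrt M" for x
    proof (rule power2_le_imp_le)
      have "(norm (B x))\<^sup>2 = x \<bullet> R x" using symB[of x "B x"]
        by (simp add: power2_norm_eq_inner BB)
      also have "\<dots> \<le> norm x * norm (R x)" by (rule norm_cauchy_schwarz)
      also have "\<dots> \<le> norm x * (norm x * M)" by (intro mult_left_mono M) auto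
      finally show "(norm (B x))\<^sup>2 \<le> (norm x * sqrt M)\<^sup>2"
        using M(1) by (simp add: power_mult_distrib) (simp add: power2_eq_square mult.assoc)
    qed (use M in simp)
  qed
  moreover have "x = 0" if "B x = 0" for x using B[of x] that linear_opD0[OF lin] by simp
  ultimately have "inj_sym B" unfolding inj_sym_def using symB by blast
  moreover have "graph_inv A (\<lambda>x. B (B x))" using R(2) BB by (simp add: graph_inv_def)
  ultimately show ?thesis using that gr by (simp add: T_def)
qed


section \<open>The Hilbert space of square-integrable functions on the half-line\<close>

lemma L2_D:
  assumes "f \<in> L2"
  shows "f \<in> borel_measurable Rplus" "integrable Rplus (\<lambda>t. (norm (f t))\<^sup>2)"
  using assms by (auto simp: L2_def)

lemma L2_mono:
  fixes f :: "real \<Rightarrow> 'h::{real_inner,banach,second_countable_topology}"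
  assumes [measurable]: "f \<in> borel_measurable Rplus"
    and g: "integrable Rplus g" and le: "AE t in Rplus. (norm (f t))\<^sup>2 \<le> g t"
  shows "f \<in> L2"
  unfolding L2_def
proof (intro CollectI conjI assms(1) Bochner_Integration.integrable_bound[OF g])
  show "AE t in Rplus. norm ((norm (f t))\<^sup>2) \<le> norm (g t)" using le by eventually_elim auto
qed simp

lemma L2_zero [simp]: "(\<lambda>_. 0) \<in> L2"
  by (simp add: L2_def)

lemma L2_add:
  assumes "f \<in> L2" "g \<in> L2"
  shows "(\<lambda>t. f t + g t) \<in> L2"
proof (rule L2_mono)
  note [measurable] = L2_D(1)[OF assms(1)] L2_D(1)[OF assms(2)]
  show "(\<lambda>t. f t + g t) \<in> borel_measurable Rplus" by measurable
  show "integrable Rplus (\<lambda>t. 2 * (norm (f t))\<^sup>2 + 2 * (norm (g t))\<^sup>2)"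
    using L2_D(2)[OF assms(1)] L2_D(2)[OF assms(2)] by (intro Bochner_Integration.integrable_add) auto
  have "(norm (a + b))\<^sup>2 \<le> 2 * (norm a)\<^sup>2 + 2 * (norm b)\<^sup>2" for a b :: 'a
    using norm_diff_sq_parallelogram[of a b] zero_le_power2[of "norm (a - b)"] by linarith
  then show "AE t in Rplus. (norm (f t + g t))\<^sup>2 \<le> 2 * (norm (f t))\<^sup>2 + 2 * (norm (g t))\<^sup>2" by simp
qed

lemma L2_bounded_linear:
  assumes S: "bounded_linear S" and f: "f \<in> L2"
  shows "(\<lambda>t. S (f t)) \<in> L2"
proof -
  obtain M where M: "\<And>x. norm (S x) \<le> norm x * M" using bounded_linear.bounded[OF S] by blast
  have [measurable]: "f \<in> borel_measurable Rplus" using f by (rule L2_D)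
  have "S \<in> borel_measurable borel"
    by (intro borel_measurable_continuous_onI bounded_linear.continuous_on[OF S] continuous_on_id)
  then have m: "(\<lambda>t. S (f t)) \<in> borel_measurable Rplus" by measurable
  show ?thesis
  proof (rule L2_mono[OF m, of "\<lambda>t. M\<^sup>2 * (norm (f t))\<^sup>2"])
    show "integrable Rplus (\<lambda>t. M\<^sup>2 * (norm (f t))\<^sup>2)" using L2_D(2)[OF f] by simp
    show "AE t in Rplus. (norm (S (f t)))\<^sup>2 \<le> M\<^sup>2 * (norm (f t))\<^sup>2"
      using M by (intro AE_I2) (metis mult.commute norm_ge_zero power_mono power_mult_distrib)
  qed
qed

lemma L2_scaleR: "f \<in> L2 \<Longrightarrow> (\<lambda>t. c *\<^sub>R f t) \<in> L2"
  by (rule L2_bounded_linear[OF bounded_linear_scaleR_right])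

lemma L2_uminus: "f \<in> L2 \<Longrightarrow> (\<lambda>t. - f t) \<in> L2"
  by (rule L2_bounded_linear[OF bounded_linear_minus[OF bounded_linear_ident]])

lemma L2_diff: "f \<in> L2 \<Longrightarrow> g \<in> L2 \<Longrightarrow> (\<lambda>t. f t - g t) \<in> L2"
  using L2_add[of f "\<lambda>t. - g t"] L2_uminus[of g] by simp

text \<open>One domination argument for an arbitrary bounded bilinear product covers both inner
  products and multiplication by scalar functions.\<close>

lemma L2_product_integrable:
  fixes pr :: "'a::{real_inner,banach,second_countable_topology} \<Rightarrow>
      'b::{real_inner,banach,second_countable_topology} \<Rightarrow> 'c::{banach,second_countable_topology}"
  assumes "bounded_bilinear pr" and f: "f \<in> L2" and g: "g \<in> L2"
  shows "integrable Rplus (\<lambda>t. pr (f t) (g t))"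
proof -
  interpret bounded_bilinear pr by fact
  obtain M where M: "0 \<le> M" "\<And>a b. norm (pr a b) \<le> norm a * norm b * M" using nonneg_bounded
    by blast
  have m[measurable]: "f \<in> borel_measurable Rplus" "g \<in> borel_measurable Rplus"
    using f g by (auto intro: L2_D)
  have "(\<lambda>(x, y). pr x y) \<in> borel_measurable (borel \<Otimes>\<^sub>M borel)"
    unfolding borel_prod split_def
    by (intro borel_measurable_continuous_onI continuous_on continuous_intros)
  from measurable_compose[OF measurable_Pair[OF m] this]
  have "(\<lambda>t. pr (f t) (g t)) \<in> borel_measurable Rplus" by simp
  then show ?thesis
  proof (rule Bochner_Integration.integrable_bound[rotated])
    show "integrable Rplus (\<lambda>t. M * ((norm (f t))\<^sup>2 + (norm (g t))\<^sup>2))"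
      using L2_D(2)[OF f] L2_D(2)[OF g] by simp
    have "norm (pr a b) \<le> norm (M * ((norm a)\<^sup>2 + (norm b)\<^sup>2))" for a b
    proof -
      have "norm a * norm b \<le> (norm a)\<^sup>2 + (norm b)\<^sup>2"
        using sum_squares_bound[of "norm a" "norm b"] mult_nonneg_nonneg[OF norm_ge_zero norm_ge_zero, of a b]
        by linarith
      then have "norm a * norm b * M \<le> ((norm a)\<^sup>2 + (norm b)\<^sup>2) * M" using M(1)
        by (rule mult_right_mono)
      then show ?thesis using M(2)[of a b] by (simp add: mult.commute)
    qed
    then show "AE t in Rplus. norm (pr (f t) (g t)) \<le> norm (M * ((norm (f t))\<^sup>2 + (norm (g t))\<^sup>2))"
      by simp
  qed
qed

lemmas L2_inner_integrable = L2_product_integrable[OF bounded_bilinear_inner]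
lemmas L2_scaleR_integrable = L2_product_integrable[OF bounded_bilinear_scaleR]

section \<open>The Hilbert space of classes modulo equality almost everywhere\<close>

definition l2rel ::
    "(real \<Rightarrow> 'h) \<Rightarrow> (real \<Rightarrow> 'h::{real_inner,banach,second_countable_topology}) \<Rightarrow> bool" where
  "l2rel f g \<longleftrightarrow> f \<in> L2 \<and> g \<in> L2 \<and> (AE t in Rplus. f t = g t)"

lemma l2rel_refl [simp]: "l2rel f f \<longleftrightarrow> f \<in> L2"
  by (simp add: l2rel_def)

\<comment> \<open>Orthogonality, completeness and contraction arguments require a genuine norm,
  which only classes have. The relation is partial because representatives are restricted to
  \<open>L2\<close>.\<close>
quotient_type (overloaded) 'h l2 =
  "real \<Rightarrow> 'h::{real_inner,banach,second_countable_topology}" / partial: l2rel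
proof (rule part_equivpI)
  show "\<exists>x. l2rel x (x :: real \<Rightarrow> 'h)" by (rule exI[of _ "\<lambda>_. 0"]) simp
  show "symp (l2rel :: (real \<Rightarrow> 'h) \<Rightarrow> _)" by (rule sympI) (auto simp: l2rel_def)
  show "transp (l2rel :: (real \<Rightarrow> 'h) \<Rightarrow> _)" by (rule transpI) (auto simp: l2rel_def)
qed

instantiation l2 :: ("{real_inner,banach,second_countable_topology}") real_inner
begin

lift_definition zero_l2 :: "'a l2" is "\<lambda>_. 0" by simp
lift_definition plus_l2 :: "'a l2 \<Rightarrow> 'a l2 \<Rightarrow> 'a l2" is "\<lambda>f g t. f t + g t"
  by (auto simp: l2rel_def intro!: L2_add)
lift_definition minus_l2 :: "'a l2 \<Rightarrow> 'a l2 \<Rightarrow> 'a l2" is "\<lambda>f g t. f t - g t"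
  by (auto simp: l2rel_def intro!: L2_diff)
lift_definition uminus_l2 :: "'a l2 \<Rightarrow> 'a l2" is "\<lambda>f t. - f t"
  by (auto simp: l2rel_def intro!: L2_uminus)
lift_definition scaleR_l2 :: "real \<Rightarrow> 'a l2 \<Rightarrow> 'a l2" is "\<lambda>c f t. c *\<^sub>R f t"
  by (auto simp: l2rel_def intro!: L2_scaleR)
lift_definition inner_l2 :: "'a l2 \<Rightarrow> 'a l2 \<Rightarrow> real" is "\<lambda>f g. LINT t|Rplus. f t \<bullet> g t"
  by (rule integral_cong_AE) (auto simp: l2rel_def intro!: borel_measurable_inner[OF L2_D(1) L2_D(1)])

definition norm_l2 :: "'a l2 \<Rightarrow> real" where "norm_l2 x = sqrt (x \<bullet> x)"
definition dist_l2 :: "'a l2 \<Rightarrow> 'a l2 \<Rightarrow> real" where "dist_l2 x y = norm (x - y)"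
definition sgn_l2 :: "'a l2 \<Rightarrow> 'a l2" where "sgn_l2 x = inverse (norm x) *\<^sub>R x"
definition uniformity_l2 :: "('a l2 \<times> 'a l2) filter" where
  "uniformity_l2 = (INF e\<in>{0<..}. principal {(x, y). dist x y < e})"
definition open_l2 :: "'a l2 set \<Rightarrow> bool" where
  "open_l2 U \<longleftrightarrow> (\<forall>x\<in>U. eventually (\<lambda>(x', y). x' = x \<longrightarrow> y \<in> U) uniformity)"

instance
proof
  fix x y z :: "'a l2" and a b :: real
  show "x + y + z = x + (y + z)"
    by transfer (auto simp: l2rel_def algebra_simps intro!: L2_add)
  show "x + y = y + x"
    by transfer (auto simp: l2rel_def algebra_simps intro!: L2_add)
  show "0 + x = x" by transfer (auto simp: l2rel_def)
  show "- x + x = 0" by transfer (auto simp: l2rel_def)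
  show "x - y = x + - y" by transfer (auto simp: l2rel_def intro!: L2_diff)
  show "a *\<^sub>R (x + y) = a *\<^sub>R x + a *\<^sub>R y"
    by transfer (auto simp: l2rel_def scaleR_add_right intro!: L2_add L2_scaleR)
  show "(a + b) *\<^sub>R x = a *\<^sub>R x + b *\<^sub>R x"
    by transfer (auto simp: l2rel_def scaleR_add_left intro!: L2_add L2_scaleR)
  show "a *\<^sub>R b *\<^sub>R x = (a * b) *\<^sub>R x" by transfer (auto simp: l2rel_def intro!: L2_scaleR)
  show "1 *\<^sub>R x = x" by transfer (auto simp: l2rel_def)
  show "dist x y = norm (x - y)" by (rule dist_l2_def)
  show "sgn x = inverse (norm x) *\<^sub>R x" by (rule sgn_l2_def)
  show "uniformity = (INF e\<in>{0<..}. principal {(x :: 'a l2, y). dist x y < e})"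
    by (rule uniformity_l2_def)
  show "open U \<longleftrightarrow> (\<forall>x\<in>U. \<forall>\<^sub>F (x', y) in uniformity. x' = x \<longrightarrow> y \<in> U)" for U :: "'a l2 set"
    by (rule open_l2_def)
  show "x \<bullet> y = y \<bullet> x" by transfer (simp add: inner_commute)
  show "(x + y) \<bullet> z = x \<bullet> z + y \<bullet> z"
    by transfer (simp add: inner_add_left L2_inner_integrable)
  show "(a *\<^sub>R x) \<bullet> y = a * (x \<bullet> y)" by transfer simp
  show "0 \<le> x \<bullet> x" by transfer simp
  show "x \<bullet> x = 0 \<longleftrightarrow> x = 0"
  proof transfer
    fix f :: "real \<Rightarrow> 'a" assume "l2rel f f"
    then have f: "f \<in> L2" by simp
    have "(LINT t|Rplus. f t \<bullet> f t) = 0 \<longleftrightarrow> (AE t in Rplus. f t \<bullet> f t = 0)"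
      by (rule integral_nonneg_eq_0_iff_AE) (use f in \<open>auto simp: L2_inner_integrable\<close>)
    then show "(LINT t|Rplus. f t \<bullet> f t) = 0 \<longleftrightarrow> l2rel f (\<lambda>_. 0)" using f
      by (simp add: l2rel_def)
  qed
  show "norm x = sqrt (x \<bullet> x)" by (rule norm_l2_def)
qed

end

lemma rep_l2 [simp]: "rep_l2 x \<in> L2"
  using Quotient3_rep_reflp[OF Quotient3_l2, of x] by simp

lemma abs_rep_l2 [simp]: "abs_l2 (rep_l2 x) = x"
  by (rule Quotient3_abs_rep[OF Quotient3_l2])

lemma abs_l2_eq_iff:
  assumes "f \<in> L2" "g \<in> L2"
  shows "abs_l2 f = abs_l2 g \<longleftrightarrow> (AE t in Rplus. f t = g t)"
  using Quotient3_rel[OF Quotient3_l2, of f g] assms by (auto simp: l2rel_def)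

lemma rep_abs_l2:
  assumes "f \<in> L2"
  shows "AE t in Rplus. rep_l2 (abs_l2 f) t = f t"
  using abs_l2_eq_iff[OF rep_l2 assms, of "abs_l2 f"] by simp

lemma l2_cases: obtains f where "f \<in> L2" "x = abs_l2 f"
  using rep_l2 abs_rep_l2 by metis

lemma abs_l2_plus: "f \<in> L2 \<Longrightarrow> g \<in> L2 \<Longrightarrow> abs_l2 f + abs_l2 g = abs_l2 (\<lambda>t. f t + g t)"
  by (rule plus_l2.abs_eq) simp_all

lemma abs_l2_minus: "f \<in> L2 \<Longrightarrow> g \<in> L2 \<Longrightarrow> abs_l2 f - abs_l2 g = abs_l2 (\<lambda>t. f t - g t)"
  by (rule minus_l2.abs_eq) simp_all

lemma abs_l2_scaleR: "f \<in> L2 \<Longrightarrow> c *\<^sub>R abs_l2 f = abs_l2 (\<lambda>t. c *\<^sub>R f t)"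
  by (rule scaleR_l2.abs_eq) simp_all

lemma abs_l2_inner: "f \<in> L2 \<Longrightarrow> g \<in> L2 \<Longrightarrow> abs_l2 f \<bullet> abs_l2 g = (LINT t|Rplus. f t \<bullet> g t)"
  by (rule inner_l2.abs_eq) simp_all

lemma norm_abs_l2: "f \<in> L2 \<Longrightarrow> norm (abs_l2 f) = L2_norm f"
  by (simp add: norm_eq_sqrt_inner abs_l2_inner L2_norm_def power2_norm_eq_inner)

lemma L2_norm_sq: "(L2_norm f)\<^sup>2 = (LINT t|Rplus. (norm (f t))\<^sup>2)"
  by (simp add: L2_norm_def)

lemma L2_from_nn_integral:
  fixes f :: "real \<Rightarrow> 'h::{real_inner,banach,second_countable_topology}"
  assumes [measurable]: "f \<in> borel_measurable Rplus" and "0 \<le> C"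
    and le: "(\<integral>\<^sup>+t. ennreal ((norm (f t))\<^sup>2) \<partial>Rplus) \<le> ennreal C"
  shows "f \<in> L2" "(L2_norm f)\<^sup>2 \<le> C"
proof -
  have i: "integrable Rplus (\<lambda>t. (norm (f t))\<^sup>2)"
    by (rule integrableI_bounded) (use le in \<open>auto simp: less_top[symmetric] top_unique\<close>)
  then show "f \<in> L2" by (simp add: L2_def)
  have "ennreal (LINT t|Rplus. (norm (f t))\<^sup>2) \<le> ennreal C"
    using nn_integral_eq_integral[OF i] le by simp
  then show "(L2_norm f)\<^sup>2 \<le> C" using assms(2) by (simp add: L2_norm_sq)
qed

text \<open>Riesz-Fischer: a rapidly convergent subsequence converges almost everywhere, and Fatou's
  lemma shows that the pointwise limit is also the limit in norm.\<close>

instance l2 :: ("{real_inner,banach,second_countable_topology}") complete_space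
proof
  fix X :: "nat \<Rightarrow> 'a l2" assume "Cauchy X"
  then have "\<forall>n. \<exists>N. \<forall>i\<ge>N. \<forall>j\<ge>N. dist (X i) (X j) < (1/4) ^ n"
    unfolding Cauchy_def by simp
  then obtain N where N: "\<And>n i j. i \<ge> N n \<Longrightarrow> j \<ge> N n \<Longrightarrow> dist (X i) (X j) < (1/4) ^ n" by metis
  \<comment> \<open>A sum rather than N n itself, so that r m \<ge> N n whenever n \<le> m.\<close>
  define r where "r n = (\<Sum>k\<le>n. N k)" for n
  have r: "N n \<le> r m" if "n \<le> m" for n m
    unfolding r_def by (rule member_le_sum) (use that in auto)
  define f where "f n = rep_l2 (X (r n))" for n
  have f: "f n \<in> L2" for n by (simp add: f_def)
  note [measurable] = L2_D(1)[OF f]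
  have dist_f: "(LINT t|Rplus. (norm (f m t - f n t))\<^sup>2) \<le> (1/16) ^ n" if "n \<le> m" for n m
  proof -
    have "X (r m) - X (r n) = abs_l2 (\<lambda>t. f m t - f n t)"
      using abs_l2_minus[OF f f, of m n] by (simp add: f_def)
    then have "(LINT t|Rplus. (norm (f m t - f n t))\<^sup>2) = (dist (X (r m)) (X (r n)))\<^sup>2"
      by (simp add: dist_norm norm_abs_l2 L2_diff f L2_norm_sq)
    also have "\<dots> \<le> ((1/4) ^ n)\<^sup>2"
      using N[OF r r, of n m n] that by (intro power_mono) auto
    also have "\<dots> = (1/16) ^ n"
      by (simp flip: power_mult add: power_mult power2_eq_square power_mult_distrib[symmetric])
    finally show ?thesis .
  qed
  have nn: "(\<integral>\<^sup>+t. ennreal ((norm (f m t - f n t))\<^sup>2) \<partial>Rplus) \<le> ennreal ((1/16) ^ n)" if "n \<le> m" for n m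
    using dist_f[OF that] nn_integral_eq_integral[OF L2_D(2)[OF L2_diff[OF f f]], of m n]
    by (simp add: ennreal_leI)
  \<comment> \<open>Squared increments have integral at most 16^(-n); the weight 4^n keeps the
    series of integrals finite and yields pointwise increments of order 2^(-n), which are
    summable.\<close>
  have "AE t in Rplus. (\<Sum>n. ennreal (4 ^ n * (norm (f (Suc n) t - f n t))\<^sup>2)) \<noteq> \<infinity>"
  proof (rule nn_integral_noteq_infinite)
    have "(\<integral>\<^sup>+t. (\<Sum>n. ennreal (4 ^ n * (norm (f (Suc n) t - f n t))\<^sup>2)) \<partial>Rplus)
        = (\<Sum>n. \<integral>\<^sup>+t. ennreal (4 ^ n * (norm (f (Suc n) t - f n t))\<^sup>2) \<partial>Rplus)"
      by (rule nn_integral_suminf) measurable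
    also have "\<dots> \<le> (\<Sum>n. ennreal ((1/4) ^ n))"
    proof (rule suminf_le)
      fix n
      have "(\<integral>\<^sup>+t. ennreal (4 ^ n * (norm (f (Suc n) t - f n t))\<^sup>2) \<partial>Rplus)
          = ennreal (4 ^ n) * (\<integral>\<^sup>+t. ennreal ((norm (f (Suc n) t - f n t))\<^sup>2) \<partial>Rplus)"
        by (subst nn_integral_cmult[symmetric]) (auto simp: ennreal_mult)
      also have "\<dots> \<le> ennreal (4 ^ n) * ennreal ((1/16) ^ n)" by (intro mult_left_mono nn) auto
      also have "\<dots> = ennreal ((1/4) ^ n)"
        by (simp add: ennreal_mult[symmetric] power_mult_distrib[symmetric])
      finally show "(\<integral>\<^sup>+t. ennreal (4 ^ n * (norm (f (Suc n) t - f n t))\<^sup>2) \<partial>Rplus) \<le> ennreal ((1/4) ^ n)" .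
    qed auto
    also have "\<dots> = ennreal (\<Sum>n. (1/4) ^ n)" by (intro suminf_ennreal2) auto
    also have "\<dots> < \<infinity>" by simp
    finally show "(\<integral>\<^sup>+t. (\<Sum>n. ennreal (4 ^ n * (norm (f (Suc n) t - f n t))\<^sup>2)) \<partial>Rplus) \<noteq> \<infinity>"
      by (auto simp: top_unique)
  qed measurable
  then have conv: "AE t in Rplus. convergent (\<lambda>n. f n t)"
  proof eventually_elim
    case (elim t)
    define C where "C = enn2real (\<Sum>n. ennreal (4 ^ n * (norm (f (Suc n) t - f n t))\<^sup>2))"
    have le: "norm (f (Suc n) t - f n t) \<le> sqrt C * (1/2) ^ n" for n
    proof (rule power2_le_imp_le)
      have "ennreal (4 ^ n * (norm (f (Suc n) t - f n t))\<^sup>2) \<le> (\<Sum>n. ennreal (4 ^ n * (norm (f (Suc n) t - f n t))\<^sup>2))"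
        by (rule order_trans[OF _ sum_le_suminf[of _ "{n}"]]) auto
      also have "\<dots> = ennreal C" using elim by (simp add: C_def less_top)
      finally have "4 ^ n * (norm (f (Suc n) t - f n t))\<^sup>2 \<le> C" by (simp add: C_def)
      then have "(norm (f (Suc n) t - f n t))\<^sup>2 \<le> C * (1/4) ^ n"
        by (simp add: field_simps power_divide)
      also have "\<dots> = (sqrt C * (1/2) ^ n)\<^sup>2"
        by (simp add: power_mult_distrib C_def flip: power_mult) (simp add: power_mult mult.commute[of n] power2_eq_square)
      finally show "(norm (f (Suc n) t - f n t))\<^sup>2 \<le> (sqrt C * (1/2) ^ n)\<^sup>2" .
    qed (simp add: C_def)
    have "summable (\<lambda>n. f (Suc n) t - f n t)"
      by (rule summable_comparison_test'[where g = "\<lambda>n. sqrt C * (1/2) ^ n"]) (use le in \<open>auto intro!: summable_mult\<close>)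
    then have "convergent (\<lambda>n. \<Sum>k<n. f (Suc k) t - f k t)" by (simp add: summable_iff_convergent)
    then have "convergent (\<lambda>n. f n t - f 0 t)"
      using sum_lessThan_telescope[of "\<lambda>k. f k t"] by simp
    then show ?case by (simp only: convergent_diff_const_right_iff)
  qed
  define g where "g t = lim (\<lambda>n. f n t)" for t
  have [measurable]: "g \<in> borel_measurable Rplus" unfolding g_def by measurable
  have fg: "(\<lambda>t. g t - f n t) \<in> L2" "(L2_norm (\<lambda>t. g t - f n t))\<^sup>2 \<le> (1/16) ^ n"
    for n
  proof -
    have "(\<integral>\<^sup>+t. ennreal ((norm (g t - f n t))\<^sup>2) \<partial>Rplus)
        = (\<integral>\<^sup>+t. liminf (\<lambda>m. ennreal ((norm (f m t - f n t))\<^sup>2)) \<partial>Rplus)"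
    proof (rule nn_integral_cong_AE, use conv in eventually_elim)
      case (elim t)
      then have "(\<lambda>m. f m t) \<longlonglongrightarrow> g t" by (simp add: g_def convergent_LIMSEQ_iff)
      then have "(\<lambda>m. ennreal ((norm (f m t - f n t))\<^sup>2)) \<longlonglongrightarrow> ennreal ((norm (g t - f n t))\<^sup>2)"
        by (intro tendsto_intros)
      then show ?case by (intro lim_imp_Liminf[symmetric]) auto
    qed
    also have "\<dots> \<le> liminf (\<lambda>m. \<integral>\<^sup>+t. ennreal ((norm (f m t - f n t))\<^sup>2) \<partial>Rplus)"
      by (rule nn_integral_liminf) measurable
    also have "\<dots> \<le> ennreal ((1/16) ^ n)"
      by (rule Liminf_le) (use nn in \<open>auto intro!: eventually_sequentiallyI[of n]\<close>)
    finally have le: "(\<integral>\<^sup>+t. ennreal ((norm (g t - f n t))\<^sup>2) \<partial>Rplus) \<le> ennreal ((1/16) ^ n)" .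
    from L2_from_nn_integral[OF _ _ this]
    show "(\<lambda>t. g t - f n t) \<in> L2" "(L2_norm (\<lambda>t. g t - f n t))\<^sup>2 \<le> (1/16) ^ n"
      by auto
  qed
  have g: "g \<in> L2" using L2_add[OF fg(1)[of 0] f[of 0]] by simp
  have dist_g: "dist (abs_l2 g) (X (r n)) \<le> (1/4) ^ n" for n
  proof (rule power2_le_imp_le)
    have "abs_l2 g - X (r n) = abs_l2 (\<lambda>t. g t - f n t)"
      using abs_l2_minus[OF g f, of n] by (simp add: f_def)
    then have "(dist (abs_l2 g) (X (r n)))\<^sup>2 \<le> (1/16) ^ n" using fg
      by (simp add: dist_norm norm_abs_l2)
    also have "\<dots> = ((1/4) ^ n)\<^sup>2"
      by (simp flip: power_mult add: mult.commute[of n]) (simp add: power_mult power2_eq_square)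
    finally show "(dist (abs_l2 g) (X (r n)))\<^sup>2 \<le> ((1/4) ^ n)\<^sup>2" .
  qed simp
  have "X \<longlonglongrightarrow> abs_l2 g"
  proof (rule metric_LIMSEQ_I)
    fix e :: real assume "e > 0"
    then obtain n where n: "(1/4) ^ n < e / 2"
      using real_arch_pow_inv[of "e / 2" "1/4"] by auto
    have "dist (X m) (abs_l2 g) < e" if "m \<ge> N n" for m
      using N[OF that r[of n n]] dist_g[of n] n dist_triangle[of "X m" "abs_l2 g" "X (r n)"]
      by (simp add: dist_commute)
    then show "\<exists>M. \<forall>m\<ge>M. dist (X m) (abs_l2 g) < e" by blast
  qed
  then show "convergent X" by (auto simp: convergent_def)
qed

instance l2 :: ("{real_inner,banach,second_countable_topology}") banach ..

section \<open>Bounded operators and scalar functions acting on classes\<close>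

lift_definition l2_map :: "('a \<Rightarrow> 'b) \<Rightarrow> 'a::{real_inner,banach,second_countable_topology} l2
    \<Rightarrow> 'b::{real_inner,banach,second_countable_topology} l2"
  is "\<lambda>S f. if bounded_linear S then (\<lambda>t. S (f t)) else (\<lambda>_. 0)"
proof -
  fix S :: "'a \<Rightarrow> 'b" and f g :: "real \<Rightarrow> 'a"
  assume "l2rel f g"
  then have fg: "f \<in> L2" "g \<in> L2" "AE t in Rplus. f t = g t" by (auto simp: l2rel_def)
  show "l2rel (if bounded_linear S then \<lambda>t. S (f t) else (\<lambda>_. 0))
      (if bounded_linear S then \<lambda>t. S (g t) else (\<lambda>_. 0))"
  proof (cases "bounded_linear S")
    case True
    have "AE t in Rplus. S (f t) = S (g t)" using fg(3) by eventually_elim simp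
    then show ?thesis using True fg L2_bounded_linear[OF True] by (simp add: l2rel_def)
  qed simp
qed

lemma l2_map_abs: "bounded_linear S \<Longrightarrow> f \<in> L2 \<Longrightarrow> l2_map S (abs_l2 f) = abs_l2 (\<lambda>t. S (f t))"
  by (simp add: l2_map.abs_eq)

lemma norm_l2_map_le:
  assumes S: "bounded_linear S" and le: "\<And>x. norm (S x) \<le> C * norm x"
  shows "norm (l2_map S x) \<le> C * norm x"
proof -
  obtain f where f: "f \<in> L2" "x = abs_l2 f" by (rule l2_cases)
  \<comment> \<open>A negative C is possible only on the zero space, which is treated
    separately.\<close>
  have "0 \<le> C \<or> (\<forall>x::'a. x = 0)"
    by (metis le mult_nonneg_nonneg norm_ge_zero order.trans linorder_not_le mult_neg_pos zero_less_norm_iff)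
  then consider "0 \<le> C" | "\<And>x::'a. x = 0" by blast
  then show ?thesis
  proof cases
    case 1
    show ?thesis
    proof (rule power2_le_imp_le)
      have "(norm (l2_map S x))\<^sup>2 = (LINT t|Rplus. (norm (S (f t)))\<^sup>2)"
        by (simp add: f l2_map_abs S norm_abs_l2 L2_bounded_linear[OF S f(1)] L2_norm_sq)
      also have "\<dots> \<le> (LINT t|Rplus. C\<^sup>2 * (norm (f t))\<^sup>2)"
        using le 1
        by (intro integral_mono L2_D(2) L2_bounded_linear[OF S f(1)] f(1) integrable_mult_right)
           (auto simp flip: power_mult_distrib intro!: power_mono)
      also have "\<dots> = (C * norm x)\<^sup>2" by (simp add: f norm_abs_l2 L2_norm_sq power_mult_distrib)
      finally show "(norm (l2_map S x))\<^sup>2 \<le> (C * norm x)\<^sup>2" .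
    qed (use 1 in simp)
  next
    case 2
    then have "f = (\<lambda>_. 0)" by blast
    then have "x = 0" "l2_map S x = 0"
      using f(2) S by (simp_all add: zero_l2_def l2_map_abs linear_simps(3)[OF S])
    then show ?thesis by simp
  qed
qed

lemma bounded_linear_l2_map:
  assumes S: "bounded_linear S"
  shows "bounded_linear (l2_map S)"
proof -
  interpret S: bounded_linear S by fact
  obtain M where M: "\<And>x. norm (S x) \<le> norm x * M" using S.bounded by blast
  show ?thesis
  proof (rule bounded_linear_intro)
    show "norm (l2_map S x) \<le> norm x * M" for x
      using norm_l2_map_le[OF S, of M x] M by (simp add: mult.commute)
    show "l2_map S (x + y) = l2_map S x + l2_map S y" for x y
      by (rule l2_cases[of x], rule l2_cases[of y])
         (simp add: abs_l2_plus l2_map_abs S L2_add L2_bounded_linear[OF S] S.add)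
    show "l2_map S (c *\<^sub>R x) = c *\<^sub>R l2_map S x" for c x
      by (rule l2_cases[of x])
         (simp add: abs_l2_scaleR l2_map_abs S L2_scaleR L2_bounded_linear[OF S] S.scaleR)
  qed
qed

lemma inj_sym_l2_map:
  assumes B: "inj_sym B"
  shows "inj_sym (l2_map B)"
  unfolding inj_sym_def
proof (intro conjI allI impI)
  have bl: "bounded_linear B" using B by (rule inj_symD)
  then show "bounded_linear (l2_map B)" by (rule bounded_linear_l2_map)
  show "l2_map B x \<bullet> y = x \<bullet> l2_map B y" for x y
    by (rule l2_cases[of x], rule l2_cases[of y])
       (simp add: l2_map_abs bl abs_l2_inner L2_bounded_linear[OF bl] inj_symD(2)[OF B])
  show "x = 0" if "l2_map B x = 0" for x
  proof (rule l2_cases[of x])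
    fix f assume f: "f \<in> L2" "x = abs_l2 f"
    have "AE t in Rplus. B (f t) = 0"
      using that abs_l2_eq_iff[OF L2_bounded_linear[OF bl f(1)] L2_zero]
      by (simp add: f l2_map_abs bl zero_l2_def)
    then have "AE t in Rplus. f t = 0" by eventually_elim (rule inj_symD(3)[OF B])
    then show ?thesis using abs_l2_eq_iff[OF f(1) L2_zero] by (simp add: f zero_l2_def)
  qed
qed

text \<open>For fixed \<phi> in \<open>L2\<close> this is continuous in the class, so relations
  between weak derivatives become closed conditions on classes.\<close>

definition l2_pair :: "(real \<Rightarrow> real) \<Rightarrow> 'a l2 \<Rightarrow> 'a::{real_inner,banach,second_countable_topology}" where
  "l2_pair \<phi> x = (LINT t|Rplus. \<phi> t *\<^sub>R rep_l2 x t)"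

lemma l2_pair_abs:
  assumes "\<phi> \<in> L2" "f \<in> L2"
  shows "l2_pair \<phi> (abs_l2 f) = (LINT t|Rplus. \<phi> t *\<^sub>R f t)"
  unfolding l2_pair_def
  by (rule integral_cong_AE)
     (use rep_abs_l2[OF assms(2)] in \<open>auto intro!: borel_measurable_scaleR[OF L2_D(1) L2_D(1)] assms\<close>)

lemma l2_pair_inner:
  assumes \<phi>: "\<phi> \<in> L2"
  shows "(\<lambda>t. \<phi> t *\<^sub>R v) \<in> L2"
    "l2_pair \<phi> x \<bullet> v = x \<bullet> abs_l2 (\<lambda>t. \<phi> t *\<^sub>R v)"
proof -
  show \<phi>v: "(\<lambda>t. \<phi> t *\<^sub>R v) \<in> L2"
    by (rule L2_bounded_linear[OF bounded_linear_scaleR_left \<phi>])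
  show "l2_pair \<phi> x \<bullet> v = x \<bullet> abs_l2 (\<lambda>t. \<phi> t *\<^sub>R v)"
  proof (rule l2_cases[of x])
    fix f assume f: "f \<in> L2" "x = abs_l2 f"
    have "l2_pair \<phi> x \<bullet> v = (LINT t|Rplus. (\<phi> t *\<^sub>R f t) \<bullet> v)"
      unfolding f(2) l2_pair_abs[OF \<phi> f(1)]
      by (rule integral_inner_left[symmetric]) (simp add: L2_scaleR_integrable \<phi> f)
    also have "\<dots> = (LINT t|Rplus. f t \<bullet> (\<phi> t *\<^sub>R v))" by (simp add: inner_commute)
    also have "\<dots> = x \<bullet> abs_l2 (\<lambda>t. \<phi> t *\<^sub>R v)" using f \<phi>v
      by (simp add: abs_l2_inner)
    finally show ?thesis .
  qed
qed

lemma bounded_linear_l2_pair: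
  assumes \<phi>: "\<phi> \<in> L2"
  shows "bounded_linear (l2_pair \<phi> :: 'a::{real_inner,banach,second_countable_topology} l2 \<Rightarrow> 'a)"
proof (rule bounded_linear_intro[where K = "L2_norm \<phi>"])
  fix x y :: "'a l2" and c :: real
  show "l2_pair \<phi> (x + y) = l2_pair \<phi> x + l2_pair \<phi> y"
    by (rule l2_cases[of x], rule l2_cases[of y])
       (simp add: abs_l2_plus l2_pair_abs \<phi> L2_add scaleR_add_right L2_scaleR_integrable)
  show "l2_pair \<phi> (c *\<^sub>R x) = c *\<^sub>R l2_pair \<phi> x"
    by (rule l2_cases[of x])
       (simp add: abs_l2_scaleR l2_pair_abs \<phi> L2_scaleR scaleR_left_commute[of _ c] del: scaleR_scaleR)
  show "norm (l2_pair \<phi> x) \<le> norm x * L2_norm \<phi>"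
  proof -
    \<comment> \<open>Testing the pairing against its own value v reduces the bound to
      Cauchy-Schwarz in \<open>l2\<close>, after cancelling a factor |v|.\<close>
    define v where "v = l2_pair \<phi> x"
    have "v \<bullet> v = x \<bullet> abs_l2 (\<lambda>t. \<phi> t *\<^sub>R v)"
      using l2_pair_inner(2)[OF \<phi>, of x v] by (simp add: v_def)
    also have "\<dots> \<le> norm x * norm (abs_l2 (\<lambda>t. \<phi> t *\<^sub>R v))"
      by (rule norm_cauchy_schwarz)
    also have "norm (abs_l2 (\<lambda>t. \<phi> t *\<^sub>R v)) = L2_norm \<phi> * norm v"
      by (simp add: norm_abs_l2 l2_pair_inner(1) \<phi> L2_norm_def power_mult_distrib real_sqrt_mult)
    finally have "norm v * norm v \<le> (norm x * L2_norm \<phi>) * norm v"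
      by (simp add: power2_norm_eq_inner[symmetric] power2_eq_square mult.assoc)
    then show ?thesis
      by (cases "v = 0") (auto simp: v_def[symmetric] L2_norm_def)
  qed
qed


section \<open>Test functions\<close>

definition smooth :: "(real \<Rightarrow> real) \<Rightarrow> bool" where
  "smooth \<phi> \<longleftrightarrow> (\<forall>n t. (deriv ^^ n) \<phi> field_differentiable (at t))"

text \<open>A family closed under differentiation contains all iterated derivatives of its members;
  this takes the place of a formula for the n-th derivative.\<close>

lemma smooth_coinduct:
  assumes step: "\<And>f. f \<in> S \<Longrightarrow> \<exists>f'\<in>S. \<forall>t. (f has_real_derivative f' t) (at t)" and "\<phi> \<in> S"
  shows "smooth \<phi>"
proof -
  have "(deriv ^^ n) \<phi> \<in> S" for n
  proof (induction n)
    case (Suc n)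
    from step[OF this] obtain f' where f': "f' \<in> S"
      "\<forall>t. ((deriv ^^ n) \<phi> has_real_derivative f' t) (at t)"
      by blast
    then have "deriv ((deriv ^^ n) \<phi>) = f'" using DERIV_imp_deriv by blast
    then show ?case using f' by simp
  qed (use assms in simp)
  then show ?thesis unfolding smooth_def using step by (meson field_differentiable_def)
qed

text \<open>x^(-j) exp(-1/x), extended by 0. The powers are included because differentiation of
  exp(-1/x) produces them; each function of the family tends to 0 at 0.\<close>

definition bump_atom :: "nat \<Rightarrow> real \<Rightarrow> real" where
  "bump_atom j x = (if x > 0 then (1 / x) ^ j * exp (- (1 / x)) else 0)"

lemma bump_atom_tendsto_0: "(bump_atom j \<longlongrightarrow> 0) (at 0)"
proof -
  have "((\<lambda>x::real. (1 / x) ^ j / exp (1 / x)) \<longlongrightarrow> 0) (at_right 0)"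
    using filterlim_compose[OF tendsto_power_div_exp_0 filterlim_inverse_at_top_right]
    by (simp add: inverse_eq_divide)
  moreover have "\<forall>\<^sub>F x in at_right 0. (1 / x) ^ j / exp (1 / x) = bump_atom j x"
    unfolding eventually_at_right_field by (auto simp: bump_atom_def exp_minus field_simps intro: exI[of _ 1])
  ultimately have "(bump_atom j \<longlongrightarrow> 0) (at_right 0)" by (rule Lim_transform_eventually)
  moreover have "(bump_atom j \<longlongrightarrow> 0) (at_left 0)"
    by (rule Lim_transform_eventually[OF tendsto_const])
       (auto simp: bump_atom_def eventually_at_left_field intro!: exI[of _ "-1"])
  ultimately show ?thesis by (simp add: filterlim_split_at)
qed

lemma bump_atom_has_derivative:
  "(bump_atom j has_real_derivative (bump_atom (j + 2) x - real j * bump_atom (j + 1) x)) (at x)"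
proof (cases "x = 0")
  case True
  \<comment> \<open>The difference quotient at 0 is the atom of index j + 1.\<close>
  have "((\<lambda>h. (bump_atom j (0 + h) - bump_atom j 0) / h) \<longlongrightarrow> 0) (at 0)"
    by (rule Lim_transform_eventually[OF bump_atom_tendsto_0[of "Suc j"]])
       (auto simp: bump_atom_def eventually_at_filter)
  then have "(bump_atom j has_real_derivative 0) (at 0)" by (simp add: DERIV_def)
  then show ?thesis using True by (simp add: bump_atom_def)
next
  case False
  show ?thesis
  proof (cases "x > 0")
    case True
    have ex: "((\<lambda>x. exp (- (1 / x))) has_real_derivative (1 / x)\<^sup>2 * exp (- (1 / x))) (at x)"
      using True by (auto intro!: derivative_eq_intros simp: power2_eq_square)
    have pw: "((\<lambda>x. (1 / x) ^ j) has_real_derivative - (real j * (1 / x) ^ (j + 1))) (at x)"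
    proof -
      have "((\<lambda>x. 1 / x) has_real_derivative - (1 / x)\<^sup>2) (at x)"
        using True by (auto intro!: derivative_eq_intros simp: power2_eq_square)
      from DERIV_power[OF this, of j] show ?thesis
        by (rule DERIV_cong) (cases j; simp add: power2_eq_square)
    qed
    have "((\<lambda>x. (1 / x) ^ j * exp (- (1 / x))) has_real_derivative
        (- (real j * (1 / x) ^ (j + 1))) * exp (- (1 / x)) + ((1 / x)\<^sup>2 * exp (- (1 / x))) * (1 / x) ^ j) (at x)"
      by (rule DERIV_mult[OF pw ex])
    also have "(- (real j * (1 / x) ^ (j + 1))) * exp (- (1 / x)) + ((1 / x)\<^sup>2 * exp (- (1 / x))) * (1 / x) ^ j
        = bump_atom (j + 2) x - real j * bump_atom (j + 1) x"
      using True by (simp add: bump_atom_def power_add power2_eq_square mult_ac)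
    finally show ?thesis
      by (rule has_field_derivative_transform_within_open[of _ _ _ "{0<..}"])
         (use True in \<open>auto simp: bump_atom_def\<close>)
  next
    case neg: False
    have "((\<lambda>x. 0) has_real_derivative 0) (at x)" by simp
    then have "(bump_atom j has_real_derivative 0) (at x)"
      by (rule has_field_derivative_transform_within_open[of _ _ _ "{..<0}"])
         (use neg False in \<open>auto simp: bump_atom_def\<close>)
    then show ?thesis using neg by (simp add: bump_atom_def)
  qed
qed

inductive_set bump_algebra :: "(real \<Rightarrow> real) set" where
  atom: "(\<lambda>t. bump_atom j (a * t + b)) \<in> bump_algebra"
| add: "f \<in> bump_algebra \<Longrightarrow> g \<in> bump_algebra \<Longrightarrow> (\<lambda>t. f t + g t) \<in> bump_algebra"
| mult: "f \<in> bump_algebra \<Longrightarrow> g \<in> bump_algebra \<Longrightarrow> (\<lambda>t. f t * g t) \<in> bump_algebra"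
| cmult: "f \<in> bump_algebra \<Longrightarrow> (\<lambda>t. c * f t) \<in> bump_algebra"

lemma bump_algebra_derivative:
  "f \<in> bump_algebra \<Longrightarrow> \<exists>f'\<in>bump_algebra. \<forall>t. (f has_real_derivative f' t) (at t)"
proof (induction rule: bump_algebra.induct)
  case (atom j a b)
  let ?f' = "\<lambda>t. a * (bump_atom (j + 2) (a * t + b) + (- real j) * bump_atom (j + 1) (a * t + b))"
  have "?f' \<in> bump_algebra" by (intro bump_algebra.intros)
  moreover have "((\<lambda>t. bump_atom j (a * t + b)) has_real_derivative ?f' t) (at t)" for t
  proof -
    have "((\<lambda>t. a * t + b) has_real_derivative a) (at t)" by (auto intro!: derivative_eq_intros)
    from DERIV_chain2[where f = "bump_atom j", OF bump_atom_has_derivative this]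
    show ?thesis by (simp add: algebra_simps)
  qed
  ultimately show ?case by (intro bexI[of _ ?f'] allI)
next
  case (add f g)
  then obtain f' g' where "f' \<in> bump_algebra" "g' \<in> bump_algebra"
    "\<And>t. (f has_real_derivative f' t) (at t)" "\<And>t. (g has_real_derivative g' t) (at t)" by blast
  then show ?case by (intro bexI[of _ "\<lambda>t. f' t + g' t"]) (auto intro: DERIV_add bump_algebra.intros)
next
  case (mult f g)
  then obtain f' g' where "f' \<in> bump_algebra" "g' \<in> bump_algebra"
    "\<And>t. (f has_real_derivative f' t) (at t)" "\<And>t. (g has_real_derivative g' t) (at t)" by blast
  then show ?case using mult
    by (intro bexI[of _ "\<lambda>t. f' t * g t + g' t * f t"]) (auto intro: DERIV_mult bump_algebra.intros)
next
  case (cmult f c)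
  then obtain f' where "f' \<in> bump_algebra" "\<And>t. (f has_real_derivative f' t) (at t)" by blast
  then show ?case by (intro bexI[of _ "\<lambda>t. c * f' t"]) (auto intro: DERIV_cmult bump_algebra.intros)
qed

text \<open>For n > 0 this is exp(-1/(n(t-a))) exp(-1/(n(b-t))) on (a, b), tending to the indicator
  of (a, b). The arguments are in affine form so that the factors match the atoms of
  \<open>bump_algebra\<close>.\<close>

definition plateau :: "real \<Rightarrow> real \<Rightarrow> nat \<Rightarrow> real \<Rightarrow> real" where
  "plateau a b n t = bump_atom 0 (real n * t + (- real n * a)) * bump_atom 0 ((- real n) * t + real n * b)"

lemma plateau_test_function:
  assumes "0 < a" "n > 0"
  shows "test_function (plateau a b n)"
proof -
  have "plateau a b n \<in> bump_algebra" unfolding plateau_def by (intro bump_algebra.intros)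
  then have "smooth (plateau a b n)" by (rule smooth_coinduct[rotated]) (rule bump_algebra_derivative)
  moreover have "plateau a b n t = 0" if "t \<notin> {a..b}" for t
  proof -
    have "real n * t + (- real n * a) \<le> 0 \<or> (- real n) * t + real n * b \<le> 0"
      using that assms(2) by (auto simp: mult_left_mono less_imp_le not_le)
    then show ?thesis by (auto simp: plateau_def bump_atom_def)
  qed
  ultimately show ?thesis using assms(1) unfolding test_function_def smooth_def by blast
qed

lemma bump_atom_0_bounds: "0 \<le> bump_atom 0 x" "bump_atom 0 x \<le> 1"
  by (auto simp: bump_atom_def)

lemma plateau_bound: "\<bar>plateau a b n t\<bar> \<le> indicator {a<..<b} t"
proof (cases "t \<in> {a<..<b}")
  case True
  then show ?thesis
    using mult_mono[OF bump_atom_0_bounds(2) bump_atom_0_bounds(2) zero_le_one bump_atom_0_bounds(1)]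
    by (simp add: plateau_def abs_mult bump_atom_0_bounds)
next
  case False
  then have "t \<le> a \<or> b \<le> t" by auto
  then have "real n * t + (- real n * a) \<le> 0 \<or> (- real n) * t + real n * b \<le> 0"
    by (auto simp: mult_left_mono)
  then show ?thesis using False by (auto simp: plateau_def bump_atom_def)
qed

lemma plateau_tendsto: "(\<lambda>n. plateau a b n t) \<longlonglongrightarrow> indicator {a<..<b} t"
proof (cases "t \<in> {a<..<b}")
  case True
  have lim: "(\<lambda>n. bump_atom 0 (real n * c)) \<longlonglongrightarrow> 1" if "c > 0" for c
  proof -
    have "(\<lambda>n. exp (- (1 / c * (1 / real n)))) \<longlonglongrightarrow> exp (- (1 / c * 0))"
      by (intro tendsto_intros lim_1_over_n)
    moreover have "\<forall>\<^sub>F n in sequentially. exp (- (1 / c * (1 / real n))) = bump_atom 0 (real n * c)"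
      using eventually_gt_at_top[of 0] by eventually_elim (use that in \<open>simp add: bump_atom_def\<close>)
    ultimately show ?thesis using Lim_transform_eventually by force
  qed
  have "(\<lambda>n. bump_atom 0 (real n * (t - a)) * bump_atom 0 (real n * (b - t))) \<longlonglongrightarrow> 1 * 1"
    using True by (intro tendsto_mult lim) auto
  then show ?thesis using True by (simp add: plateau_def algebra_simps)
next
  case False
  then have "plateau a b n t = 0" for n using plateau_bound[of a b n t] by simp
  then show ?thesis using False by simp
qed

section \<open>Test functions and integration\<close>

lemma test_function_deriv_iter:
  assumes "test_function \<phi>"
  shows "test_function ((deriv ^^ n) \<phi>)"
proof -
  obtain a b where ab: "0 < a" "\<And>t. t \<notin> {a..b} \<Longrightarrow> \<phi> t = 0" using assms
    by (auto simp: test_function_def)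
  have "(deriv ^^ n) \<phi> t = 0" if "t \<notin> {a..b}" for t
    using that
  proof (induction n arbitrary: t)
    case (Suc n)
    have "open (- {a..b})" by auto
    have "((\<lambda>_. 0) has_real_derivative 0) (at t)" by simp
    then have "((deriv ^^ n) \<phi> has_real_derivative 0) (at t)"
      by (rule has_field_derivative_transform_within_open[OF _ \<open>open (- {a..b})\<close>]) (use Suc in auto)
    then show ?case by (simp add: DERIV_imp_deriv)
  qed (use ab in auto)
  then show ?thesis
    using assms ab(1) unfolding test_function_def
    by (auto simp flip: funpow_add[unfolded o_def, THEN fun_cong] comp_apply[of "deriv ^^ _"])
qed

lemma test_function_deriv: "test_function \<phi> \<Longrightarrow> test_function (deriv \<phi>)"
  using test_function_deriv_iter[of \<phi> 1] by simp

lemma test_function_has_derivative: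
  "test_function \<phi> \<Longrightarrow> (\<phi> has_real_derivative deriv \<phi> t) (at t)"
  unfolding test_function_def by (metis DERIV_deriv_iff_field_differentiable funpow_0)

lemma test_function_continuous: "test_function \<phi> \<Longrightarrow> continuous_on S \<phi>"
  by (meson DERIV_isCont continuous_at_imp_continuous_on test_function_has_derivative)

lemma borel_measurable_Rplus:
  fixes f :: "real \<Rightarrow> 'b::{banach,second_countable_topology}"
  assumes "continuous_on {0<..} f"
  shows "f \<in> borel_measurable Rplus"
proof -
  have "f \<in> borel_measurable (restrict_space borel {0<..})"
    using assms by (rule borel_measurable_continuous_on_restrict)
  then have "(\<lambda>x. indicator {0<..} x *\<^sub>R f x) \<in> borel_measurable borel"
    by (subst (asm) borel_measurable_restrict_space_iff) auto
  then have "(\<lambda>x. indicator {0<..} x *\<^sub>R f x) \<in> borel_measurable lebesgue"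
    using measurable_completion[of _ lborel] by simp
  then show ?thesis by (subst borel_measurable_restrict_space_iff) auto
qed

lemma integrable_lebesgue_on_Icc:
  fixes f :: "real \<Rightarrow> 'b::{banach,second_countable_topology}"
  assumes "continuous_on {a..b} f"
  shows "integrable (lebesgue_on {a..b}) f"
proof -
  have "integrable lborel (\<lambda>x. indicator {a..b} x *\<^sub>R f x)"
    using borel_integrable_atLeastAtMost'[OF assms] by (simp add: set_integrable_def)
  then have "integrable lebesgue (\<lambda>x. indicator {a..b} x *\<^sub>R f x)"
    by (subst integrable_completion) (auto dest: borel_measurable_integrable)
  then show ?thesis by (subst integrable_restrict_space) auto
qed

lemma integrable_Rplus_iff_Icc:
  fixes f :: "real \<Rightarrow> 'b::{banach,second_countable_topology}"
  assumes "0 < a" "\<And>t. t \<notin> {a..b} \<Longrightarrow> f t = 0"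
  shows "integrable Rplus f \<longleftrightarrow> integrable (lebesgue_on {a..b}) f"
    and "integral\<^sup>L Rplus f = integral\<^sup>L (lebesgue_on {a..b}) f"
proof -
  have "(\<lambda>t. indicator {0<..} t *\<^sub>R f t) = (\<lambda>t. indicator {a..b} t *\<^sub>R f t)"
    using assms by (auto simp: fun_eq_iff indicator_def)
  then show "integrable Rplus f \<longleftrightarrow> integrable (lebesgue_on {a..b}) f"
    and "integral\<^sup>L Rplus f = integral\<^sup>L (lebesgue_on {a..b}) f"
    by (simp_all add: integrable_restrict_space integral_restrict_space)
qed

lemma test_function_L2:
  assumes "test_function \<phi>"
  shows "\<phi> \<in> L2"
proof -
  obtain a b where ab: "0 < a" "\<And>t. t \<notin> {a..b} \<Longrightarrow> \<phi> t = 0" using assms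
    by (auto simp: test_function_def)
  have "integrable Rplus (\<lambda>t. (norm (\<phi> t))\<^sup>2)"
    by (subst integrable_Rplus_iff_Icc[OF ab(1), of b])
       (auto simp: ab intro!: integrable_lebesgue_on_Icc continuous_on_power test_function_continuous[OF assms])
  then show ?thesis
    by (simp add: L2_def borel_measurable_Rplus test_function_continuous assms)
qed

lemma test_function_times_integrable:
  assumes \<phi>: "test_function \<phi>" and v: "loc_integrable v"
  shows "integrable Rplus (\<lambda>t. \<phi> t *\<^sub>R v t)"
proof -
  obtain a b where ab: "0 < a" "\<And>t. t \<notin> {a..b} \<Longrightarrow> \<phi> t = 0" using \<phi>
    by (auto simp: test_function_def)
  have "compact (\<phi> ` {a..b})"
    by (intro compact_continuous_image test_function_continuous[OF \<phi>]) auto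
  then obtain M where M: "\<And>t. t \<in> {a..b} \<Longrightarrow> \<bar>\<phi> t\<bar> \<le> M"
    by (metis bounded_iff compact_imp_bounded imageI real_norm_def)
  have v': "integrable (lebesgue_on {a..b}) v" using v ab(1) by (simp add: loc_integrable_def)
  have "integrable (lebesgue_on {a..b}) (\<lambda>t. \<phi> t *\<^sub>R v t)"
  proof (rule Bochner_Integration.integrable_bound)
    show "integrable (lebesgue_on {a..b}) (\<lambda>t. M *\<^sub>R v t)" using v' by simp
    show "(\<lambda>t. \<phi> t *\<^sub>R v t) \<in> borel_measurable (lebesgue_on {a..b})"
      using integrable_lebesgue_on_Icc[OF test_function_continuous[OF \<phi>]] v'
      by (intro borel_measurable_scaleR) (auto dest: borel_measurable_integrable)
    have "norm (\<phi> t *\<^sub>R v t) \<le> norm (M *\<^sub>R v t)" if "t \<in> {a..b}" for t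
      using M[OF that] by (auto intro!: mult_right_mono)
    then show "AE t in lebesgue_on {a..b}. norm (\<phi> t *\<^sub>R v t) \<le> norm (M *\<^sub>R v t)"
      by (intro AE_I2) auto
  qed
  then show ?thesis by (subst integrable_Rplus_iff_Icc[OF ab(1)]) (auto simp: ab)
qed

lemma L2_loc_integrable:
  assumes "v \<in> L2"
  shows "loc_integrable v"
  unfolding loc_integrable_def
proof (intro allI impI)
  fix a b :: real assume a: "0 < a"
  have eq: "(\<lambda>t. (indicat_real {a..b} t)\<^sup>2) = indicat_real {a..b}" by (auto simp: indicator_def)
  have "integrable Rplus (indicat_real {a..b})"
    using a by (subst integrable_Rplus_iff_Icc[of a b])
      (auto intro!: Bochner_Integration.integrable_cong[THEN iffD1, OF refl _ integrable_lebesgue_on_Icc[of a b "\<lambda>_. 1::real"]])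
  then have "indicat_real {a..b} \<in> L2" by (auto simp: L2_def eq dest: borel_measurable_integrable)
  from L2_scaleR_integrable[OF this assms]
  have "integrable Rplus (\<lambda>t. indicat_real {a..b} t *\<^sub>R v t)" .
  then have "integrable (lebesgue_on {a..b}) (\<lambda>t. indicat_real {a..b} t *\<^sub>R v t)"
    by (subst (asm) integrable_Rplus_iff_Icc[OF a]) auto
  then show "integrable (lebesgue_on {a..b}) v"
    by (rule Bochner_Integration.integrable_cong[THEN iffD1, rotated 2]) auto
qed

section \<open>The fundamental lemma of the calculus of variations\<close>

lemma integrable_indicator_on:
  fixes v :: "'a::euclidean_space \<Rightarrow> 'h::{banach,second_countable_topology}"
  assumes v: "integrable (lebesgue_on I) v" and A: "A \<in> sets lebesgue"
  shows "integrable (lebesgue_on I) (\<lambda>t. indicator A t *\<^sub>R v t)"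
proof -
  have "A \<inter> space (lebesgue_on I) \<in> sets (lebesgue_on I)" using A
    by (auto simp: sets_restrict_space)
  from integrable_mult_indicator[OF this v] show ?thesis
    by (rule Bochner_Integration.integrable_cong[THEN iffD1, rotated 2]) (auto simp: indicator_def)
qed

text \<open>Half-lines generate the Borel sets and are stable under intersection, and the sets over
  which v integrates to 0 form a Dynkin class, so all Borel sets qualify; Lebesgue sets differ from
  Borel ones by null sets.\<close>

lemma AE_zero_if_interval_integrals_zero:
  fixes v :: "real \<Rightarrow> 'h::{banach,second_countable_topology}"
  assumes v: "integrable (lebesgue_on {a..b}) v"
    and zero: "\<And>d. (LINT t|lebesgue_on {a..b}. indicator {..<d} t *\<^sub>R v t) = 0"
  shows "AE t in lebesgue_on {a..b}. v t = 0"
proof -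
  let ?I = "lebesgue_on {a..b}"
  interpret finite_measure ?I
    by (rule finite_measureI) (simp add: emeasure_restrict_space emeasure_lborel_Icc_eq)
  note ind = integrable_indicator_on[OF v]
  \<comment> \<open>With d = b + 1 the half-line contains the whole interval; complements are
    handled by subtracting from this integral.\<close>
  have all: "(LINT t|?I. v t) = 0"
  proof -
    have "(LINT t|?I. v t) = (LINT t|?I. indicator {..<b + 1} t *\<^sub>R v t)"
      by (rule Bochner_Integration.integral_cong) auto
    then show ?thesis using zero by simp
  qed
  have borel: "(LINT t|?I. indicator A t *\<^sub>R v t) = 0" if "A \<in> sets borel" for A
  proof -
    have A: "A \<in> sigma_sets UNIV (range lessThan)"
      using that by (simp add: borel_Iio[where 'a = real])
    have "Int_stable (range (lessThan :: real \<Rightarrow> real set))"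
    proof (rule Int_stableI)
      fix A B :: "real set" assume "A \<in> range lessThan" "B \<in> range lessThan"
      then obtain x y where "A = {..<x}" "B = {..<y}" by blast
      then have "A \<inter> B = {..<min x y}" by auto
      then show "A \<inter> B \<in> range lessThan" by blast
    qed
    then show ?thesis using subset_UNIV[of "range lessThan", folded Pow_UNIV] A
    proof (rule sigma_sets_induct_disjoint)
      show "(LINT t|?I. indicator A t *\<^sub>R v t) = 0" if "A \<in> range lessThan" for A
        using that zero by auto
      show "(LINT t|?I. indicator {} t *\<^sub>R v t) = 0" by simp
    next
      fix A assume A: "A \<in> sigma_sets UNIV (range (lessThan :: real \<Rightarrow> _))"
        and IH: "(LINT t|?I. indicator A t *\<^sub>R v t) = 0"
      have "A \<in> sets lebesgue" using A
        by (simp flip: borel_Iio[where 'a = real, THEN arg_cong[of _ _ sets], simplified])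
      have "(LINT t|?I. indicator (UNIV - A) t *\<^sub>R v t) = (LINT t|?I. v t - indicator A t *\<^sub>R v t)"
        by (rule Bochner_Integration.integral_cong) (auto simp: indicator_def)
      also have "\<dots> = (LINT t|?I. v t) - (LINT t|?I. indicator A t *\<^sub>R v t)"
        by (rule Bochner_Integration.integral_diff[OF v ind]) fact
      finally show "(LINT t|?I. indicator (UNIV - A) t *\<^sub>R v t) = 0" using all IH by simp
    next
      fix F :: "nat \<Rightarrow> real set"
      assume F: "disjoint_family F" "range F \<subseteq> sigma_sets UNIV (range lessThan)"
        and IH: "\<And>i. (LINT t|?I. indicator (F i) t *\<^sub>R v t) = 0"
      have F': "F i \<in> sets lebesgue" for i
        using F(2) by (auto simp flip: borel_Iio[where 'a = real, THEN arg_cong[of _ _ sets], simplified])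
      have "(\<lambda>n. LINT t|?I. (\<Sum>i<n. indicator (F i) t *\<^sub>R v t)) \<longlonglongrightarrow> (LINT t|?I. indicator (\<Union>i. F i) t *\<^sub>R v t)"
      proof (rule integral_dominated_convergence[where w = "\<lambda>t. norm (v t)"])
        show "(\<lambda>t. indicator (\<Union>i. F i) t *\<^sub>R v t) \<in> borel_measurable ?I"
          using ind[of "\<Union>i. F i"] F' by (auto dest: borel_measurable_integrable)
        show "(\<lambda>t. \<Sum>i<n. indicator (F i) t *\<^sub>R v t) \<in> borel_measurable ?I" for n
          by (intro borel_measurable_sum borel_measurable_integrable[OF ind] F')
        show "integrable ?I (\<lambda>t. norm (v t))" using v by simp
        have eq: "(\<Sum>i<n. indicator (F i) t *\<^sub>R v t) = indicator (\<Union>i<n. F i) t *\<^sub>R v t"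
          for n t
        proof -
          have "(\<Sum>i<n. indicat_real (F i) t) = indicator (\<Union>i<n. F i) t"
            by (rule indicator_UN_disjoint[symmetric]) (use F(1) in \<open>auto simp: disjoint_family_on_def\<close>)
          then show ?thesis by (simp flip: scaleR_left.sum)
        qed
        show "AE t in ?I. (\<lambda>n. \<Sum>i<n. indicator (F i) t *\<^sub>R v t) \<longlonglongrightarrow> indicator (\<Union>i. F i) t *\<^sub>R v t"
          unfolding eq by (intro AE_I2 tendsto_intros LIMSEQ_indicator_UN)
        show "AE t in ?I. norm (\<Sum>i<n. indicator (F i) t *\<^sub>R v t) \<le> norm (v t)" for n
          unfolding eq by (auto simp: indicator_def)
      qed
      moreover have "(LINT t|?I. (\<Sum>i<n. indicator (F i) t *\<^sub>R v t)) = 0" for n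
        by (subst Bochner_Integration.integral_sum) (auto intro: ind F' simp: IH)
      ultimately show "(LINT t|?I. indicator (\<Union>i. F i) t *\<^sub>R v t) = 0"
        using LIMSEQ_unique[OF _ tendsto_const] by auto
    qed
  qed
  show ?thesis
  proof (rule density_zero[OF v])
    fix A assume A: "A \<in> sets ?I"
    then have "A \<in> sets lebesgue" by (auto simp: sets_restrict_space)
    then obtain S N N' where S: "A = S \<union> N" "N \<subseteq> N'" "N' \<in> null_sets lborel"
      "S \<in> sets lborel"
      by (rule sets_completionE)
    have "AE t in lebesgue. t \<notin> N'" by (intro AE_not_in null_sets_completionI S)
    then have "AE t in ?I. t \<notin> N'" by (subst AE_restrict_space_iff) auto
    then have "AE t in ?I. indicator A t *\<^sub>R v t = indicator S t *\<^sub>R v t"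
      by eventually_elim (use S in \<open>auto simp: indicator_def\<close>)
    then have "(LINT t|?I. indicator A t *\<^sub>R v t) = (LINT t|?I. indicator S t *\<^sub>R v t)"
      using ind[of A] ind[of S] S(4) \<open>A \<in> sets lebesgue\<close>
      by (intro integral_cong_AE) (auto dest: borel_measurable_integrable)
    then show "set_lebesgue_integral ?I A v = 0"
      using borel[of S] S(4) by (simp add: set_lebesgue_integral_def)
  qed
qed

lemma AE_Rplus_if_Icc:
  assumes "\<And>a b. 0 < a \<Longrightarrow> AE t in lebesgue_on {a..b}. P t"
  shows "AE t in Rplus. P t"
proof -
  have "AE t in lebesgue. \<forall>n. t \<in> {1 / real (Suc n)..real n} \<longrightarrow> P t"
    unfolding AE_all_countable using assms by (auto simp: AE_restrict_space_iff)
  then have "AE t in lebesgue. t \<in> {0<..} \<longrightarrow> P t"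
  proof eventually_elim
    case (elim t)
    show ?case
    proof
      assume t: "t \<in> {0<..}"
      obtain n1 where n1: "inverse (real (Suc n1)) < t" using reals_Archimedean[of t] t by auto
      obtain n2 where n2: "t \<le> real n2" using real_arch_simple by blast
      have "1 / real (Suc (max n1 n2)) \<le> 1 / real (Suc n1)" by (intro divide_left_mono) auto
      then have "t \<in> {1 / real (Suc (max n1 n2))..real (max n1 n2)}"
        using n1 n2 by (auto simp: inverse_eq_divide)
      then show "P t" using elim by blast
    qed
  qed
  then show ?thesis by (subst AE_restrict_space_iff) auto
qed

text \<open>Plateau functions converge boundedly to indicators of intervals, so vanishing against
  test functions gives vanishing integrals over intervals. Integrals rather than signs are used
  because v is vector-valued.\<close>

lemma fundamental_lemma:
  assumes v: "loc_integrable v"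
    and zero: "\<And>\<phi>. test_function \<phi> \<Longrightarrow> (LINT t|Rplus. \<phi> t *\<^sub>R v t) = 0"
  shows "AE t in Rplus. v t = 0"
proof (rule AE_Rplus_if_Icc)
  fix a b :: real assume a: "0 < a"
  let ?I = "lebesgue_on {a..b}"
  have vI: "integrable ?I v" using v a by (simp add: loc_integrable_def)
  show "AE t in ?I. v t = 0"
  proof (rule AE_zero_if_interval_integrals_zero[OF vI])
    fix d :: real
    \<comment> \<open>Plateaus on (a, min b d) stay inside {a..b}; on {a..b} their limit differs
      from the indicator of {..<d} at most at the end points a and b.\<close>
    let ?b = "min b d"
    have v': "integrable ?I (\<lambda>t. \<phi> t *\<^sub>R v t)" if "test_function \<phi>"
      "\<And>t. t \<notin> {a..b} \<Longrightarrow> \<phi> t = 0" for \<phi>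
      using test_function_times_integrable[OF that(1) v] a that(2)
      by (subst (asm) integrable_Rplus_iff_Icc[OF a]) auto
    have pl0: "plateau a ?b (Suc n) t = 0" if "t \<notin> {a..b}" for n t
      using plateau_bound[of a ?b "Suc n" t] that by (auto simp: indicator_def split: if_splits)
    have lim: "(\<lambda>n. LINT t|?I. plateau a ?b (Suc n) t *\<^sub>R v t) \<longlonglongrightarrow> (LINT t|?I. indicator {a<..<?b} t *\<^sub>R v t)"
    proof (rule integral_dominated_convergence[where w = "\<lambda>t. norm (v t)"])
      show "(\<lambda>t. indicator {a<..<?b} t *\<^sub>R v t) \<in> borel_measurable ?I"
        using integrable_indicator_on[OF vI, of "{a<..<?b}"] by (auto dest: borel_measurable_integrable)
      show "(\<lambda>t. plateau a ?b (Suc n) t *\<^sub>R v t) \<in> borel_measurable ?I" for n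
        using v'[OF plateau_test_function[OF a] pl0] by (auto dest: borel_measurable_integrable)
      show "integrable ?I (\<lambda>t. norm (v t))" using vI by simp
      show "AE t in ?I. (\<lambda>n. plateau a ?b (Suc n) t *\<^sub>R v t) \<longlonglongrightarrow> indicator {a<..<?b} t *\<^sub>R v t"
        by (intro AE_I2 tendsto_intros LIMSEQ_Suc plateau_tendsto)
      have "norm (plateau a ?b (Suc n) t *\<^sub>R v t) \<le> norm (v t)" for n t
      proof -
        have "\<bar>plateau a ?b (Suc n) t\<bar> \<le> 1"
          by (rule order_trans[OF plateau_bound]) (simp add: indicator_def)
        then show ?thesis by (simp add: mult_left_le_one_le)
      qed
      then show "AE t in ?I. norm (plateau a ?b (Suc n) t *\<^sub>R v t) \<le> norm (v t)" for n by simp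
    qed
    have "(LINT t|?I. plateau a ?b (Suc n) t *\<^sub>R v t) = 0" for n
      using zero[OF plateau_test_function[OF a], of "Suc n" ?b] pl0[of _ n]
        integrable_Rplus_iff_Icc(2)[OF a, of b "\<lambda>t. plateau a ?b (Suc n) t *\<^sub>R v t"] by simp
    then have "(LINT t|?I. indicator {a<..<?b} t *\<^sub>R v t) = 0"
      using LIMSEQ_unique[OF lim] by auto
    moreover have "(LINT t|?I. indicator {..<d} t *\<^sub>R v t) = (LINT t|?I. indicator {a<..<?b} t *\<^sub>R v t)"
    proof (rule integral_cong_AE)
      show "(\<lambda>t. indicator {a<..<?b} t *\<^sub>R v t) \<in> borel_measurable ?I"
        "(\<lambda>t. indicator {..<d} t *\<^sub>R v t) \<in> borel_measurable ?I"
        by (rule borel_measurable_integrable[OF integrable_indicator_on[OF vI]], simp)+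
      have "{a, b} \<in> null_sets lborel" by (intro finite_imp_null_set_lborel) auto
      then have "AE t in lebesgue. t \<notin> {a, b}" by (intro AE_not_in null_sets_completionI)
      then show "AE t in ?I. indicator {..<d} t *\<^sub>R v t = indicator {a<..<?b} t *\<^sub>R v t"
      proof (subst AE_restrict_space_iff, simp, elim eventually_mono, intro impI)
        fix t assume "t \<notin> {a, b}" "t \<in> {a..b}"
        then have "t \<in> {..<d} \<longleftrightarrow> t \<in> {a<..<?b}" by auto
        then show "indicator {..<d} t *\<^sub>R v t = indicator {a<..<?b} t *\<^sub>R v t"
          by (simp only: indicator_def)
      qed
    qed
    ultimately show "(LINT t|?I. indicator {..<d} t *\<^sub>R v t) = 0" by simp
  qed
qed

section \<open>Weak derivatives\<close>

lemma loc_integrable_diff: "loc_integrable u \<Longrightarrow> loc_integrable v \<Longrightarrow> loc_integrable (\<lambda>t. u t - v t)"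
  by (simp add: loc_integrable_def)

lemma has_weak_derivD:
  "has_weak_deriv n u v \<Longrightarrow> test_function \<phi> \<Longrightarrow>
    (LINT t|Rplus. (deriv ^^ n) \<phi> t *\<^sub>R u t) = (-1) ^ n *\<^sub>R (LINT t|Rplus. \<phi> t *\<^sub>R v t)"
  by (simp add: has_weak_deriv_def)

lemma has_weak_deriv_unique:
  assumes "has_weak_deriv n u v" "has_weak_deriv n u w"
  shows "AE t in Rplus. v t = w t"
proof -
  have li: "loc_integrable v" "loc_integrable w" using assms by (auto simp: has_weak_deriv_def)
  have "AE t in Rplus. v t - w t = 0"
  proof (rule fundamental_lemma[OF loc_integrable_diff[OF li]])
    fix \<phi> assume \<phi>: "test_function \<phi>"
    have "(-1) ^ n *\<^sub>R (LINT t|Rplus. \<phi> t *\<^sub>R v t) = (-1) ^ n *\<^sub>R (LINT t|Rplus. \<phi> t *\<^sub>R w t)"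
      using has_weak_derivD[OF assms(1) \<phi>] has_weak_derivD[OF assms(2) \<phi>] by simp
    then have "(LINT t|Rplus. \<phi> t *\<^sub>R v t) = (LINT t|Rplus. \<phi> t *\<^sub>R w t)" by simp
    then show "(LINT t|Rplus. \<phi> t *\<^sub>R (v t - w t)) = 0"
      by (simp add: scaleR_diff_right test_function_times_integrable[OF \<phi>] li)
  qed
  then show ?thesis by simp
qed

lemma has_weak_deriv_weak_deriv:
  assumes "has_weak_deriv n u v"
  shows "AE t in Rplus. weak_deriv n u t = v t"
  by (rule has_weak_deriv_unique[OF _ assms]) (simp add: weak_deriv_def someI[of "has_weak_deriv n u", OF assms])

lemma has_weak_deriv_0: "loc_integrable u \<Longrightarrow> has_weak_deriv 0 u u"
  by (simp add: has_weak_deriv_def)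

lemma has_weak_deriv_Suc:
  assumes uv: "has_weak_deriv 1 u v" and vw: "has_weak_deriv n v w"
  shows "has_weak_deriv (Suc n) u w"
  unfolding has_weak_deriv_def
proof (intro conjI allI impI)
  show "loc_integrable u" "loc_integrable w" using assms by (auto simp: has_weak_deriv_def)
  fix \<phi> assume \<phi>: "test_function \<phi>"
  have "(LINT t|Rplus. (deriv ^^ Suc n) \<phi> t *\<^sub>R u t) = - (LINT t|Rplus. (deriv ^^ n) \<phi> t *\<^sub>R v t)"
    using has_weak_derivD[OF uv test_function_deriv_iter[OF \<phi>, of n]] by simp
  also have "\<dots> = - ((-1) ^ n *\<^sub>R (LINT t|Rplus. \<phi> t *\<^sub>R w t))"
    using has_weak_derivD[OF vw \<phi>] by simp
  finally show "(LINT t|Rplus. (deriv ^^ Suc n) \<phi> t *\<^sub>R u t) = (-1) ^ Suc n *\<^sub>R (LINT t|Rplus. \<phi> t *\<^sub>R w t)"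
    by simp
qed

lemma has_weak_deriv_1_l2:
  assumes "f \<in> L2" "g \<in> L2"
    and "\<And>\<phi>. test_function \<phi> \<Longrightarrow> l2_pair (deriv \<phi>) (abs_l2 f) = - l2_pair \<phi> (abs_l2 g)"
  shows "has_weak_deriv 1 f g"
  unfolding has_weak_deriv_def
  using assms by (auto simp: L2_loc_integrable l2_pair_abs test_function_L2 test_function_deriv)

lemma l2_pair_eq_0:
  assumes "\<And>\<phi>. test_function \<phi> \<Longrightarrow> l2_pair \<phi> x = 0"
  shows "x = 0"
proof (rule l2_cases[of x])
  fix f assume f: "f \<in> L2" "x = abs_l2 f"
  have "AE t in Rplus. f t = 0"
    by (rule fundamental_lemma[OF L2_loc_integrable[OF f(1)]])
       (use assms in \<open>simp add: f l2_pair_abs test_function_L2\<close>)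
  then show ?thesis using f abs_l2_eq_iff[OF f(1) L2_zero] by (simp add: zero_l2_def)
qed


section \<open>Square-integrable functions with a continuous square-integrable derivative\<close>

text \<open>Derivatives are taken within the closed half-line, so that x 0 is the boundary value in
  integration by parts.\<close>

definition C1L2 ::
    "(real \<Rightarrow> 'h) \<Rightarrow> (real \<Rightarrow> 'h::{real_inner,banach,second_countable_topology}) \<Rightarrow> bool" where
  "C1L2 x y \<longleftrightarrow> x \<in> L2 \<and> y \<in> L2 \<and> continuous_on {0..} y
     \<and> (\<forall>t\<ge>0. (x has_vector_derivative y t) (at t within {0..}))"

lemma C1L2D:
  assumes "C1L2 x y"
  shows "x \<in> L2" "y \<in> L2" "continuous_on {0..} y"
    "0 \<le> t \<Longrightarrow> (x has_vector_derivative y t) (at t within {0..})" "continuous_on {0..} x"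
  using assms unfolding C1L2_def continuous_on_eq_continuous_within[of "{0..}" x]
  by (auto intro: has_vector_derivative_continuous)

lemma C1L2_bounded_linear:
  assumes S: "bounded_linear S" and xy: "C1L2 x y"
  shows "C1L2 (\<lambda>t. S (x t)) (\<lambda>t. S (y t))"
  using C1L2D[OF xy] unfolding C1L2_def
  by (auto intro!: L2_bounded_linear[OF S] bounded_linear.continuous_on[OF S]
      bounded_linear.has_vector_derivative[OF S])

lemma C1L2_add:
  assumes "C1L2 x y" "C1L2 x' y'"
  shows "C1L2 (\<lambda>t. x t + x' t) (\<lambda>t. y t + y' t)"
  using C1L2D[OF assms(1)] C1L2D[OF assms(2)] unfolding C1L2_def
  by (auto intro!: L2_add continuous_intros has_vector_derivative_add)

lemma integral_Rplus_Icc: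
  fixes F :: "real \<Rightarrow> real"
  assumes "0 \<le> T" and F: "\<And>t. 0 \<le> t \<Longrightarrow> (F has_vector_derivative F' t) (at t within {0..})"
    and F': "continuous_on {0..} F'"
  shows "integrable Rplus (\<lambda>t. indicator {0..T} t *\<^sub>R F' t)"
    "(LINT t|Rplus. indicator {0..T} t *\<^sub>R F' t) = F T - F 0"
proof -
  have cont: "continuous_on {0..T} F'" by (rule continuous_on_subset[OF F']) auto
  have i: "integrable lborel (\<lambda>t. indicator {0..T} t *\<^sub>R F' t)"
    using borel_integrable_atLeastAtMost'[OF cont] by (simp add: set_integrable_def)
  have "integral\<^sup>L lborel (\<lambda>t. indicator {0..T} t *\<^sub>R F' t) = F T - F 0"
    by (rule integral_FTC_atLeastAtMost[OF assms(1) _ cont])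
       (rule has_vector_derivative_within_subset[OF F], auto)
  then have i': "integrable lebesgue (\<lambda>t. indicator {0..T} t *\<^sub>R F' t)"
    and e': "integral\<^sup>L lebesgue (\<lambda>t. indicator {0..T} t *\<^sub>R F' t) = F T - F 0"
    using i by (auto simp: integrable_completion integral_completion dest: borel_measurable_integrable)
  have "AE t in lebesgue. t \<notin> {0::real}"
    by (intro AE_not_in null_sets_completionI finite_imp_null_set_lborel) auto
  then have ae: "AE t in lebesgue. indicator {0..T} t *\<^sub>R F' t = indicator {0<..} t *\<^sub>R (indicator {0..T} t *\<^sub>R F' t)"
    by eventually_elim (auto simp: indicator_def)
  have m: "(\<lambda>t. indicator {0<..} t *\<^sub>R (indicator {0..T} t *\<^sub>R F' t)) \<in> borel_measurable lebesgue"
    by (rule borel_measurable_scaleR[OF _ borel_measurable_integrable[OF i']]) (rule borel_measurable_indicator, simp)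
  show "integrable Rplus (\<lambda>t. indicator {0..T} t *\<^sub>R F' t)"
    using integrable_cong_AE_imp[OF i' m] ae by (subst integrable_restrict_space) auto
  show "(LINT t|Rplus. indicator {0..T} t *\<^sub>R F' t) = F T - F 0"
    using integral_cong_AE[OF borel_measurable_integrable[OF i'] m ae] e'
    by (subst integral_restrict_space) auto
qed

text \<open>Integrability of the derivative gives F a limit at infinity, and integrability of F
  forces that limit to be 0; only the boundary term at 0 remains.\<close>

lemma integral_Rplus_FTC:
  fixes F :: "real \<Rightarrow> real"
  assumes F: "\<And>t. 0 \<le> t \<Longrightarrow> (F has_vector_derivative F' t) (at t within {0..})"
    and F': "continuous_on {0..} F'" and int: "integrable Rplus F" "integrable Rplus F'"
  shows "(LINT t|Rplus. F' t) = - F 0"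
proof -
  let ?l = "(LINT t|Rplus. F' t) + F 0"
  have "((\<lambda>T. LINT t|Rplus. indicator {0..T} t *\<^sub>R F' t) \<longlongrightarrow> (LINT t|Rplus. F' t)) at_top"
  proof (rule integral_dominated_convergence_at_top[where w = "\<lambda>t. norm (F' t)"])
    show "\<forall>\<^sub>F T in at_top. AE t in Rplus. norm (indicator {0..T} t *\<^sub>R F' t) \<le> norm (F' t)"
      by (auto simp: indicator_def)
    have "\<forall>\<^sub>F T in at_top. indicator {0..T} t *\<^sub>R F' t = F' t" if "t > 0" for t
      using eventually_ge_at_top[of t]
        by eventually_elim (use that in \<open>auto simp: indicator_def\<close>)
    then show "AE t in Rplus. ((\<lambda>T. indicator {0..T} t *\<^sub>R F' t) \<longlongrightarrow> F' t) at_top"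
      by (intro AE_I2 tendsto_eventually) auto
    have "(\<lambda>t. indicator {0..T} t *\<^sub>R F' t) \<in> borel_measurable Rplus" for T
      using integrable_indicator_on[OF int(2), of "{0..T}"] by (auto dest: borel_measurable_integrable)
    then show "\<And>T. (\<lambda>t. indicator {0..T} t *\<^sub>R F' t) \<in> borel_measurable Rplus" .
  qed (use int in \<open>auto dest: borel_measurable_integrable\<close>)
  moreover have "\<forall>\<^sub>F T in at_top. (LINT t|Rplus. indicator {0..T} t *\<^sub>R F' t) = F T - F 0"
    using eventually_ge_at_top[of 0] by eventually_elim (rule integral_Rplus_Icc(2)[OF _ F F'])
  ultimately have "((\<lambda>T. F T - F 0) \<longlongrightarrow> (LINT t|Rplus. F' t)) at_top"
    by (rule Lim_transform_eventually)
  from tendsto_add[OF this tendsto_const[of "F 0"]] have lim: "(F \<longlongrightarrow> ?l) at_top" by simp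
  have "?l = 0"
  proof (rule ccontr)
    assume l: "?l \<noteq> 0"
    have "\<forall>\<^sub>F t in at_top. \<bar>?l\<bar> / 2 < \<bar>F t\<bar>"
      using order_tendstoD(1)[OF tendsto_rabs[OF lim], of "\<bar>?l\<bar> / 2"] l by simp
    then obtain T0 where T0: "\<And>t. t \<ge> T0 \<Longrightarrow> \<bar>?l\<bar> / 2 < \<bar>F t\<bar>"
      by (auto simp: eventually_at_top_linorder)
    define T where "T = max T0 1"
    \<comment> \<open>|F| exceeds |l|/2 on intervals of every length n, so its integral would exceed
      every bound.\<close>
    have le: "\<bar>?l\<bar> / 2 * real n \<le> (LINT t|Rplus. \<bar>F t\<bar>)" for n
    proof -
      let ?J = "{T..T + real n}"
      have J: "integrable (lebesgue_on ?J) (\<lambda>_. \<bar>?l\<bar> / 2)"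
        "integral\<^sup>L (lebesgue_on ?J) (\<lambda>_. \<bar>?l\<bar> / 2) = \<bar>?l\<bar> / 2 * real n"
        by (auto intro!: integrable_lebesgue_on_Icc continuous_intros
            simp: measure_restrict_space)
      have eq: "integral\<^sup>L Rplus (\<lambda>t. indicator ?J t * (\<bar>?l\<bar> / 2)) = integral\<^sup>L (lebesgue_on ?J) (\<lambda>t. indicator ?J t * (\<bar>?l\<bar> / 2))"
        "integrable Rplus (\<lambda>t. indicator ?J t * (\<bar>?l\<bar> / 2)) \<longleftrightarrow> integrable (lebesgue_on ?J) (\<lambda>t. indicator ?J t * (\<bar>?l\<bar> / 2))"
        by (rule integrable_Rplus_iff_Icc; auto simp: T_def indicator_def)+
      have eq2: "integral\<^sup>L (lebesgue_on ?J) (\<lambda>t. indicator ?J t * (\<bar>?l\<bar> / 2)) = \<bar>?l\<bar> / 2 * real n"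
        unfolding J(2)[symmetric] by (rule Bochner_Integration.integral_cong) auto
      have int2: "integrable Rplus (\<lambda>t. indicator ?J t * (\<bar>?l\<bar> / 2))"
        unfolding eq(2) using J(1) by (rule Bochner_Integration.integrable_cong[THEN iffD1, rotated 2]) auto
      have "integral\<^sup>L Rplus (\<lambda>t. indicator ?J t * (\<bar>?l\<bar> / 2)) \<le> (LINT t|Rplus. \<bar>F t\<bar>)"
      proof (rule integral_mono[OF int2])
        show "integrable Rplus (\<lambda>t. \<bar>F t\<bar>)" using int(1) by simp
        fix t
        show "indicator ?J t * (\<bar>?l\<bar> / 2) \<le> \<bar>F t\<bar>"
          using T0[of t] by (cases "t \<in> ?J") (auto simp: T_def)
      qed
      then show ?thesis by (simp only: eq(1) eq2)
    qed
    obtain n where "(LINT t|Rplus. \<bar>F t\<bar>) / (\<bar>?l\<bar> / 2) < real n" using reals_Archimedean2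
      by blast
    then show False using le[of n] l by (simp add: field_simps)
  qed
  then show ?thesis by simp
qed

lemma inner_has_vector_derivative:
  assumes "(x has_vector_derivative y) (at t within S)" "(x' has_vector_derivative y') (at t within S)"
  shows "((\<lambda>s. x s \<bullet> x' s) has_vector_derivative (y \<bullet> x' t + x t \<bullet> y')) (at t within S)"
  using bounded_bilinear.has_vector_derivative[OF bounded_bilinear_inner assms] by (simp add: add.commute)

lemma C1L2_integration_by_parts:
  assumes xy: "C1L2 x y" and xy': "C1L2 x' y'"
  shows "abs_l2 y \<bullet> abs_l2 x' + abs_l2 x \<bullet> abs_l2 y' = - (x 0 \<bullet> x' 0)"
proof -
  note D = C1L2D[OF xy] C1L2D[OF xy']
  have "(LINT t|Rplus. y t \<bullet> x' t + x t \<bullet> y' t) = - (x 0 \<bullet> x' 0)"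
    by (rule integral_Rplus_FTC)
       (auto intro!: inner_has_vector_derivative D continuous_intros L2_inner_integrable)
  then show ?thesis by (simp add: abs_l2_inner D L2_inner_integrable)
qed

text \<open>The derivative of |x|^2 is 2 x . y. The pair a, b with the same pointwise product allows
  powers of B to be moved between the factors before Cauchy-Schwarz is applied.\<close>

lemma C1L2_pointwise_bound:
  assumes xy: "C1L2 x y" and ab: "a \<in> L2" "b \<in> L2"
    and eq: "\<And>t. 0 \<le> t \<Longrightarrow> x t \<bullet> y t = a t \<bullet> b t" and T: "0 \<le> T"
  shows "(norm (x T))\<^sup>2 \<le> (norm (x 0))\<^sup>2 + 2 * (norm (abs_l2 a) * norm (abs_l2 b))"
proof -
  note D = C1L2D[OF xy]
  have "(LINT t|Rplus. indicator {0..T} t *\<^sub>R (y t \<bullet> x t + x t \<bullet> y t)) = x T \<bullet> x T - x 0 \<bullet> x 0"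
    by (rule integral_Rplus_Icc(2)[OF T]) (auto intro!: inner_has_vector_derivative D continuous_intros)
  also have "(LINT t|Rplus. indicator {0..T} t *\<^sub>R (y t \<bullet> x t + x t \<bullet> y t))
      = (LINT t|Rplus. 2 * ((indicator {0..T} t *\<^sub>R a t) \<bullet> b t))"
    by (rule Bochner_Integration.integral_cong) (auto simp: eq inner_commute indicator_def)
  also have "\<dots> = 2 * (LINT t|Rplus. (indicator {0..T} t *\<^sub>R a t) \<bullet> b t)" by simp
  finally have main: "(norm (x T))\<^sup>2 - (norm (x 0))\<^sup>2 = 2 * (LINT t|Rplus. (indicator {0..T} t *\<^sub>R a t) \<bullet> b t)"
    by (simp add: power2_norm_eq_inner)
  have m: "(\<lambda>t. indicator {0..T} t *\<^sub>R a t) \<in> borel_measurable Rplus"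
    by (rule borel_measurable_scaleR[OF _ L2_D(1)[OF ab(1)]])
       (rule measurable_restrict_space1, rule borel_measurable_indicator, simp)
  have le: "(norm (indicator {0..T} t *\<^sub>R a t))\<^sup>2 \<le> (norm (a t))\<^sup>2" for t
    by (simp add: indicator_def)
  have Ia: "(\<lambda>t. indicator {0..T} t *\<^sub>R a t) \<in> L2"
    by (rule L2_mono[OF m L2_D(2)[OF ab(1)]]) (use le in auto)
  have "(LINT t|Rplus. (indicator {0..T} t *\<^sub>R a t) \<bullet> b t) = abs_l2 (\<lambda>t. indicator {0..T} t *\<^sub>R a t) \<bullet> abs_l2 b"
    by (simp add: abs_l2_inner Ia ab)
  also have "\<dots> \<le> norm (abs_l2 (\<lambda>t. indicator {0..T} t *\<^sub>R a t)) * norm (abs_l2 b)"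
    by (rule norm_cauchy_schwarz)
  also have "\<dots> \<le> norm (abs_l2 a) * norm (abs_l2 b)"
    unfolding norm_abs_l2[OF Ia] norm_abs_l2[OF ab(1)] L2_norm_def
    by (intro mult_right_mono real_sqrt_le_mono integral_mono L2_D(2) Ia ab le) auto
  finally show ?thesis using main by simp
qed

lemma C1L2_test_function:
  assumes \<phi>: "test_function \<phi>"
  shows "C1L2 (\<lambda>t. \<phi> t *\<^sub>R v) (\<lambda>t. deriv \<phi> t *\<^sub>R v)"
proof -
  have "C1L2 \<phi> (deriv \<phi>)" unfolding C1L2_def
    using test_function_has_derivative[OF \<phi>]
    by (auto intro!: test_function_L2 test_function_continuous test_function_deriv \<phi>
        simp flip: has_real_derivative_iff_has_vector_derivative intro: has_field_derivative_at_within)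
  from C1L2_bounded_linear[OF bounded_linear_scaleR_left this] show ?thesis .
qed

lemma C1L2_weak_derivative:
  assumes xy: "C1L2 x y" and \<phi>: "test_function \<phi>"
  shows "l2_pair (deriv \<phi>) (abs_l2 x) = - l2_pair \<phi> (abs_l2 y)"
proof -
  have 0: "\<phi> 0 = 0" using \<phi> by (auto simp: test_function_def)
  have L: "\<phi> \<in> L2" "deriv \<phi> \<in> L2"
    by (auto intro!: test_function_L2 test_function_deriv \<phi>)
  have "v \<bullet> l2_pair (deriv \<phi>) (abs_l2 x) = v \<bullet> - l2_pair \<phi> (abs_l2 y)" for v
    using C1L2_integration_by_parts[OF xy C1L2_test_function[OF \<phi>, of v]]
      l2_pair_inner(2)[OF L(1), of "abs_l2 y" v] l2_pair_inner(2)[OF L(2), of "abs_l2 x" v] 0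
    by (simp add: inner_commute)
  from dense_orthogonal_eq[of UNIV, OF _ this] show ?thesis by simp
qed

section \<open>The scalar equation\<close>

lemma exp_decay_L2:
  fixes f :: "real \<Rightarrow> real"
  assumes f: "continuous_on {0..} f" and k: "0 < k"
    and le: "\<And>t. 0 \<le> t \<Longrightarrow> \<bar>f t\<bar> \<le> M * exp (- k * t)"
  shows "f \<in> L2"
proof (rule L2_mono)
  show "f \<in> borel_measurable Rplus" by (rule borel_measurable_Rplus, rule continuous_on_subset[OF f]) auto
  have "(\<lambda>t. exp (- (2 * k) * t)) absolutely_integrable_on {0..}"
    using integrable_on_exp_minus_to_infinity[of "2 * k" 0] k
    by (intro nonnegative_absolutely_integrable_1) auto
  then have "set_integrable lebesgue {0<..} (\<lambda>t. exp (- (2 * k) * t))"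
    by (rule set_integrable_subset) auto
  then show "integrable Rplus (\<lambda>t. M\<^sup>2 * exp (- (2 * k) * t))"
    by (simp add: integrable_restrict_space set_integrable_def)
  have "(norm (f t))\<^sup>2 \<le> M\<^sup>2 * exp (- (2 * k) * t)" if "0 \<le> t" for t
  proof -
    have "(norm (f t))\<^sup>2 \<le> (M * exp (- k * t))\<^sup>2" using le[OF that] by (intro power_mono) auto
    also have "\<dots> = M\<^sup>2 * exp (- (2 * k) * t)"
      by (simp add: power_mult_distrib flip: exp_double)
    finally show ?thesis .
  qed
  then show "AE t in Rplus. (norm (f t))\<^sup>2 \<le> M\<^sup>2 * exp (- (2 * k) * t)" by (intro AE_I2) auto
qed

lemma continuous_on_Icc_bounded:
  fixes f :: "real \<Rightarrow> real"
  assumes "continuous_on {a..b} f"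
  obtains M where "\<forall>t\<in>{a..b}. \<bar>f t\<bar> \<le> M"
proof -
  have "bounded (f ` {a..b})"
    by (intro compact_imp_bounded compact_continuous_image assms) simp
  then obtain M where "\<forall>y\<in>f ` {a..b}. norm y \<le> M" by (auto simp: bounded_iff)
  then show ?thesis by (intro that[of M]) auto
qed

lemma antiderivative_on_half_line:
  fixes f :: "real \<Rightarrow> real"
  assumes f: "continuous_on {0..} f" and f0: "\<And>t. N \<le> t \<Longrightarrow> f t = 0" and N: "0 \<le> N"
  shows "\<exists>F M. F 0 = 0 \<and> (\<forall>t\<ge>0. (F has_real_derivative f t) (at t within {0..}))
    \<and> (\<forall>t\<ge>N. F t = F N) \<and> (\<forall>t\<ge>0. \<bar>F t\<bar> \<le> M)"
proof -
  define F where "F t = integral {0..t} f" for t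
  have F': "(F has_real_derivative f t) (at t within {0..})" if t: "0 \<le> t" for t
  proof -
    have "(F has_real_derivative f t) (at t within {0..t + 1})"
      unfolding F_def using t by (intro integral_has_real_derivative continuous_on_subset[OF f]) auto
    moreover have "at t within {0..t + 1} = at t within {0..}"
      by (rule at_within_nhd[of _ "{..<t + 1}"]) auto
    ultimately show ?thesis by simp
  qed
  have const: "F t = F N" if "N \<le> t" for t
  proof -
    have "f integrable_on {0..t}"
      by (intro integrable_continuous_real continuous_on_subset[OF f]) auto
    then have "integral {0..N} f + integral {N..t} f = F t"
      unfolding F_def using N that by (intro Henstock_Kurzweil_Integration.integral_combine) auto
    moreover have "integral {N..t} f = integral {N..t} (\<lambda>_. 0)"
      by (rule Henstock_Kurzweil_Integration.integral_cong) (use f0 in auto)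
    ultimately show ?thesis by (simp add: F_def)
  qed
  have "continuous_on {0..} F"
    using F' by (meson DERIV_continuous atLeast_iff continuous_on_eq_continuous_within)
  then have "continuous_on {0..N} F" by (rule continuous_on_subset) auto
  then obtain M where M: "\<forall>t\<in>{0..N}. \<bar>F t\<bar> \<le> M"
    by (rule continuous_on_Icc_bounded)
  have bound: "\<bar>F t\<bar> \<le> M" if "0 \<le> t" for t
    using M const[of t] that N by (cases "t \<le> N") auto
  have "F 0 = 0" by (simp add: F_def)
  then show ?thesis using F' const bound by blast
qed

lemma compact_support_exp_bound:
  fixes f :: "real \<Rightarrow> real"
  assumes f: "continuous_on {0..} f" and f0: "\<And>t. N \<le> t \<Longrightarrow> f t = 0" and k: "0 \<le> k"
  obtains M where "0 \<le> M" "\<And>t. 0 \<le> t \<Longrightarrow> \<bar>f t\<bar> \<le> M * exp (- k * t)"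
proof -
  have "continuous_on {0..N} f" by (rule continuous_on_subset[OF f]) auto
  then have "continuous_on {0..N} (\<lambda>t. f t * exp (k * t))" by (intro continuous_intros)
  then obtain M where M: "\<forall>t\<in>{0..N}. \<bar>f t * exp (k * t)\<bar> \<le> M"
    by (rule continuous_on_Icc_bounded)
  have "\<bar>f t\<bar> \<le> \<bar>M\<bar> * exp (- k * t)" if "0 \<le> t" for t
  proof (cases "t \<le> N")
    case True
    then have "\<bar>f t\<bar> * exp (k * t) \<le> \<bar>M\<bar>"
      using bspec[OF M, of t] that by (simp add: abs_mult)
    then show ?thesis by (simp add: exp_minus field_simps)
  qed (use f0 in simp)
  then show ?thesis using that[of "\<bar>M\<bar>"] by auto
qed

lemma C1L2_real_iff:
  fixes x y :: "real \<Rightarrow> real"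
  shows "C1L2 x y \<longleftrightarrow> x \<in> L2 \<and> y \<in> L2 \<and> continuous_on {0..} y
     \<and> (\<forall>t\<ge>0. (x has_real_derivative y t) (at t within {0..}))"
  by (simp add: C1L2_def has_real_derivative_iff_has_vector_derivative)

text \<open>The factors of \<open>D\<^sup>3 - c\<^sup>3 = (D - c) (D\<^sup>2 + c D + c\<^sup>2)\<close> are inverted one after the other, the first one
  by integration from infinity and the second one by variation of constants.\<close>

lemma scalar_equation_solvable:
  fixes f :: "real \<Rightarrow> real"
  assumes c: "0 < c" and f: "continuous_on {0..} f" and f0: "\<And>t. N \<le> t \<Longrightarrow> f t = 0"
    and N: "0 \<le> N"
  obtains g0 g1 g2 g3 where "C1L2 g0 g1" "C1L2 g1 g2" "C1L2 g2 g3" "g0 0 = 0" "g1 0 = 0"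
    "\<And>t. 0 \<le> t \<Longrightarrow> g3 t - c ^ 3 * g0 t = f t"
proof -
  have conti: "continuous_on {0..} F"
    if "\<And>t. 0 \<le> t \<Longrightarrow> (F has_real_derivative F' t) (at t within {0..})"
    for F F' :: "real \<Rightarrow> real"
    using that by (meson DERIV_continuous atLeast_iff continuous_on_eq_continuous_within)
  have "continuous_on {0..} (\<lambda>t. exp (- c * t) * f t)" by (intro continuous_intros f)
  moreover have "\<And>t. N \<le> t \<Longrightarrow> exp (- c * t) * f t = 0" using f0 by simp
  ultimately obtain E where E': "\<forall>t\<ge>0. (E has_real_derivative exp (- c * t) * f t) (at t within {0..})"
    "\<forall>t\<ge>N. E t = E N" using antiderivative_on_half_line[OF _ _ N] by blast
  note E = E'[rule_format]
  \<comment> \<open>Solution of w' = c w + f. Subtracting E N selects the one that vanishes beyond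
    the support of f instead of growing.\<close>
  define w where "w t = exp (c * t) * (E t - E N)" for t
  have w': "(w has_real_derivative (c * w t + f t)) (at t within {0..})" if "0 \<le> t" for t
    unfolding w_def using E(1)[OF that]
    by (auto intro!: derivative_eq_intros simp: algebra_simps exp_minus)
  have w0: "w t = 0" if "N \<le> t" for t using E(2)[OF that] by (simp add: w_def)
  have wc: "continuous_on {0..} w" by (rule conti[OF w'])
  \<comment> \<open>The characteristic roots of D^2 + c D + c^2 are - c/2 + i \<beta> and - c/2 - i
    \<beta>.\<close>
  define \<beta> where "\<beta> = sqrt 3 / 2 * c"
  have \<beta>: "\<beta> > 0" "\<beta>\<^sup>2 = 3 / 4 * c\<^sup>2" using c
    by (auto simp: \<beta>_def power_mult_distrib power_divide)
  have "continuous_on {0..} (\<lambda>t. exp (c / 2 * t) * cos (\<beta> * t) * w t)"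
    by (intro continuous_intros wc)
  moreover have "\<And>t. N \<le> t \<Longrightarrow> exp (c / 2 * t) * cos (\<beta> * t) * w t = 0" using w0
    by simp
  ultimately obtain Ic Mc where Ic': "Ic 0 = 0"
    "\<forall>t\<ge>0. (Ic has_real_derivative exp (c / 2 * t) * cos (\<beta> * t) * w t) (at t within {0..})"
    "\<forall>t\<ge>0. \<bar>Ic t\<bar> \<le> Mc" using antiderivative_on_half_line[OF _ _ N] by blast
  note Ic = Ic'[rule_format]
  have "continuous_on {0..} (\<lambda>t. exp (c / 2 * t) * sin (\<beta> * t) * w t)"
    by (intro continuous_intros wc)
  moreover have "\<And>t. N \<le> t \<Longrightarrow> exp (c / 2 * t) * sin (\<beta> * t) * w t = 0" using w0
    by simp
  ultimately obtain Is Ms where Is': "Is 0 = 0"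
    "\<forall>t\<ge>0. (Is has_real_derivative exp (c / 2 * t) * sin (\<beta> * t) * w t) (at t within {0..})"
    "\<forall>t\<ge>0. \<bar>Is t\<bar> \<le> Ms" using antiderivative_on_half_line[OF _ _ N] by blast
  note Is = Is'[rule_format]
  \<comment> \<open>The integral over s from 0 to t of exp(- c (t - s) / 2) sin(\<beta> (t - s))
    w(s), respectively with cos for z, split by the addition theorem. Then y / \<beta> solves the
    second-order equation with zero initial data.\<close>
  define y where "y t = exp (- (c / 2) * t) * (sin (\<beta> * t) * Ic t - cos (\<beta> * t) * Is t)" for t
  define z where "z t = exp (- (c / 2) * t) * (cos (\<beta> * t) * Ic t + sin (\<beta> * t) * Is t)" for t
  have ee: "exp (- (c / 2) * t) * exp (c / 2 * t) = 1" for t by (simp flip: exp_add)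
  have y': "(y has_real_derivative (- (c / 2) * y t + \<beta> * z t)) (at t within {0..})" if "0 \<le> t"
    for t
  proof -
    have "(y has_real_derivative
        (exp (- (c / 2) * t) * (- (c / 2))) * (sin (\<beta> * t) * Ic t - cos (\<beta> * t) * Is t)
        + ((cos (\<beta> * t) * \<beta>) * Ic t + (exp (c / 2 * t) * cos (\<beta> * t) * w t) * sin (\<beta> * t)
           - ((- sin (\<beta> * t) * \<beta>) * Is t + (exp (c / 2 * t) * sin (\<beta> * t) * w t) * cos (\<beta> * t)))
          * exp (- (c / 2) * t)) (at t within {0..})"
      unfolding y_def
      by (intro DERIV_mult DERIV_diff Ic(2) Is(2) that; (rule derivative_eq_intros refl)+; simp)
    then show ?thesis by (rule DERIV_cong) (simp add: y_def z_def algebra_simps diff_divide_distrib)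
  qed
  have z': "(z has_real_derivative (- (c / 2) * z t - \<beta> * y t + w t)) (at t within {0..})" if "0 \<le> t"
    for t
  proof -
    have "(z has_real_derivative
        (exp (- (c / 2) * t) * (- (c / 2))) * (cos (\<beta> * t) * Ic t + sin (\<beta> * t) * Is t)
        + ((- sin (\<beta> * t) * \<beta>) * Ic t + (exp (c / 2 * t) * cos (\<beta> * t) * w t) * cos (\<beta> * t)
           + ((cos (\<beta> * t) * \<beta>) * Is t + (exp (c / 2 * t) * sin (\<beta> * t) * w t) * sin (\<beta> * t)))
          * exp (- (c / 2) * t)) (at t within {0..})"
      unfolding z_def
      by (intro DERIV_mult DERIV_add Ic(2) Is(2) that; (rule derivative_eq_intros refl)+; simp)
    moreover have "(exp (- (c / 2) * t) * (- (c / 2))) * (cos (\<beta> * t) * Ic t + sin (\<beta> * t) * Is t)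
        + ((- sin (\<beta> * t) * \<beta>) * Ic t + (exp (c / 2 * t) * cos (\<beta> * t) * w t) * cos (\<beta> * t)
           + ((cos (\<beta> * t) * \<beta>) * Is t + (exp (c / 2 * t) * sin (\<beta> * t) * w t) * sin (\<beta> * t)))
          * exp (- (c / 2) * t)
      = - (c / 2) * z t - \<beta> * y t
        + (exp (- (c / 2) * t) * exp (c / 2 * t)) * ((cos (\<beta> * t))\<^sup>2 + (sin (\<beta> * t))\<^sup>2) * w t"
      by (simp add: y_def z_def algebra_simps add_divide_distrib power2_eq_square
          del: sin_cos_squared_add sin_cos_squared_add2 sin_cos_squared_add3)
    ultimately show ?thesis unfolding ee by (simp add: add.commute)
  qed
  define g0 where "g0 t = y t / \<beta>" for t
  define g1 where "g1 t = z t - c / 2 * g0 t" for t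
  \<comment> \<open>Second and third derivative are prescribed by the equations; that they are
    derivatives is verified afterwards.\<close>
  define g2 where "g2 t = w t - c * g1 t - c\<^sup>2 * g0 t" for t
  define g3 where "g3 t = c * w t + f t - c * g2 t - c\<^sup>2 * g1 t" for t
  have d0: "(g0 has_real_derivative g1 t) (at t within {0..})" if "0 \<le> t" for t
    unfolding g0_def g1_def using y'[OF that] \<beta>(1)
    by (auto intro!: derivative_eq_intros simp: field_simps)
  have d1: "(g1 has_real_derivative g2 t) (at t within {0..})" if "0 \<le> t" for t
  proof -
    have "(g1 has_real_derivative ((- (c / 2) * z t - \<beta> * y t + w t) - c / 2 * g1 t)) (at t within {0..})"
      unfolding g1_def[abs_def] by (rule DERIV_diff DERIV_cmult z' d0[unfolded g1_def] that)+
    moreover have "\<beta> * y t = 3 / 4 * c\<^sup>2 * g0 t"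
      using \<beta> by (simp add: g0_def power2_eq_square field_simps)
    moreover have "z t = g1 t + c / 2 * g0 t" by (simp add: g1_def)
    ultimately show ?thesis by (simp add: g2_def power2_eq_square algebra_simps)
  qed
  have d2: "(g2 has_real_derivative g3 t) (at t within {0..})" if "0 \<le> t" for t
    unfolding g2_def[abs_def] g3_def by (rule DERIV_diff DERIV_cmult w' d0 that d1[unfolded g2_def])+
  have c0: "continuous_on {0..} g0" and c1: "continuous_on {0..} g1" and c2: "continuous_on {0..} g2"
    by (rule conti[OF d0], assumption) (rule conti[OF d1], assumption, rule conti[OF d2], assumption)
  have c3: "continuous_on {0..} g3" unfolding g3_def by (intro continuous_intros wc f c1 c2)
  have tri: "\<bar>a * p + b * q\<bar> \<le> P + Q" if "\<bar>a\<bar> \<le> 1" "\<bar>b\<bar> \<le> 1"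
    "\<bar>p\<bar> \<le> P" "\<bar>q\<bar> \<le> Q" for a b p q P Q :: real
  proof -
    have "\<bar>a * p\<bar> \<le> 1 * P" "\<bar>b * q\<bar> \<le> 1 * Q" unfolding abs_mult
      by (intro mult_mono that; simp)+
    then show ?thesis by linarith
  qed
  have "\<bar>z t\<bar> \<le> (Mc + Ms) * exp (- (c / 2) * t)" if "0 \<le> t" for t
    using tri[OF abs_cos_le_one abs_sin_le_one Ic(3)[OF that] Is(3)[OF that], of "\<beta> * t" "\<beta> * t"]
    by (simp add: z_def abs_mult)
  moreover have "continuous_on {0..} z" by (rule conti[OF z'])
  ultimately have zL: "z \<in> L2" using c by (intro exp_decay_L2[of z "c / 2"]) auto
  have "\<bar>y t\<bar> \<le> (Mc + Ms) * exp (- (c / 2) * t)" if "0 \<le> t" for t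
    using tri[OF abs_sin_le_one, of "- cos (\<beta> * t)"
      "Ic t" Mc "Is t" Ms "\<beta> * t"] Ic(3)[OF that] Is(3)[OF that]
    by (simp add: y_def abs_mult)
  moreover have "continuous_on {0..} y" by (rule conti[OF y'])
  ultimately have yL: "y \<in> L2" using c by (intro exp_decay_L2[of y "c / 2"]) auto
  have wL: "w \<in> L2"
    using compact_support_exp_bound[OF wc w0, of N c] exp_decay_L2[OF wc c] c by (metis less_imp_le)
  have fL: "f \<in> L2"
    using compact_support_exp_bound[OF f f0, of N c] exp_decay_L2[OF f c] c by (metis less_imp_le)
  have sc: "(\<lambda>t. a * h t) \<in> L2" if "h \<in> L2" for a and h :: "real \<Rightarrow> real"
    using L2_scaleR[OF that, of a] by simp
  have g0L: "g0 \<in> L2" using sc[OF yL, of "1 / \<beta>"] by (simp add: g0_def[abs_def])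
  have g1L: "g1 \<in> L2" unfolding g1_def[abs_def] by (intro L2_diff sc zL g0L)
  have g2L: "g2 \<in> L2" unfolding g2_def[abs_def] by (intro L2_diff sc wL g0L g1L)
  have g3L: "g3 \<in> L2" unfolding g3_def[abs_def] by (intro L2_diff L2_add sc wL fL g2L g1L)
  have "y 0 = 0" "z 0 = 0" using Ic(1) Is(1) by (simp_all add: y_def z_def)
  then have "g0 0 = 0" "g1 0 = 0" by (simp_all add: g0_def g1_def)
  moreover have "g3 t - c ^ 3 * g0 t = f t" for t
    by (simp add: g3_def g2_def algebra_simps power2_eq_square power3_eq_cube)
  moreover have "C1L2 g0 g1" "C1L2 g1 g2" "C1L2 g2 g3"
    using g0L g1L g2L g3L c1 c2 c3 d0 d1 d2 by (simp_all add: C1L2_real_iff)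
  ultimately show ?thesis using that by blast
qed


section \<open>A numerical inequality\<close>

lemma cube_le_imp_le:
  fixes x y :: real
  assumes "x ^ 3 \<le> y ^ 3" "0 \<le> y"
  shows "x \<le> y"
proof (rule power_le_imp_le_base)
  show "x ^ Suc 2 \<le> y ^ Suc 2" "0 \<le> y" using assms by simp_all
qed

lemma powr_third_cube: "0 \<le> x \<Longrightarrow> (x powr (1/3)) ^ 3 = x" for x :: real
  using powr_power[of x "1/3" 3] by (cases "x = 0") simp_all

lemma powr_two_thirds_cube: "0 \<le> x \<Longrightarrow> (x powr (2/3)) ^ 3 = x\<^sup>2" for x :: real
  using powr_power[of x "2/3" 3] by (cases "x = 0") simp_all

text \<open>Arithmetic-geometric mean for x, y/2, y/2, with equality at y = 2 x. It is the source of
  the factor 2^(1/3) / 3^(1/2).\<close>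

lemma am_gm_3: "0 \<le> x \<Longrightarrow> 0 \<le> y \<Longrightarrow> 27 * (x * y\<^sup>2) \<le> 4 * (x + y) ^ 3" for x y :: real
proof -
  assume xy: "0 \<le> x" "0 \<le> y"
  have "4 * (x + y) ^ 3 - 27 * (x * y\<^sup>2) = (2 * x - y)\<^sup>2 * (x + 4 * y)"
    by (simp add: power2_eq_square power3_eq_cube algebra_simps)
  also have "0 \<le> \<dots>" using xy by simp
  finally show ?thesis by simp
qed

text \<open>The constants of the theorem: \<open>a, b, c, d\<close> stand
  for the norms of \<open>A\<^sup>3u, A\<^sup>2u', Au'', u'''\<close>, and
  \<open>q\<close> for the norm of \<open>A\<^bsup>3/2\<^esup>u'(0)\<close>.\<close>

lemma intermediate_bounds:
  fixes a b c d n q k :: real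
  assumes nonneg: "0 \<le> a" "0 \<le> b" "0 \<le> c" "0 \<le> d" "0 \<le> n" "0 \<le> k"
    and b: "b\<^sup>2 \<le> a * c" and c: "c\<^sup>2 \<le> b * d + q * sqrt (2 * c * d)"
    and n: "a\<^sup>2 + d\<^sup>2 = n\<^sup>2" and q: "q \<le> k * n"
  shows "c \<le> 2 powr (1/3) / 3 powr (1/2) * (1 + 3 powr (1/2) * k powr (2/3)) * n"
    and "b \<le> 2 powr (1/3) / 3 powr (1/2) * (1 + 3 * k powr (2/3) / 2 powr (1/3)) powr (1/2) * n"
proof -
  \<comment> \<open>Inserting b \<le> (a c)^(1/2) into the bound for c^2 gives c^3 \<le> W^2 with W
    = a^(1/2) d + k n (2 d)^(1/2). X^3 and Y^3 are the squares of these two summands, and c \<le> X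
    + Y is the aim.\<close>
  define X where "X = (a * d\<^sup>2) powr (1/3)"
  define Y where "Y = (2 * k\<^sup>2 * n\<^sup>2 * d) powr (1/3)"
  have X: "0 \<le> X" "X ^ 3 = a * d\<^sup>2" and Y: "0 \<le> Y" "Y ^ 3 = 2 * k\<^sup>2 * n\<^sup>2 * d"
    using nonneg by (auto simp: X_def Y_def powr_third_cube)
  define s where "s = (2::real) powr (1/3)"
  define r where "r = sqrt 3"
  have s: "0 < s" "s ^ 3 = 2" by (auto simp: s_def powr_third_cube)
  have r: "0 < r" "r\<^sup>2 = 3" "r ^ 3 = 3 * r" by (auto simp: r_def power3_eq_cube)
  have r_powr: "3 powr (1/2) = r" by (simp add: r_def powr_half_sqrt)
  define \<kappa> where "\<kappa> = k powr (2/3)"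
  have \<kappa>: "0 \<le> \<kappa>" "\<kappa> ^ 3 = k\<^sup>2" using nonneg
    by (auto simp: \<kappa>_def powr_two_thirds_cube)
  have an: "a \<le> n" "d \<le> n" using n nonneg by (auto intro!: power2_le_imp_le[of _ n] simp flip: n)
  have cXY: "c \<le> X + Y"
  proof (cases "c = 0")
    case False
    then have c0: "0 < c" using nonneg by simp
    define W where "W = sqrt a * d + k * n * sqrt (2 * d)"
    have W0: "0 \<le> W" using nonneg by (simp add: W_def)
    have "c\<^sup>2 \<le> sqrt (a * c) * d + (k * n) * sqrt (2 * c * d)"
    proof -
      have "b \<le> sqrt (a * c)" using b nonneg by (simp add: real_le_rsqrt)
      then have "b * d \<le> sqrt (a * c) * d" using nonneg by (intro mult_right_mono)
      moreover have "q * sqrt (2 * c * d) \<le> (k * n) * sqrt (2 * c * d)"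
        using q nonneg by (intro mult_right_mono) auto
      ultimately show ?thesis using c by linarith
    qed
    also have "\<dots> = sqrt c * W" by (simp add: W_def real_sqrt_mult algebra_simps)
    finally have "(c\<^sup>2)\<^sup>2 \<le> (sqrt c * W)\<^sup>2" by (intro power_mono) auto
    then have "c * c ^ 3 \<le> c * W\<^sup>2"
      using c0 by (simp add: power_mult_distrib power2_eq_square[of "c\<^sup>2"] power2_eq_square[of c] power3_eq_cube mult.assoc)
    then have "c ^ 3 \<le> W\<^sup>2" using c0 by simp
    also have "W\<^sup>2 = X ^ 3 + Y ^ 3 + 2 * (sqrt a * d * (k * n * sqrt (2 * d)))"
      using nonneg by (simp add: W_def X Y power2_sum power_mult_distrib)
    \<comment> \<open>The cross term is (X Y)^(3/2); the geometric mean of X and Y is at most their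
      arithmetic mean, so twice this term fits into (X + Y)^3.\<close>
    also have "sqrt a * d * (k * n * sqrt (2 * d)) \<le> (X * Y) * ((X + Y) / 2)"
    proof (rule power2_le_imp_le)
      have "(sqrt a * d * (k * n * sqrt (2 * d)))\<^sup>2 = X ^ 3 * Y ^ 3"
        using nonneg by (simp add: X Y power_mult_distrib)
      also have "\<dots> = (X * Y)\<^sup>2 * (X * Y)" by (simp add: power2_eq_square power3_eq_cube)
      also have "\<dots> \<le> (X * Y)\<^sup>2 * ((X + Y) / 2)\<^sup>2"
        using sum_squares_bound[of X Y] by (intro mult_left_mono) (auto simp: power_divide power2_sum)
      also have "\<dots> = ((X * Y) * ((X + Y) / 2))\<^sup>2" by (rule power_mult_distrib[symmetric])
      finally show "(sqrt a * d * (k * n * sqrt (2 * d)))\<^sup>2 \<le> ((X * Y) * ((X + Y) / 2))\<^sup>2" .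
    qed (use X Y in simp)
    finally have "c ^ 3 \<le> X ^ 3 + Y ^ 3 + X * Y * (X + Y)" by simp
    also have "\<dots> \<le> (X + Y) ^ 3"
    proof -
      have "(X + Y) ^ 3 = X ^ 3 + Y ^ 3 + 3 * (X * Y * (X + Y))" by (simp add: power3_eq_cube algebra_simps)
      moreover have "0 \<le> X * Y * (X + Y)" using X Y by simp
      ultimately show ?thesis by linarith
    qed
    finally show ?thesis by (rule cube_le_imp_le) (use X Y in simp)
  qed (use X Y in simp)
  \<comment> \<open>Under a^2 + d^2 = n^2 the product a^2 d^4 is at most (4/27) n^6, and (s/r)^6 =
    4/27.\<close>
  have "X \<le> s / r * n"
  proof (rule cube_le_imp_le, rule power2_le_imp_le)
    have "27 * ((X ^ 3)\<^sup>2) = 27 * (a\<^sup>2 * (d\<^sup>2)\<^sup>2)" by (simp add: X power_mult_distrib)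
    also have "\<dots> \<le> 4 * (n\<^sup>2) ^ 3" using am_gm_3[of "a\<^sup>2" "d\<^sup>2"] by (simp add: n)
    finally have "(X ^ 3)\<^sup>2 \<le> 4 / 27 * (n\<^sup>2) ^ 3" by simp
    also have "\<dots> = ((s / r * n) ^ 3)\<^sup>2"
      using r by (simp add: power_mult_distrib power_divide s)
    finally show "(X ^ 3)\<^sup>2 \<le> ((s / r * n) ^ 3)\<^sup>2" .
  qed (use s r nonneg in auto)
  moreover have "Y \<le> s * \<kappa> * n"
  proof (rule cube_le_imp_le)
    have "Y ^ 3 \<le> 2 * k\<^sup>2 * n\<^sup>2 * n" unfolding Y using an nonneg
      by (intro mult_left_mono) auto
    then show "Y ^ 3 \<le> (s * \<kappa> * n) ^ 3"
      by (simp add: power_mult_distrib s \<kappa>) (simp add: power2_eq_square power3_eq_cube)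
  qed (use s \<kappa> nonneg in auto)
  moreover have "s / r * (1 + r * \<kappa>) * n = s / r * n + s * \<kappa> * n" using r
    by (simp add: field_simps)
  ultimately have "c \<le> s / r * (1 + r * \<kappa>) * n" using cXY by linarith
  then show "c \<le> 2 powr (1/3) / 3 powr (1/2) * (1 + 3 powr (1/2) * k powr (2/3)) * n"
    by (simp only: r_powr s_def \<kappa>_def)
  \<comment> \<open>Here a X = (a^4 d^2)^(1/3), so \<open>am_gm_3\<close> is applied with the roles
    of a and d exchanged. Bounding a and X separately would lose the constant.\<close>
  have "a * X \<le> s\<^sup>2 / 3 * n\<^sup>2"
  proof (rule cube_le_imp_le)
    have "(a * X) ^ 3 = a ^ 3 * (a * d\<^sup>2)" unfolding power_mult_distrib X(2) ..
    also have "\<dots> = d\<^sup>2 * (a\<^sup>2)\<^sup>2"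
      by (simp only: power2_eq_square power3_eq_cube mult_ac)
    finally have "27 * (a * X) ^ 3 = 27 * (d\<^sup>2 * (a\<^sup>2)\<^sup>2)" by simp
    also have "\<dots> \<le> 4 * (n\<^sup>2) ^ 3" using am_gm_3[of "d\<^sup>2" "a\<^sup>2"]
      by (simp add: add.commute flip: n)
    also have "\<dots> = 27 * (s\<^sup>2 / 3 * n\<^sup>2) ^ 3"
    proof -
      have "(s\<^sup>2) ^ 3 = (s ^ 3)\<^sup>2" by (simp flip: power_mult)
      then show ?thesis by (simp add: power_mult_distrib power_divide s)
    qed
    finally show "(a * X) ^ 3 \<le> (s\<^sup>2 / 3 * n\<^sup>2) ^ 3" by simp
  qed simp
  moreover have "a * Y \<le> s * \<kappa> * n\<^sup>2"
  proof -
    have "a * Y \<le> n * (s * \<kappa> * n)" using an nonneg Y \<open>Y \<le> s * \<kappa> * n\<close>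
      by (intro mult_mono) auto
    then show ?thesis by (simp add: power2_eq_square mult_ac)
  qed
  moreover have "b\<^sup>2 \<le> a * X + a * Y"
    using b mult_left_mono[OF cXY, of a] nonneg by (simp add: distrib_left)
  moreover have "(s / r * sqrt (1 + 3 * \<kappa> / s) * n)\<^sup>2 = s\<^sup>2 / 3 * n\<^sup>2 + s * \<kappa> * n\<^sup>2"
  proof -
    have "0 \<le> 1 + 3 * \<kappa> / s" using s \<kappa> by simp
    then have "(s / r * sqrt (1 + 3 * \<kappa> / s) * n)\<^sup>2 = s\<^sup>2 / 3 * (1 + 3 * \<kappa> / s) * n\<^sup>2"
      by (simp add: power_mult_distrib power_divide r(2))
    also have "\<dots> = s\<^sup>2 / 3 * n\<^sup>2 + s * \<kappa> * n\<^sup>2" using s(1)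
      by (simp add: field_simps power2_eq_square)
    finally show ?thesis .
  qed
  ultimately have "b\<^sup>2 \<le> (s / r * sqrt (1 + 3 * \<kappa> / s) * n)\<^sup>2" by linarith
  then have "b \<le> s / r * sqrt (1 + 3 * \<kappa> / s) * n"
    by (rule power2_le_imp_le) (use s r \<kappa> nonneg in auto)
  moreover have "(1 + 3 * \<kappa> / s) powr (1/2) = sqrt (1 + 3 * \<kappa> / s)"
    by (rule powr_half_sqrt) (use s \<kappa> in simp)
  ultimately show "b \<le> 2 powr (1/3) / 3 powr (1/2) * (1 + 3 * k powr (2/3) / 2 powr (1/3)) powr (1/2) * n"
    by (simp only: r_powr s_def \<kappa>_def)
qed

section \<open>Density of the range for commuting positive and skew-symmetric operators\<close>

lemma pair_subspaceD:
  assumes "subspace G" "(v, d) \<in> G" "(v', d') \<in> G"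
  shows "(v + v', d + d') \<in> G" "(c *\<^sub>R v, c *\<^sub>R d) \<in> G"
  using subspace_add[OF assms] subspace_scale[OF assms(1,2), of c] by simp_all

text \<open>\<open>G\<close> is the graph of a skew-symmetric operator \<open>D\<close> commuting with \<open>T\<close>. The range of \<open>(T + \<epsilon>) D - 1\<close> is dense
  because it is a relatively bounded perturbation of that of \<open>(T + \<epsilon>) (D - 1 / \<epsilon>)\<close>; then let \<open>\<epsilon> \<rightarrow> 0\<close>.\<close>

lemma shifted_range_dense:
  fixes G :: "('a::{real_inner,banach} \<times> 'a) set"
  assumes G: "subspace G" and T: "inj_sym T" and pos: "\<And>x. 0 \<le> x \<bullet> T x"
    and skew: "\<And>v d. (v, d) \<in> G \<Longrightarrow> d \<bullet> v = 0"
      "\<And>v d. (v, d) \<in> G \<Longrightarrow> d \<bullet> T v = 0"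
    and stable: "\<And>v d. (v, d) \<in> G \<Longrightarrow> (T v, T d) \<in> G"
    and dense: "\<And>M z. 0 < M \<Longrightarrow> (\<And>v d. (v, d) \<in> G \<Longrightarrow> z \<bullet> (d - M *\<^sub>R v) = 0) \<Longrightarrow> z = 0"
    and \<epsilon>: "0 < \<epsilon>"
      and z: "\<And>v d. (v, d) \<in> G \<Longrightarrow> z \<bullet> (T d + \<epsilon> *\<^sub>R d - v) = 0"
  shows "z = 0"
proof -
  interpret T: bounded_linear T using T by (rule inj_symD)
  have sym: "T x \<bullet> y = x \<bullet> T y" for x y using inj_symD(2)[OF T] .
  define S where "S x = T x + \<epsilon> *\<^sub>R x" for x
  define M where "M = 1 / \<epsilon>"
  have M: "0 < M" "M * \<epsilon> = 1" using \<epsilon> by (auto simp: M_def)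
  have blS: "bounded_linear S" unfolding S_def[abs_def]
    by (intro bounded_linear_add T.bounded_linear_axioms bounded_linear_scaleR_right)
  interpret S: bounded_linear S by fact
  have symS: "S x \<bullet> y = x \<bullet> S y" for x y by (simp add: S_def inner_simps sym)
  obtain K where K: "0 < K" "\<And>x. norm (T x) \<le> norm x * K" using T.pos_bounded by blast
  have S_sq: "(norm (S v))\<^sup>2 = (norm (T v))\<^sup>2 + 2 * \<epsilon> * (v \<bullet> T v) + \<epsilon>\<^sup>2 * (norm v)\<^sup>2" for v
    unfolding power2_norm_eq_inner
    by (simp add: S_def inner_simps sym[of v v] power2_eq_square inner_commute algebra_simps)
  \<comment> \<open>The ratio comes from |S v|^2 \<ge> |T v|^2 + \<epsilon>^2 |v|^2 and |T v| \<le>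
    K |v|; it is strictly below 1 because \<epsilon> > 0.\<close>
  define \<theta> where "\<theta> = 1 / sqrt (1 + (\<epsilon> / K)\<^sup>2)"
  have "1 < 1 + (\<epsilon> / K)\<^sup>2" using \<epsilon> K by simp
  then have sq: "1 < sqrt (1 + (\<epsilon> / K)\<^sup>2)" by (subst real_less_rsqrt) auto
  have \<theta>: "0 < \<theta>" "\<theta> < 1" using sq
    by (auto simp: \<theta>_def field_simps intro: less_trans[OF zero_less_one])
  have T_S: "norm (T v) \<le> \<theta> * norm (S v)" for v
  proof -
    have "(norm (T v))\<^sup>2 \<le> (norm v * K)\<^sup>2" by (intro power_mono K) auto
    then have "(\<epsilon> / K)\<^sup>2 * (norm (T v))\<^sup>2 \<le> (\<epsilon> / K)\<^sup>2 * (norm v * K)\<^sup>2" by (rule mult_left_mono) simp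
    then have "(\<epsilon> / K)\<^sup>2 * (norm (T v))\<^sup>2 \<le> \<epsilon>\<^sup>2 * (norm v)\<^sup>2"
      using K(1) by (simp add: power_divide power_mult_distrib)
    then have "(sqrt (1 + (\<epsilon> / K)\<^sup>2) * norm (T v))\<^sup>2 \<le> (norm (S v))\<^sup>2"
      unfolding S_sq using mult_nonneg_nonneg[OF less_imp_le[OF \<epsilon>] pos[of v]]
      by (simp add: power_mult_distrib distrib_right)
    then have "sqrt (1 + (\<epsilon> / K)\<^sup>2) * norm (T v) \<le> norm (S v)"
      by (rule power2_le_imp_le) simp
    then show ?thesis using sq by (simp add: \<theta>_def field_simps)
  qed
  have S_inj: "x = 0" if "S x = 0" for x
  proof -
    have "\<epsilon>\<^sup>2 * (norm x)\<^sup>2 \<le> 0" using S_sq[of x] that pos[of x] \<epsilon>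
      by (smt (verit) mult_nonneg_nonneg norm_zero zero_le_power2 zero_power2)
    then show ?thesis using \<epsilon> by (simp add: mult_le_0_iff)
  qed
  define D where "D = (\<lambda>(v, d). S (d - M *\<^sub>R v)) ` G"
  have "linear (\<lambda>(v, d). S (d - M *\<^sub>R v))"
    by (rule linearI) (auto simp: S.add S.diff S.scaleR algebra_simps)
  then have "subspace D" unfolding D_def using G by (rule linear_subspace_image)
  then have "closure D = UNIV"
  proof (rule dense_if_orthogonal_trivial)
    fix x assume x: "\<And>y. y \<in> D \<Longrightarrow> x \<bullet> y = 0"
    have "S x \<bullet> (d - M *\<^sub>R v) = 0" if "(v, d) \<in> G" for v d
      using x[of "S (d - M *\<^sub>R v)"] that unfolding symS D_def by force
    then show "x = 0" using dense[OF M(1)] S_inj by blast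
  qed
  then obtain y where y: "\<And>n. y n \<in> D" "y \<longlonglongrightarrow> z" unfolding closure_sequential
    by (metis UNIV_I closure_sequential)
  \<comment> \<open>With w = S (d - M v), the element of the range in question is w + M T v. Since S
    d and S v are orthogonal, M |S v| \<le> |w|, so the perturbation M T v has relative bound
    \<theta>. As z is orthogonal to w + M T v, this yields z . w \<le> \<theta> |z| |w| on the dense
    set D.\<close>
  have main: "z \<bullet> w \<le> \<theta> * (norm z * norm w)" if w: "w \<in> D" for w
  proof -
    obtain v d where vd: "(v, d) \<in> G" "w = S (d - M *\<^sub>R v)" using w by (auto simp: D_def)
    have "w + M *\<^sub>R T v = T d + \<epsilon> *\<^sub>R d - v"
      using M(2) by (simp add: vd(2) S_def T.diff T.scaleR algebra_simps)
    then have "z \<bullet> w = - (M * (z \<bullet> T v))"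
      using z[OF vd(1)] by (metis add.commute add_eq_0_iff inner_add_right inner_scaleR_right)
    also have "\<dots> \<le> M * (norm z * norm (T v))"
      using Cauchy_Schwarz_ineq2[of z "T v"] M(1)
      by (metis abs_le_D2 mult_left_mono less_imp_le mult_minus_right)
    also have "\<dots> \<le> M * (norm z * (\<theta> * norm (S v)))"
      using T_S[of v] M(1) by (intro mult_left_mono) auto
    also have "\<dots> = \<theta> * (norm z * (M * norm (S v)))" by simp
    also have "M * norm (S v) \<le> norm w"
    proof (rule power2_le_imp_le)
      have "S d \<bullet> S v = d \<bullet> T (T v) + 2 * \<epsilon> * (d \<bullet> T v) + \<epsilon>\<^sup>2 * (d \<bullet> v)"
        by (simp add: S_def inner_simps sym power2_eq_square algebra_simps)
      also have "\<dots> = 0" using skew[OF vd(1)] skew(1)[OF stable[OF vd(1)]] by (simp add: sym)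
      finally have "(norm w)\<^sup>2 = (norm (S d))\<^sup>2 + (M * norm (S v))\<^sup>2"
        unfolding power_mult_distrib power2_norm_eq_inner vd(2)
        by (simp add: S.diff S.scaleR inner_simps inner_commute power2_eq_square)
      then show "(M * norm (S v))\<^sup>2 \<le> (norm w)\<^sup>2" by simp
    qed simp
    finally show ?thesis using \<theta>(1) by (simp add: mult_left_mono)
  qed
  have "z \<bullet> z \<le> \<theta> * (norm z * norm z)"
  proof (rule LIMSEQ_le)
    show "(\<lambda>n. z \<bullet> y n) \<longlonglongrightarrow> z \<bullet> z"
      "(\<lambda>n. \<theta> * (norm z * norm (y n))) \<longlonglongrightarrow> \<theta> * (norm z * norm z)"
      by (intro tendsto_intros y)+
  qed (use main y in blast)
  then have "(1 - \<theta>) * (norm z)\<^sup>2 \<le> 0"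
    by (simp add: power2_norm_eq_inner algebra_simps power2_eq_square flip: power2_norm_eq_inner)
  then show "z = 0" using \<theta>(2) by (simp add: mult_le_0_iff)
qed

text \<open>The term \<epsilon> d has no bound relative to T d - v, so a perturbation argument is
  out of reach. Instead z is tested against ((T + \<epsilon>) v, (T + \<epsilon>) d), which gives T
  z . w = \<epsilon> (z . v) for w = (T + \<epsilon>) d - v. These w are dense and |v| \<le> |w|,
  whence |T z|^2 \<le> \<epsilon> |z| |T z|.\<close>

lemma commuting_range_dense:
  fixes G :: "('a::{real_inner,banach} \<times> 'a) set"
  assumes G: "subspace G" and T: "inj_sym T" and pos: "\<And>x. 0 \<le> x \<bullet> T x"
    and skew: "\<And>v d. (v, d) \<in> G \<Longrightarrow> d \<bullet> v = 0"
      "\<And>v d. (v, d) \<in> G \<Longrightarrow> d \<bullet> T v = 0"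
    and stable: "\<And>v d. (v, d) \<in> G \<Longrightarrow> (T v, T d) \<in> G"
    and dense: "\<And>M z. 0 < M \<Longrightarrow> (\<And>v d. (v, d) \<in> G \<Longrightarrow> z \<bullet> (d - M *\<^sub>R v) = 0) \<Longrightarrow> z = 0"
    and z: "\<And>v d. (v, d) \<in> G \<Longrightarrow> z \<bullet> (T d - v) = 0"
  shows "z = 0"
proof -
  interpret T: bounded_linear T using T by (rule inj_symD)
  have sym: "T x \<bullet> y = x \<bullet> T y" for x y using inj_symD(2)[OF T] .
  have bound: "(norm (T z))\<^sup>2 \<le> \<epsilon> * (norm z * norm (T z))" if \<epsilon>: "0 < \<epsilon>"
    for \<epsilon>
  proof -
    define D where "D = (\<lambda>(v, d). T d + \<epsilon> *\<^sub>R d - v) ` G"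
    have "linear (\<lambda>(v, d). T d + \<epsilon> *\<^sub>R d - v)"
      by (rule linearI) (auto simp: T.add T.diff T.scaleR algebra_simps)
    then have "subspace D" unfolding D_def using G by (rule linear_subspace_image)
    then have "closure D = UNIV"
    proof (rule dense_if_orthogonal_trivial)
      fix x assume "\<And>y. y \<in> D \<Longrightarrow> x \<bullet> y = 0"
      then have "\<And>v d. (v, d) \<in> G \<Longrightarrow> x \<bullet> (T d + \<epsilon> *\<^sub>R d - v) = 0"
        unfolding D_def by force
      with assms(1-7) \<epsilon> show "x = 0" by (rule shifted_range_dense)
    qed
    then obtain y where y: "\<And>n. y n \<in> D" "y \<longlonglongrightarrow> T z"
      by (metis UNIV_I closure_sequential)
    have main: "T z \<bullet> w \<le> \<epsilon> * (norm z * norm w)" if w: "w \<in> D" for w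
    proof -
      obtain v d where vd: "(v, d) \<in> G" "w = T d + \<epsilon> *\<^sub>R d - v" using w
        by (auto simp: D_def)
      have "(T v + \<epsilon> *\<^sub>R v, T d + \<epsilon> *\<^sub>R d) \<in> G"
        using pair_subspaceD[OF G stable[OF vd(1)] pair_subspaceD(2)[OF G vd(1) vd(1)]] by blast
      from z[OF this] have "z \<bullet> (T w - \<epsilon> *\<^sub>R v) = 0"
        by (simp add: vd(2) T.add T.diff T.scaleR algebra_simps)
      then have "T z \<bullet> w = \<epsilon> * (z \<bullet> v)" by (simp add: inner_simps sym)
      also have "\<dots> \<le> \<epsilon> * (norm z * norm v)" using \<epsilon>
        by (intro mult_left_mono norm_cauchy_schwarz) auto
      also have "norm v \<le> norm w"
      proof (rule power2_le_imp_le)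
        have "(norm w)\<^sup>2 = (norm (T d + \<epsilon> *\<^sub>R d))\<^sup>2 - 2 * (d \<bullet> T v + \<epsilon> * (d \<bullet> v)) + (norm v)\<^sup>2"
          unfolding vd(2) power2_norm_eq_inner
          using sym[of d v] inner_commute[of v "T d"] inner_commute[of v d]
          by (simp add: inner_simps algebra_simps)
        then show "(norm v)\<^sup>2 \<le> (norm w)\<^sup>2" using skew[OF vd(1)] by simp
      qed simp
      finally show ?thesis using \<epsilon> by (simp add: mult_left_mono)
    qed
    have "T z \<bullet> T z \<le> \<epsilon> * (norm z * norm (T z))"
    proof (rule LIMSEQ_le)
      show "(\<lambda>n. T z \<bullet> y n) \<longlonglongrightarrow> T z \<bullet> T z"
        "(\<lambda>n. \<epsilon> * (norm z * norm (y n))) \<longlonglongrightarrow> \<epsilon> * (norm z * norm (T z))"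
        by (intro tendsto_intros y)+
    qed (use main y in blast)
    then show ?thesis by (simp add: power2_norm_eq_inner)
  qed
  have "T z = 0"
  proof (rule ccontr)
    assume nz: "T z \<noteq> 0"
    then have z0: "z \<noteq> 0" using T.zero by auto
    have "(norm (T z))\<^sup>2 \<le> norm (T z) / (2 * norm z) * (norm z * norm (T z))"
      using nz z0 by (intro bound) auto
    also have "\<dots> = (norm (T z))\<^sup>2 / 2" using z0 by (simp add: power2_eq_square field_simps)
    finally show False using nz by simp
  qed
  then show "z = 0" using inj_symD(3)[OF T] by blast
qed


section \<open>Regular states of the homogeneous problem\<close>

lemma inj_sym_inner_funpow: "inj_sym C \<Longrightarrow> (C ^^ j) x \<bullet> (C ^^ k) y = x \<bullet> (C ^^ (j + k)) y"
  using inj_symD(2)[OF inj_sym_funpow[of C j], of x "(C ^^ k) y"] by (simp add: funpow_add)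

lemma norm_le_fst_snd: "norm z \<le> norm (fst z) + norm (snd z)"
  using norm_Pair_le[of "fst z" "snd z"] by simp

lemma funpow_add_apply: "(C ^^ j) ((C ^^ k) x) = (C ^^ (j + k)) x"
  by (simp add: funpow_add)

lemma l2_map_funpow_abs:
  assumes B: "inj_sym B" and f: "f \<in> L2"
  shows "(l2_map B ^^ k) (abs_l2 f) = abs_l2 (\<lambda>t. (B ^^ k) (f t))"
proof (induction k)
  case (Suc k)
  have "(\<lambda>t. (B ^^ k) (f t)) \<in> L2"
    by (rule L2_bounded_linear[OF inj_symD(1)[OF inj_sym_funpow[OF B]] f])
  then show ?case using Suc by (simp add: l2_map_abs inj_symD(1)[OF B])
qed simp

text \<open>Constant continuation to the left. Under the sup norm on the whole line, evaluation at 0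
  is a bounded functional, so boundary values pass to limits.\<close>

definition half_line_ext :: "(real \<Rightarrow> 'h::real_normed_vector) \<Rightarrow> (real \<Rightarrow>\<^sub>C 'h)" where
  "half_line_ext x = Bcontfun (\<lambda>t. x (max 0 t))"

lemma half_line_ext_apply:
  assumes xy: "C1L2 x y"
  shows "apply_bcontfun (half_line_ext x) t = x (max 0 t)"
proof -
  have "continuous_on UNIV (\<lambda>t. x (max 0 t))"
    by (rule continuous_on_compose2[OF C1L2D(5)[OF xy]]) (auto intro!: continuous_intros)
  moreover have "norm (x (max 0 t)) \<le> sqrt ((norm (x 0))\<^sup>2 + 2 * (norm (abs_l2 x) * norm (abs_l2 y)))"
    for t
    using C1L2_pointwise_bound[OF xy C1L2D(1,2)[OF xy], of "max 0 t"] by (intro real_le_rsqrt) simp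
  ultimately have "(\<lambda>t. x (max 0 t)) \<in> bcontfun" by (rule bcontfun_normI)
  then show ?thesis by (simp add: half_line_ext_def Bcontfun_inverse)
qed

type_synonym 'h state = "'h l2 \<times> 'h l2 \<times> 'h l2 \<times> 'h l2 \<times> (real \<Rightarrow>\<^sub>C 'h) \<times> (real \<Rightarrow>\<^sub>C 'h)"

text \<open>A state collects \<open>A\<^sup>3u\<close>, \<open>A\<^sup>2u'\<close>, \<open>Au''\<close>, \<open>u'''\<close> and the continuous functions \<open>A\<^bsup>5/2\<^esup>u\<close>, \<open>A\<^bsup>3/2\<^esup>u'\<close>.\<close>

definition P0 :: "'h::{real_inner,banach,second_countable_topology} state \<Rightarrow> 'h l2" where
  "P0 x = fst x"
definition P1 :: "'h::{real_inner,banach,second_countable_topology} state \<Rightarrow> 'h l2" where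
  "P1 x = fst (snd x)"
definition P2 :: "'h::{real_inner,banach,second_countable_topology} state \<Rightarrow> 'h l2" where
  "P2 x = fst (snd (snd x))"
definition P3 :: "'h::{real_inner,banach,second_countable_topology} state \<Rightarrow> 'h l2" where
  "P3 x = fst (snd (snd (snd x)))"
definition W5 :: "'h::{real_inner,banach,second_countable_topology} state \<Rightarrow> (real \<Rightarrow>\<^sub>C 'h)" where
  "W5 x = fst (snd (snd (snd (snd x))))"
definition W3 :: "'h::{real_inner,banach,second_countable_topology} state \<Rightarrow> (real \<Rightarrow>\<^sub>C 'h)" where
  "W3 x = snd (snd (snd (snd (snd x))))"

lemmas state_defs = P0_def P1_def P2_def P3_def W5_def W3_def

lemma bounded_linear_P0: "bounded_linear P0"
  and bounded_linear_P1: "bounded_linear P1"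
  and bounded_linear_P2: "bounded_linear P2"
  and bounded_linear_P3: "bounded_linear P3"
  and bounded_linear_W5: "bounded_linear W5"
  and bounded_linear_W3: "bounded_linear W3"
  unfolding state_defs[abs_def]
  by (intro bounded_linear_fst_comp bounded_linear_snd_comp bounded_linear_ident)+

lemma bounded_linear_apply_bcontfun: "bounded_linear (\<lambda>w. apply_bcontfun w t)"
  by (rule bounded_linear_intro[where K = 1]) (auto simp: norm_bounded)

text \<open>Counterpart of \<open>l2_pair\<close> for the continuous components; equality of the two
  pairings ties such a component to its square-integrable class.\<close>

definition bc_pair :: "(real \<Rightarrow> real) \<Rightarrow> (real \<Rightarrow>\<^sub>C 'h) \<Rightarrow> 'h::{real_inner,banach,second_countable_topology}" where
  "bc_pair \<phi> w = (LINT t|Rplus. \<phi> t *\<^sub>R apply_bcontfun w t)"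

lemma bcontfun_loc_integrable:
  fixes w :: "real \<Rightarrow>\<^sub>C 'h::{real_inner,banach,second_countable_topology}"
  shows "loc_integrable (apply_bcontfun w)"
  unfolding loc_integrable_def by (intro allI impI integrable_lebesgue_on_Icc) simp

lemma bounded_linear_bc_pair:
  assumes \<phi>: "test_function \<phi>"
  shows "bounded_linear (bc_pair \<phi> :: _ \<Rightarrow> 'h::{real_inner,banach,second_countable_topology})"
proof (rule bounded_linear_intro)
  fix w v :: "real \<Rightarrow>\<^sub>C 'h" and c :: real
  note int = test_function_times_integrable[OF \<phi> bcontfun_loc_integrable]
  show "bc_pair \<phi> (w + v) = bc_pair \<phi> w + bc_pair \<phi> v"
    by (simp add: bc_pair_def scaleR_add_right int)
  show "bc_pair \<phi> (c *\<^sub>R w) = c *\<^sub>R bc_pair \<phi> w"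
    by (simp add: bc_pair_def scaleR_left_commute[of _ c] del: scaleR_scaleR)
  have "integrable Rplus (\<lambda>t. norm (\<phi> t *\<^sub>R (1::real)))"
    by (intro integrable_norm test_function_times_integrable[OF \<phi>])
       (simp add: loc_integrable_def integrable_lebesgue_on_Icc)
  then have i: "integrable Rplus (\<lambda>t. \<bar>\<phi> t\<bar>)" by simp
  have "norm (bc_pair \<phi> w) \<le> (LINT t|Rplus. norm (\<phi> t *\<^sub>R apply_bcontfun w t))"
    unfolding bc_pair_def by (rule integral_norm_bound)
  also have "\<dots> \<le> (LINT t|Rplus. norm w * \<bar>\<phi> t\<bar>)"
    using norm_bounded[of w]
    by (intro integral_mono integrable_norm int integrable_mult_right i)
       (auto simp: mult.commute[of "norm w"] intro!: mult_left_mono)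
  finally show "norm (bc_pair \<phi> w) \<le> norm w * (LINT t|Rplus. \<bar>\<phi> t\<bar>)" by simp
qed

locale inverse_sqrt =
  fixes B :: "'h::{real_inner,banach,second_countable_topology} \<Rightarrow> 'h"
  assumes B: "inj_sym B"
begin

abbreviation C :: "'h l2 \<Rightarrow> 'h l2" where "C \<equiv> l2_map B"

lemma C: "inj_sym C"
  by (rule inj_sym_l2_map[OF B])

lemmas Bk = inj_sym_funpow[OF B] and Ck = inj_sym_funpow[OF C]
lemmas Bk_bl = inj_symD(1)[OF Bk] and Ck_bl = inj_symD(1)[OF Ck]

text \<open>With g_k = A^3 u^(k), the components of a state are A^(3-k) u^(k) = B^(2k) g_k, A^(5/2)
  u = B g_0 and A^(3/2) u' = B^3 g_1. That A^3 u''' be square-integrable is more than W demands; the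
  closure \<open>X\<close> removes this excess.\<close>

definition nice :: "(real \<Rightarrow> 'h) \<Rightarrow> (real \<Rightarrow> 'h) \<Rightarrow> (real \<Rightarrow> 'h) \<Rightarrow> (real \<Rightarrow> 'h) \<Rightarrow> bool" where
  "nice g0 g1 g2 g3 \<longleftrightarrow> C1L2 g0 g1 \<and> C1L2 g1 g2 \<and> C1L2 g2 g3 \<and> g0 0 = 0"

lemma integration_by_parts:
  assumes "C1L2 x y" "C1L2 x' y'"
  shows "abs_l2 y \<bullet> (C ^^ k) (abs_l2 x') + abs_l2 x \<bullet> (C ^^ k) (abs_l2 y') = - (x 0 \<bullet> (B ^^ k) (x' 0))"
  using C1L2_integration_by_parts[OF assms(1) C1L2_bounded_linear[OF Bk_bl assms(2), of k]]
  by (simp add: l2_map_funpow_abs[OF B] C1L2D[OF assms(2)])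

text \<open>Two integrations by parts: u(0) = 0 removes the first boundary term, and symmetry makes
  g_2 . B^k g_1 half a total derivative. The exponent k = 6 yields the energy identity; with g_1(0)
  = 0, k = 0 and k = 6 yield skew-symmetry.\<close>

lemma third_derivative_inner:
  assumes "nice g0 g1 g2 g3"
  shows "abs_l2 g3 \<bullet> (C ^^ k) (abs_l2 g0) = (g1 0 \<bullet> (B ^^ k) (g1 0)) / 2"
proof -
  interpret Bk: bounded_linear "B ^^ k" by (rule Bk_bl)
  have g: "C1L2 g0 g1" "C1L2 g1 g2" "C1L2 g2 g3" "g0 0 = 0" using assms by (auto simp: nice_def)
  have "abs_l2 g3 \<bullet> (C ^^ k) (abs_l2 g0) + abs_l2 g2 \<bullet> (C ^^ k) (abs_l2 g1) = 0"
    using integration_by_parts[OF g(3,1), of k] g(4) by (simp add: Bk.zero)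
  moreover have "abs_l2 g2 \<bullet> (C ^^ k) (abs_l2 g1) + abs_l2 g1 \<bullet> (C ^^ k) (abs_l2 g2) = - (g1 0 \<bullet> (B ^^ k) (g1 0))"
    using integration_by_parts[OF g(2,2), of k] .
  moreover have "abs_l2 g1 \<bullet> (C ^^ k) (abs_l2 g2) = abs_l2 g2 \<bullet> (C ^^ k) (abs_l2 g1)"
    using inj_symD(2)[OF Ck, of k "abs_l2 g1" "abs_l2 g2"] by (simp add: inner_commute)
  ultimately show ?thesis by linarith
qed

definition state :: "(real \<Rightarrow> 'h) \<Rightarrow> (real \<Rightarrow> 'h) \<Rightarrow> (real \<Rightarrow> 'h) \<Rightarrow> (real \<Rightarrow> 'h) \<Rightarrow> 'h state" where
  "state g0 g1 g2 g3 = (abs_l2 g0, (C ^^ 2) (abs_l2 g1), (C ^^ 4) (abs_l2 g2), (C ^^ 6) (abs_l2 g3),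
     half_line_ext (\<lambda>t. B (g0 t)), half_line_ext (\<lambda>t. (B ^^ 3) (g1 t)))"

definition nice_states :: "'h state set" where
  "nice_states = {state g0 g1 g2 g3 | g0 g1 g2 g3. nice g0 g1 g2 g3}"

definition X :: "'h state set" where
  "X = closure nice_states"

lemma state_components:
  assumes "nice g0 g1 g2 g3"
  shows "P0 (state g0 g1 g2 g3) = abs_l2 g0" "P1 (state g0 g1 g2 g3) = (C ^^ 2) (abs_l2 g1)"
    "P2 (state g0 g1 g2 g3) = (C ^^ 4) (abs_l2 g2)" "P3 (state g0 g1 g2 g3) = (C ^^ 6) (abs_l2 g3)"
    "apply_bcontfun (W5 (state g0 g1 g2 g3)) t = B (g0 (max 0 t))"
    "apply_bcontfun (W3 (state g0 g1 g2 g3)) t = (B ^^ 3) (g1 (max 0 t))"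
proof -
  have g: "C1L2 g0 g1" "C1L2 g1 g2" using assms by (auto simp: nice_def)
  show "apply_bcontfun (W5 (state g0 g1 g2 g3)) t = B (g0 (max 0 t))"
    using half_line_ext_apply[OF C1L2_bounded_linear[OF inj_symD(1)[OF B] g(1)], of t]
    by (simp add: state_def W5_def)
  show "apply_bcontfun (W3 (state g0 g1 g2 g3)) t = (B ^^ 3) (g1 (max 0 t))"
    using half_line_ext_apply[OF C1L2_bounded_linear[OF Bk_bl[of 3] g(2)], of t]
    by (simp add: state_def W3_def)
qed (simp_all add: state_def P0_def P1_def P2_def P3_def)

lemma state_eqI:
  assumes "P0 x = P0 y" "P1 x = P1 y" "P2 x = P2 y" "P3 x = P3 y"
    "\<And>t. apply_bcontfun (W5 x) t = apply_bcontfun (W5 y) t"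
      "\<And>t. apply_bcontfun (W3 x) t = apply_bcontfun (W3 y) t"
  shows "x = y"
  using assms bcontfun_eqI[of "W5 x" "W5 y"] bcontfun_eqI[of "W3 x" "W3 y"]
  by (simp add: state_defs prod_eq_iff)

lemma subspace_nice_states: "subspace nice_states"
  unfolding subspace_def
proof (intro conjI ballI allI)
  have nice0: "nice (\<lambda>_. 0) (\<lambda>_. 0) (\<lambda>_. 0) (\<lambda>_. 0)"
    by (simp add: nice_def C1L2_def)
  interpret C: bounded_linear C using C by (rule inj_symD)
  note lin = linear_simps[OF Ck_bl] linear_simps[OF Bk_bl] linear_simps[OF inj_symD(1)[OF B]]
    linear_simps[OF bounded_linear_P0] linear_simps[OF bounded_linear_P1] linear_simps[OF bounded_linear_P2]
    linear_simps[OF bounded_linear_P3] linear_simps[OF bounded_linear_W5] linear_simps[OF bounded_linear_W3]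
  have "state (\<lambda>_. 0) (\<lambda>_. 0) (\<lambda>_. 0) (\<lambda>_. 0) = 0"
    by (rule state_eqI) (simp_all only: state_components[OF nice0] lin flip: zero_l2_def, simp_all)
  then show "0 \<in> nice_states" unfolding nice_states_def using nice0 by force
  fix x assume "x \<in> nice_states"
  then obtain g0 g1 g2 g3 where g: "nice g0 g1 g2 g3" "x = state g0 g1 g2 g3" by (auto simp: nice_states_def)
  then have L: "g0 \<in> L2" "g1 \<in> L2" "g2 \<in> L2" "g3 \<in> L2" by (auto simp: nice_def dest: C1L2D)
  show "c *\<^sub>R x \<in> nice_states" for c
  proof -
    have n: "nice (\<lambda>t. c *\<^sub>R g0 t) (\<lambda>t. c *\<^sub>R g1 t) (\<lambda>t. c *\<^sub>R g2 t) (\<lambda>t. c *\<^sub>R g3 t)"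
      using g(1) by (auto simp: nice_def intro!: C1L2_bounded_linear[OF bounded_linear_scaleR_right])
    have "c *\<^sub>R x = state (\<lambda>t. c *\<^sub>R g0 t) (\<lambda>t. c *\<^sub>R g1 t) (\<lambda>t. c *\<^sub>R g2 t) (\<lambda>t. c *\<^sub>R g3 t)"
      by (rule state_eqI)
         (simp_all add: state_components[OF n] state_components[OF g(1)] g(2) lin L flip: abs_l2_scaleR)
    then show ?thesis unfolding nice_states_def using n by blast
  qed
  fix y assume "y \<in> nice_states"
  then obtain h0 h1 h2 h3 where h: "nice h0 h1 h2 h3" "y = state h0 h1 h2 h3" by (auto simp: nice_states_def)
  then have L': "h0 \<in> L2" "h1 \<in> L2" "h2 \<in> L2" "h3 \<in> L2" by (auto simp: nice_def dest: C1L2D)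
  have n: "nice (\<lambda>t. g0 t + h0 t) (\<lambda>t. g1 t + h1 t) (\<lambda>t. g2 t + h2 t) (\<lambda>t. g3 t + h3 t)"
    using g(1) h(1) by (auto simp: nice_def intro!: C1L2_add)
  have "x + y = state (\<lambda>t. g0 t + h0 t) (\<lambda>t. g1 t + h1 t) (\<lambda>t. g2 t + h2 t) (\<lambda>t. g3 t + h3 t)"
    by (rule state_eqI)
       (simp_all add: state_components[OF n] state_components[OF g(1)] state_components[OF h(1)] g(2) h(2)
          lin L L' flip: abs_l2_plus)
  then show "x + y \<in> nice_states" unfolding nice_states_def using n by blast
qed

lemma subspace_X: "subspace X"
  unfolding X_def by (rule subspace_closure[OF subspace_nice_states])

lemma closed_X: "closed X"
  by (simp add: X_def)

section \<open>Passage to the closure: energy, intermediate derivatives, traces\<close>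

lemma X_induct [consumes 1, case_names closed nice]:
  assumes "x \<in> X" "closed {x. Q x}"
    "\<And>g0 g1 g2 g3. nice g0 g1 g2 g3 \<Longrightarrow> Q (state g0 g1 g2 g3)"
  shows "Q x"
proof -
  have "nice_states \<subseteq> {x. Q x}" using assms(3) by (auto simp: nice_states_def)
  then have "X \<subseteq> {x. Q x}" unfolding X_def using assms(2) by (rule closure_minimal)
  then show ?thesis using assms(1) by blast
qed

lemmas state_continuous = bounded_linear.continuous_on[OF bounded_linear_P0]
  bounded_linear.continuous_on[OF bounded_linear_P1] bounded_linear.continuous_on[OF bounded_linear_P2]
  bounded_linear.continuous_on[OF bounded_linear_P3] bounded_linear.continuous_on[OF bounded_linear_W5]
  bounded_linear.continuous_on[OF bounded_linear_W3]
  bounded_linear.continuous_on[OF bounded_linear_apply_bcontfun]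

text \<open>The cross term 2 P3 . P0 equals |A^(3/2) u'(0)|^2 by
  \<open>third_derivative_inner\<close> with k = 6.\<close>

lemma X_energy:
  assumes "x \<in> X"
  shows "(norm (P3 x - P0 x))\<^sup>2 = (norm (P3 x))\<^sup>2 + (norm (P0 x))\<^sup>2 - (norm (apply_bcontfun (W3 x) 0))\<^sup>2"
  using assms
proof (induction rule: X_induct)
  case closed
  show ?case by (intro closed_Collect_eq continuous_intros state_continuous)
next
  case (nice g0 g1 g2 g3)
  have "(C ^^ 6) (abs_l2 g3) \<bullet> abs_l2 g0 = (norm ((B ^^ 3) (g1 0)))\<^sup>2 / 2"
    using third_derivative_inner[OF nice, of 6] inj_symD(2)[OF Ck, of 6 "abs_l2 g3" "abs_l2 g0"]
      inj_sym_inner_funpow[OF B, of 3 "g1 0" 3 "g1 0"] by (simp add: power2_norm_eq_inner)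
  then show ?case
    by (simp add: state_components[OF nice] power2_norm_eq_inner inner_simps inner_commute)
qed

text \<open>|A^2 u'|^2 = - (A^3 u, A u''), because u(0) = 0 removes the boundary term.\<close>

lemma X_first_bound:
  assumes "x \<in> X"
  shows "(norm (P1 x))\<^sup>2 \<le> norm (P0 x) * norm (P2 x)"
  using assms
proof (induction rule: X_induct)
  case closed
  show ?case by (intro closed_Collect_le continuous_intros state_continuous)
next
  case (nice g0 g1 g2 g3)
  then have g: "C1L2 g0 g1" "C1L2 g1 g2" "g0 0 = 0" by (auto simp: nice_def)
  have "(norm ((C ^^ 2) (abs_l2 g1)))\<^sup>2 = - (abs_l2 g0 \<bullet> (C ^^ 4) (abs_l2 g2))"
    using integration_by_parts[OF g(1,2), of 4] g(3)
    by (simp add: power2_norm_eq_inner inj_sym_inner_funpow[OF C])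
  also have "\<dots> \<le> norm (abs_l2 g0) * norm ((C ^^ 4) (abs_l2 g2))"
    using Cauchy_Schwarz_ineq2[of "abs_l2 g0" "(C ^^ 4) (abs_l2 g2)"] by linarith
  finally show ?case by (simp only: state_components[OF nice])
qed

text \<open>Integration by parts leaves the boundary term (A^(3/2) u'(0), A^(1/2) u''(0)); its
  second factor is again estimated by integration by parts, now of A u'' against u'''.\<close>

lemma X_second_bound:
  assumes "x \<in> X"
  shows "(norm (P2 x))\<^sup>2 \<le> norm (P1 x) * norm (P3 x)
    + norm (apply_bcontfun (W3 x) 0) * sqrt (2 * norm (P2 x) * norm (P3 x))"
  using assms
proof (induction rule: X_induct)
  case closed
  show ?case by (intro closed_Collect_le continuous_intros state_continuous)
next
  case (nice g0 g1 g2 g3)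
  then have g: "C1L2 g1 g2" "C1L2 g2 g3" by (auto simp: nice_def)
  \<comment> \<open>The exponents balance: 5 + 5 = 4 + 6 for A^(1/2) u''(0), and 4 + 4 = 2 + 6 = 3 +
    5 for A u''.\<close>
  let ?p1 = "(C ^^ 2) (abs_l2 g1)" and ?p2 = "(C ^^ 4) (abs_l2 g2)" and ?p3 = "(C ^^ 6) (abs_l2 g3)"
  let ?q = "(B ^^ 3) (g1 0)" and ?s = "(B ^^ 5) (g2 0)"
  have "(norm ?s)\<^sup>2 = - 2 * (?p2 \<bullet> ?p3)"
    using integration_by_parts[OF g(2,2), of 10]
      inj_sym_inner_funpow[OF C, of 6 "abs_l2 g3" 4 "abs_l2 g2"]
    by (simp add: power2_norm_eq_inner inj_sym_inner_funpow[OF B] inj_sym_inner_funpow[OF C] inner_commute)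
  also have "\<dots> \<le> 2 * norm ?p2 * norm ?p3"
    using Cauchy_Schwarz_ineq2[of ?p2 ?p3] by simp
  finally have s: "norm ?s \<le> sqrt (2 * norm ?p2 * norm ?p3)" by (rule real_le_rsqrt)
  have "(norm ?p2)\<^sup>2 = - (?p1 \<bullet> ?p3) - ?q \<bullet> ?s"
    using integration_by_parts[OF g, of 8]
    by (simp add: power2_norm_eq_inner inj_sym_inner_funpow[OF B] inj_sym_inner_funpow[OF C])
  also have "\<dots> \<le> norm ?p1 * norm ?p3 + norm ?q * norm ?s"
    using Cauchy_Schwarz_ineq2[of ?p1 ?p3] Cauchy_Schwarz_ineq2[of ?q ?s] by linarith
  also have "\<dots> \<le> norm ?p1 * norm ?p3 + norm ?q * sqrt (2 * norm ?p2 * norm ?p3)"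
    using s by (intro add_left_mono mult_left_mono) auto
  finally show ?case by (simp add: state_components[OF nice])
qed

text \<open>\<open>C1L2_pointwise_bound\<close> with the powers of B shifted as B g_0 . B g_1 = g_0
  . B^2 g_1 and B^3 g_1 . B^3 g_2 = B^2 g_1 . B^4 g_2.\<close>

lemma X_sup_bounds:
  assumes "x \<in> X"
  shows "(norm (apply_bcontfun (W5 x) t))\<^sup>2 \<le> 2 * (norm (P0 x) * norm (P1 x))" (is ?A)
    and "(norm (apply_bcontfun (W3 x) t))\<^sup>2 \<le> (norm (apply_bcontfun (W3 x) 0))\<^sup>2 + 2 * (norm (P1 x) * norm (P2 x))" (is ?B)
proof -
  show ?A
    using assms
  proof (induction rule: X_induct)
    case closed
    show ?case by (intro closed_Collect_le continuous_intros state_continuous)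
  next
    case (nice g0 g1 g2 g3)
    then have g: "C1L2 g0 g1" "g0 0 = 0" by (auto simp: nice_def)
    have 0: "B 0 = 0" by (rule linear_simps(3)[OF inj_symD(1)[OF B]])
    have shift: "B v \<bullet> B w = v \<bullet> (B ^^ 2) w" for v w
      using inj_sym_inner_funpow[OF B, of 1 v 1 w] by (simp add: numeral_2_eq_2)
    show ?case
      using C1L2_pointwise_bound[OF C1L2_bounded_linear[OF inj_symD(1)[OF B] g(1)] C1L2D(1)[OF g(1)]
          L2_bounded_linear[OF Bk_bl[of 2] C1L2D(2)[OF g(1)]], of "max 0 t"]
      by (simp add: state_components[OF nice] g(2) 0 l2_map_funpow_abs[OF B C1L2D(2)[OF g(1)]] shift)
  qed
  show ?B
    using assms
  proof (induction rule: X_induct)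
    case closed
    show ?case by (intro closed_Collect_le continuous_intros state_continuous)
  next
    case (nice g0 g1 g2 g3)
    then have g: "C1L2 g1 g2" by (auto simp: nice_def)
    show ?case
      using C1L2_pointwise_bound[OF C1L2_bounded_linear[OF Bk_bl[of 3] g]
          L2_bounded_linear[OF Bk_bl[of 2] C1L2D(1)[OF g]] L2_bounded_linear[OF Bk_bl[of 4] C1L2D(2)[OF g]], of "max 0 t"]
      by (simp add: state_components[OF nice] l2_map_funpow_abs[OF B] C1L2D(1,2)[OF g] inj_sym_inner_funpow[OF B])
  qed
qed

text \<open>\<open>(C ^^ 6) (P0 x)\<close>, \<open>(C ^^ 4) (P1 x)\<close>,
  \<open>(C ^^ 2) (P2 x)\<close> and \<open>P3 x\<close> are u, u', u'' and u'''. For a fixed test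
  function each relation is a closed condition on the state.\<close>

lemma X_weak_derivatives:
  assumes "x \<in> X" and \<phi>: "test_function \<phi>"
  shows "l2_pair (deriv \<phi>) ((C ^^ 6) (P0 x)) = - l2_pair \<phi> ((C ^^ 4) (P1 x))" (is ?A)
    and "l2_pair (deriv \<phi>) ((C ^^ 4) (P1 x)) = - l2_pair \<phi> ((C ^^ 2) (P2 x))" (is ?B)
    and "l2_pair (deriv \<phi>) ((C ^^ 2) (P2 x)) = - l2_pair \<phi> (P3 x)" (is ?D)
proof -
  note cont = continuous_intros state_continuous bounded_linear.continuous_on[OF Ck_bl]
    bounded_linear.continuous_on[OF bounded_linear_l2_pair[OF test_function_L2[OF \<phi>]]]
    bounded_linear.continuous_on[OF bounded_linear_l2_pair[OF test_function_L2[OF test_function_deriv[OF \<phi>]]]]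
  have *: "l2_pair (deriv \<phi>) ((C ^^ 6) (abs_l2 x)) = - l2_pair \<phi> ((C ^^ 6) (abs_l2 y))" if "C1L2 x y"
    for x y
    using C1L2_weak_derivative[OF C1L2_bounded_linear[OF Bk_bl[of 6] that] \<phi>]
    by (simp add: l2_map_funpow_abs[OF B] C1L2D[OF that])
  show ?A using assms(1)
  proof (induction rule: X_induct)
    case closed
    show ?case by (intro closed_Collect_eq cont)
  next
    case (nice g0 g1 g2 g3)
    then show ?case using *[of g0 g1] by (simp add: state_components[OF nice] funpow_add_apply nice_def)
  qed
  show ?B using assms(1)
  proof (induction rule: X_induct)
    case closed
    show ?case by (intro closed_Collect_eq cont)
  next
    case (nice g0 g1 g2 g3)
    then show ?case using *[of g1 g2] by (simp add: state_components[OF nice] funpow_add_apply nice_def)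
  qed
  show ?D using assms(1)
  proof (induction rule: X_induct)
    case closed
    show ?case by (intro closed_Collect_eq cont)
  next
    case (nice g0 g1 g2 g3)
    then show ?case using *[of g2 g3] by (simp add: state_components[OF nice] funpow_add_apply nice_def)
  qed
qed

text \<open>The tested forms of A^(5/2) u = B A^3 u and A^(3/2) u' = B A^2 u'; they make
  \<open>W5 x\<close> and \<open>W3 x\<close> continuous representatives.\<close>

lemma X_traces:
  assumes "x \<in> X" and \<phi>: "test_function \<phi>"
  shows "l2_pair \<phi> (C (P0 x)) = bc_pair \<phi> (W5 x)" (is ?A)
    and "l2_pair \<phi> (C (P1 x)) = bc_pair \<phi> (W3 x)" (is ?B)
proof -
  note cont = continuous_intros state_continuous bounded_linear.continuous_on[OF inj_symD(1)[OF C]]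
    bounded_linear.continuous_on[OF bounded_linear_l2_pair[OF test_function_L2[OF \<phi>]]]
    bounded_linear.continuous_on[OF bounded_linear_bc_pair[OF \<phi>]]
  have *: "l2_pair \<phi> (abs_l2 f) = bc_pair \<phi> w" if "f \<in> L2"
    "\<And>t. 0 < t \<Longrightarrow> apply_bcontfun w t = f t" for f w
    unfolding l2_pair_abs[OF test_function_L2[OF \<phi>] that(1)] bc_pair_def
    by (rule Bochner_Integration.integral_cong) (auto simp: that)
  show ?A using assms(1)
  proof (induction rule: X_induct)
    case closed
    show ?case by (intro closed_Collect_eq cont)
  next
    case (nice g0 g1 g2 g3)
    then have "g0 \<in> L2" by (auto simp: nice_def dest: C1L2D)
    then show ?case
      using *[of "\<lambda>t. B (g0 t)" "W5 (state g0 g1 g2 g3)"] L2_bounded_linear[OF inj_symD(1)[OF B]]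
      by (simp add: state_components[OF nice] l2_map_abs inj_symD(1)[OF B])
  qed
  show ?B using assms(1)
  proof (induction rule: X_induct)
    case closed
    show ?case by (intro closed_Collect_eq cont)
  next
    case (nice g0 g1 g2 g3)
    then have g: "g1 \<in> L2" by (auto simp: nice_def dest: C1L2D)
    have "C ((C ^^ 2) (abs_l2 g1)) = (C ^^ 3) (abs_l2 g1)" by (simp add: numeral_3_eq_3 numeral_2_eq_2)
    then show ?case
      using *[of "\<lambda>t. (B ^^ 3) (g1 t)" "W3 (state g0 g1 g2 g3)"] L2_bounded_linear[OF Bk_bl[of 3] g]
      by (simp add: state_components[OF nice] l2_map_funpow_abs[OF B g])
  qed
qed

lemma X_initial:
  assumes "x \<in> X"
  shows "apply_bcontfun (W5 x) 0 = 0"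
  using assms
proof (induction rule: X_induct)
  case closed
  show ?case by (intro closed_Collect_eq continuous_intros state_continuous)
next
  case (nice g0 g1 g2 g3)
  then show ?case using linear_simps(3)[OF inj_symD(1)[OF B]]
    by (simp add: state_components[OF nice] nice_def)
qed

section \<open>The map from u to (u''' - A^3 u, A^(3/2) u'(0)) and its range\<close>

definition data :: "'h state \<Rightarrow> 'h l2 \<times> 'h" where
  "data x = (P3 x - P0 x, apply_bcontfun (W3 x) 0)"

lemma bounded_linear_data: "bounded_linear data"
  unfolding data_def[abs_def]
  by (intro bounded_linear_Pair bounded_linear_sub bounded_linear_P0 bounded_linear_P3
      bounded_linear_compose[OF bounded_linear_apply_bcontfun bounded_linear_W3])

text \<open>The energy identity read as an isometry: the left-hand side is the squared norm of u in
  W. A bound of K in that norm is thus a bound relative to \<open>data\<close>.\<close>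

lemma norm_data_sq:
  assumes "x \<in> X"
  shows "(norm (P0 x))\<^sup>2 + (norm (P3 x))\<^sup>2 = (norm (data x))\<^sup>2"
  using X_energy[OF assms] by (simp add: data_def norm_Pair)

lemma norm_X_le: "\<exists>K>0. \<forall>x\<in>X. norm x \<le> K * norm (data x)"
proof -
  \<comment> \<open>The trivial bound of A^(3/2) u'(0) by \<open>data x\<close> is the case k = 1 of
    \<open>intermediate_bounds\<close>; c1 and c2 are its constants there.\<close>
  define c2 where "c2 = 2 powr (1/3) / 3 powr (1/2) * (1 + 3 powr (1/2) * 1 powr (2/3 :: real) :: real)"
  define c1 where "c1 = 2 powr (1/3) / 3 powr (1/2) * (1 + 3 * 1 powr (2/3 :: real) / 2 powr (1/3) :: real) powr (1/2)"
  have c: "0 \<le> c1" "0 \<le> c2" by (auto simp: c1_def c2_def)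
  define K where "K = 2 + c1 + c2 + sqrt (2 * c1) + sqrt (1 + 2 * (c1 * c2))"
  have "norm x \<le> K * norm (data x)" if x: "x \<in> X" for x
  proof -
    let ?n = "norm (data x)"
    have q: "norm (apply_bcontfun (W3 x) 0) \<le> 1 * ?n"
      using norm_snd_le[of "apply_bcontfun (W3 x) 0" "P3 x - P0 x"] by (simp add: data_def)
    note bounds = intermediate_bounds[OF norm_ge_zero norm_ge_zero norm_ge_zero norm_ge_zero norm_ge_zero zero_le_one
        X_first_bound[OF x] X_second_bound[OF x] norm_data_sq[OF x] q]
    have p2: "norm (P2 x) \<le> c2 * ?n" using bounds(1) by (simp only: c2_def)
    have p1: "norm (P1 x) \<le> c1 * ?n" using bounds(2) by (simp only: c1_def)
    have p0: "norm (P0 x) \<le> ?n" by (rule power2_le_imp_le) (simp_all flip: norm_data_sq[OF x])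
    have p3: "norm (P3 x) \<le> ?n" by (rule power2_le_imp_le) (simp_all flip: norm_data_sq[OF x])
    have "norm (W5 x) \<le> sqrt (2 * c1) * ?n"
    proof (rule norm_bound, rule power2_le_imp_le)
      fix t
      have "norm (P0 x) * norm (P1 x) \<le> ?n * (c1 * ?n)" using p0 p1 by (intro mult_mono) auto
      then show "(norm (apply_bcontfun (W5 x) t))\<^sup>2 \<le> (sqrt (2 * c1) * ?n)\<^sup>2"
        using X_sup_bounds(1)[OF x, of t] c by (simp add: power_mult_distrib power2_eq_square[of ?n] mult_ac)
    qed (use c in simp)
    moreover have "norm (W3 x) \<le> sqrt (1 + 2 * (c1 * c2)) * ?n"
    proof (rule norm_bound, rule power2_le_imp_le)
      fix t
      have "norm (P1 x) * norm (P2 x) \<le> (c1 * ?n) * (c2 * ?n)" using p1 p2 c by (intro mult_mono) auto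
      moreover have "(norm (apply_bcontfun (W3 x) 0))\<^sup>2 \<le> ?n\<^sup>2" using q
        by (intro power_mono) auto
      moreover have "(sqrt (1 + 2 * (c1 * c2)) * ?n)\<^sup>2 = ?n\<^sup>2 + 2 * ((c1 * ?n) * (c2 * ?n))"
        using c by (simp add: power_mult_distrib) (simp add: power2_eq_square algebra_simps)
      ultimately show "(norm (apply_bcontfun (W3 x) t))\<^sup>2 \<le> (sqrt (1 + 2 * (c1 * c2)) * ?n)\<^sup>2"
        using X_sup_bounds(2)[OF x, of t] by linarith
    qed (use c in simp)
    moreover have "norm x \<le> norm (P0 x) + (norm (P1 x) + (norm (P2 x) + (norm (P3 x) + (norm (W5 x) + norm (W3 x)))))"
      unfolding state_defs
      using norm_le_fst_snd[of x] norm_le_fst_snd[of "snd x"] norm_le_fst_snd[of "snd (snd x)"]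
        norm_le_fst_snd[of "snd (snd (snd x))"] norm_le_fst_snd[of "snd (snd (snd (snd x)))"]
      by linarith
    ultimately show ?thesis using p0 p1 p2 p3 unfolding K_def distrib_right by linarith
  qed
  moreover have "0 < K" using c unfolding K_def
    by (intro add_pos_nonneg real_sqrt_ge_zero add_nonneg_nonneg mult_nonneg_nonneg) auto
  ultimately show ?thesis by blast
qed

lemma scaled_nice:
  assumes "C1L2 a0 a1" "C1L2 a1 a2" "C1L2 a2 a3" "a0 0 = (0::real)"
  shows "nice (\<lambda>t. a0 t *\<^sub>R v) (\<lambda>t. a1 t *\<^sub>R v) (\<lambda>t. a2 t *\<^sub>R v) (\<lambda>t. a3 t *\<^sub>R v)"
  using assms by (auto simp: nice_def intro!: C1L2_bounded_linear[OF bounded_linear_scaleR_left])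

text \<open>Graph of the third derivative on functions with u(0) = u'(0) = 0, acting on A^3 u.
  Prescribing both initial values makes it skew-symmetric.\<close>

definition zero_graph :: "('h l2 \<times> 'h l2) set" where
  "zero_graph = {(abs_l2 g0, abs_l2 g3) | g0 g1 g2 g3. nice g0 g1 g2 g3 \<and> g1 0 = 0}"

lemma subspace_zero_graph: "subspace zero_graph"
  unfolding subspace_def
proof (intro conjI ballI allI)
  have "nice (\<lambda>_. 0) (\<lambda>_. 0) (\<lambda>_. 0) (\<lambda>_. 0)" by (simp add: nice_def C1L2_def)
  then show "0 \<in> zero_graph" unfolding zero_graph_def zero_prod_def zero_l2_def by blast
  fix x assume "x \<in> zero_graph"
  then obtain g0 g1 g2 g3 where g: "nice g0 g1 g2 g3" "g1 0 = 0" "x = (abs_l2 g0, abs_l2 g3)"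
    unfolding zero_graph_def by blast
  then have L: "g0 \<in> L2" "g3 \<in> L2" by (auto simp: nice_def dest: C1L2D)
  show "c *\<^sub>R x \<in> zero_graph" for c
  proof -
    have "nice (\<lambda>t. c *\<^sub>R g0 t) (\<lambda>t. c *\<^sub>R g1 t) (\<lambda>t. c *\<^sub>R g2 t) (\<lambda>t. c *\<^sub>R g3 t)"
      using g(1) by (auto simp: nice_def intro!: C1L2_bounded_linear[OF bounded_linear_scaleR_right])
    moreover have "c *\<^sub>R x = (abs_l2 (\<lambda>t. c *\<^sub>R g0 t), abs_l2 (\<lambda>t. c *\<^sub>R g3 t))"
      by (simp add: g(3) abs_l2_scaleR L)
    moreover have "c *\<^sub>R g1 0 = 0" using g(2) by simp
    ultimately show ?thesis unfolding zero_graph_def by blast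
  qed
  fix y assume "y \<in> zero_graph"
  then obtain h0 h1 h2 h3 where h: "nice h0 h1 h2 h3" "h1 0 = 0" "y = (abs_l2 h0, abs_l2 h3)"
    unfolding zero_graph_def by blast
  then have L': "h0 \<in> L2" "h3 \<in> L2" by (auto simp: nice_def dest: C1L2D)
  have "nice (\<lambda>t. g0 t + h0 t) (\<lambda>t. g1 t + h1 t) (\<lambda>t. g2 t + h2 t) (\<lambda>t. g3 t + h3 t)"
    using g(1) h(1) by (auto simp: nice_def intro!: C1L2_add)
  moreover have "x + y = (abs_l2 (\<lambda>t. g0 t + h0 t), abs_l2 (\<lambda>t. g3 t + h3 t))"
    by (simp add: g(3) h(3) abs_l2_plus L L')
  moreover have "g1 0 + h1 0 = 0" using g(2) h(2) by simp
  ultimately show "x + y \<in> zero_graph" unfolding zero_graph_def by blast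
qed

text \<open>The scalar equation with c^3 = M and right-hand side \<phi>, multiplied by a fixed
  vector w, shows that z is orthogonal to \<phi> w for all test functions \<phi> and vectors
  w.\<close>

lemma zero_graph_dense:
  assumes M: "0 < M" and z: "\<And>v d. (v, d) \<in> zero_graph \<Longrightarrow> z \<bullet> (d - M *\<^sub>R v) = 0"
  shows "z = 0"
proof (rule l2_pair_eq_0)
  fix \<phi> assume \<phi>: "test_function \<phi>"
  obtain a b where ab: "0 < a" "\<And>t. t \<notin> {a..b} \<Longrightarrow> \<phi> t = 0" using \<phi>
    by (auto simp: test_function_def)
  define c where "c = M powr (1/3)"
  have c: "0 < c" "c ^ 3 = M" using M by (auto simp: c_def powr_third_cube)
  \<comment> \<open>The support bound is taken beyond b, since \<phi> is only given to vanish
    outside the closed interval, and kept nonnegative.\<close>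
  obtain a0 a1 a2 a3 where s: "C1L2 a0 a1" "C1L2 a1 a2" "C1L2 a2 a3" "a0 0 = 0" "a1 0 = 0"
    "\<And>t. 0 \<le> t \<Longrightarrow> a3 t - c ^ 3 * a0 t = \<phi> t"
    by (rule scalar_equation_solvable[OF c(1) test_function_continuous[OF \<phi>], of "max 0 (b + 1)"])
       (use ab in auto)
  have "w \<bullet> l2_pair \<phi> z = w \<bullet> 0" for w
  proof -
    note n = scaled_nice[OF s(1-4), of w]
    have L: "(\<lambda>t. a0 t *\<^sub>R w) \<in> L2" "(\<lambda>t. a3 t *\<^sub>R w) \<in> L2" using n
      by (auto simp: nice_def dest: C1L2D)
    have "(abs_l2 (\<lambda>t. a0 t *\<^sub>R w), abs_l2 (\<lambda>t. a3 t *\<^sub>R w)) \<in> zero_graph"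
      unfolding zero_graph_def using n s(5) by fastforce
    from z[OF this] have "z \<bullet> abs_l2 (\<lambda>t. a3 t *\<^sub>R w - M *\<^sub>R (a0 t *\<^sub>R w)) = 0"
      by (simp add: abs_l2_scaleR abs_l2_minus L L2_scaleR[OF L(1)] del: scaleR_scaleR)
    also have "abs_l2 (\<lambda>t. a3 t *\<^sub>R w - M *\<^sub>R (a0 t *\<^sub>R w)) = abs_l2 (\<lambda>t. \<phi> t *\<^sub>R w)"
    proof (subst abs_l2_eq_iff)
      show "(\<lambda>t. a3 t *\<^sub>R w - M *\<^sub>R (a0 t *\<^sub>R w)) \<in> L2"
        by (intro L2_diff L L2_scaleR)
      show "(\<lambda>t. \<phi> t *\<^sub>R w) \<in> L2"
        by (rule l2_pair_inner(1)[OF test_function_L2[OF \<phi>]])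
      have "a3 t *\<^sub>R w - M *\<^sub>R (a0 t *\<^sub>R w) = \<phi> t *\<^sub>R w" if "0 \<le> t" for t
        unfolding s(6)[OF that, symmetric] c(2) by (simp add: algebra_simps)
      then show "AE t in Rplus. a3 t *\<^sub>R w - M *\<^sub>R (a0 t *\<^sub>R w) = \<phi> t *\<^sub>R w"
        by (intro AE_I2) auto
    qed
    finally show ?thesis using l2_pair_inner(2)[OF test_function_L2[OF \<phi>], of z w]
      by (simp add: inner_commute)
  qed
  from dense_orthogonal_eq[of UNIV, OF _ this] show "l2_pair \<phi> z = 0" by simp
qed

lemma initial_velocity_attained: "\<exists>g0 g1 g2 g3. nice g0 g1 g2 g3 \<and> g1 0 = v"
proof -
  \<comment> \<open>The span of exp(-t) and t exp(-t) is closed under differentiation; t exp(-t) v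
    vanishes at 0 with velocity v.\<close>
  define e where "e a b t = (a + b * t) * exp (- t)" for a b t :: real
  have d: "(e a b has_real_derivative e (b - a) (- b) t) (at t within S)" for a b t S
    unfolding e_def[abs_def] by (auto intro!: derivative_eq_intros simp: algebra_simps)
  have cont: "continuous_on {0..} (e a b)" for a b unfolding e_def by (intro continuous_intros)
  have L: "e a b \<in> L2" for a b
  proof (rule exp_decay_L2[OF cont, of "1/2" a b "\<bar>a\<bar> + 2 * \<bar>b\<bar>"])
    fix t :: real assume t: "0 \<le> t"
    have "\<bar>a + b * t\<bar> \<le> (\<bar>a\<bar> + 2 * \<bar>b\<bar>) * exp (t / 2)"
    proof -
      have "1 \<le> exp (t / 2)" "t \<le> 2 * exp (t / 2)" using t exp_ge_add_one_self[of "t / 2"]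
        by linarith+
      then have "\<bar>a\<bar> * 1 + \<bar>b\<bar> * t \<le> \<bar>a\<bar> * exp (t / 2) + \<bar>b\<bar> * (2 * exp (t / 2))"
        by (intro add_mono mult_left_mono) auto
      moreover have "\<bar>a + b * t\<bar> \<le> \<bar>a\<bar> + \<bar>b\<bar> * t"
        using abs_triangle_ineq[of a "b * t"] t by (simp add: abs_mult)
      ultimately show ?thesis by (simp add: algebra_simps)
    qed
    then have "\<bar>a + b * t\<bar> * exp (- t) \<le> (\<bar>a\<bar> + 2 * \<bar>b\<bar>) * exp (t / 2) * exp (- t)"
      by (rule mult_right_mono) simp
    then show "\<bar>e a b t\<bar> \<le> (\<bar>a\<bar> + 2 * \<bar>b\<bar>) * exp (- (1/2) * t)"
      by (simp add: e_def abs_mult mult.assoc flip: exp_add)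
  qed simp
  have C1: "C1L2 (e a b) (e (b - a) (- b))" for a b
    by (simp add: C1L2_real_iff L cont d)
  have "C1L2 (e 0 1) (e 1 (-1))" "C1L2 (e 1 (-1)) (e (-2) 1)" "C1L2 (e (-2) 1) (e 3 (-1))"
    using C1[of 0 1] C1[of 1 "-1"] C1[of "-2" 1] by simp_all
  from scaled_nice[OF this, of v]
  have "nice (\<lambda>t. e 0 1 t *\<^sub>R v) (\<lambda>t. e 1 (-1) t *\<^sub>R v) (\<lambda>t. e (-2) 1 t *\<^sub>R v) (\<lambda>t. e 3 (-1) t *\<^sub>R v)"
    by (simp add: e_def)
  moreover have "e 1 (-1) 0 *\<^sub>R v = v" by (simp add: e_def)
  ultimately show ?thesis by blast
qed

text \<open>A vector (z, y) orthogonal to the range is tested first on functions with u'(0) = 0,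
  where \<open>commuting_range_dense\<close> with T = A^(-3) gives z = 0. Then the second component
  B^3 v runs through a dense set, so y = 0.\<close>

lemma data_nice_dense: "closure (data ` nice_states) = UNIV"
proof (rule dense_if_orthogonal_trivial)
  interpret bounded_linear data by (rule bounded_linear_data)
  show "subspace (data ` nice_states)" by (rule linear_subspace_image[OF linear subspace_nice_states])
  fix zy assume zy: "\<And>v. v \<in> data ` nice_states \<Longrightarrow> zy \<bullet> v = 0"
  obtain z y where zy_eq: "zy = (z, y)" by force
  have orth: "z \<bullet> ((C ^^ 6) (abs_l2 g3) - abs_l2 g0) + y \<bullet> (B ^^ 3) (g1 0) = 0"
    if "nice g0 g1 g2 g3" for g0 g1 g2 g3
  proof -
    have "data (state g0 g1 g2 g3) \<in> data ` nice_states"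
      by (rule imageI) (use that in \<open>auto simp: nice_states_def\<close>)
    from zy[OF this] show ?thesis by (simp add: zy_eq data_def state_components[OF that])
  qed
  have z0: "z = 0"
  proof (rule commuting_range_dense[OF subspace_zero_graph Ck[of 6]])
    show "0 \<le> x \<bullet> (C ^^ 6) x" for x
      using inj_sym_inner_funpow[OF C, of 3 x 3 x] inner_ge_zero[of "(C ^^ 3) x"] by simp
    fix v d assume "(v, d) \<in> zero_graph"
    then obtain g0 g1 g2 g3 where g: "nice g0 g1 g2 g3" "g1 0 = 0" "v = abs_l2 g0" "d = abs_l2 g3"
      unfolding zero_graph_def by blast
    then have L: "g0 \<in> L2" "g3 \<in> L2" by (auto simp: nice_def dest: C1L2D)
    have 0: "(B ^^ k) 0 = 0" for k by (rule linear_simps(3)[OF Bk_bl])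
    show "d \<bullet> v = 0" "d \<bullet> (C ^^ 6) v = 0"
      using third_derivative_inner[OF g(1), of 0] third_derivative_inner[OF g(1), of 6] by (auto simp: g)
    show "z \<bullet> ((C ^^ 6) d - v) = 0" using orth[OF g(1)] by (simp add: g 0)
    have "nice (\<lambda>t. (B ^^ 6) (g0 t)) (\<lambda>t. (B ^^ 6) (g1 t)) (\<lambda>t. (B ^^ 6) (g2 t)) (\<lambda>t. (B ^^ 6) (g3 t))"
      using g(1) 0 by (auto simp: nice_def intro!: C1L2_bounded_linear[OF Bk_bl])
    then show "((C ^^ 6) v, (C ^^ 6) d) \<in> zero_graph"
      unfolding g(3,4) l2_map_funpow_abs[OF B L(1)] l2_map_funpow_abs[OF B L(2)] zero_graph_def
      using g(2) 0[of 6] by (smt (verit, best) mem_Collect_eq)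
  qed (fact zero_graph_dense)
  have "y \<bullet> (B ^^ 3) v = 0" for v
    using initial_velocity_attained[of v] orth z0 by fastforce
  then have "(B ^^ 3) y \<bullet> (B ^^ 3) y = 0" using inj_symD(2)[OF Bk, of 3 y] by simp
  then have "y = 0" using inj_symD(3)[OF Bk, of 3 y] by simp
  then show "zy = 0" by (simp add: zy_eq z0 zero_prod_def)
qed

text \<open>Bounded below on the complete space X, \<open>data\<close> has closed range, and the
  range is dense.\<close>

lemma data_surj: "data ` X = UNIV"
proof -
  interpret bounded_linear data by (rule bounded_linear_data)
  obtain K where K: "0 < K" "\<forall>x\<in>X. norm x \<le> K * norm (data x)" using norm_X_le by blast
  have "complete (data ` X)"
  proof (rule complete_isometric_image[OF _ subspace_X bounded_linear_data])
    show "0 < 1 / K" using K by simp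
    show "\<forall>x\<in>X. 1 / K * norm x \<le> norm (data x)" using K by (auto simp: field_simps)
    show "complete X" using closed_X by (simp add: complete_eq_closed)
  qed
  then have "closed (data ` X)" by (simp add: complete_eq_closed)
  moreover have "data ` nice_states \<subseteq> data ` X" using closure_subset by (auto simp: X_def)
  ultimately have "closure (data ` nice_states) \<subseteq> data ` X" by (intro closure_minimal)
  then show ?thesis using data_nice_dense by auto
qed

end


section \<open>Relatively bounded perturbations\<close>

text \<open>Fixed points of b |-> y - L1 (s b) for a choice s of preimages under L0. Although s is a
  mere choice function, s b' - s b is a preimage of b' - b, so the relative bound makes the
  iteration contract. Closure under differences suffices for this, which is the form available for
  \<open>X_K\<close>.\<close>

lemma perturbed_surjective:
  fixes L0 L1 :: "'a::ab_group_add \<Rightarrow> 'b::banach"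
  assumes diff: "\<And>x y. x \<in> X \<Longrightarrow> y \<in> X \<Longrightarrow> x - y \<in> X"
    and L0: "\<And>x y. x \<in> X \<Longrightarrow> y \<in> X \<Longrightarrow> L0 (x - y) = L0 x - L0 y"
    and L1: "\<And>x y. x \<in> X \<Longrightarrow> y \<in> X \<Longrightarrow> L1 (x - y) = L1 x - L1 y"
    and surj: "\<And>y. \<exists>x\<in>X. L0 x = y"
    and le: "\<And>x. x \<in> X \<Longrightarrow> norm (L1 x) \<le> \<theta> * norm (L0 x)"
      and \<theta>: "\<theta> < 1"
  shows "\<exists>x\<in>X. L0 x + L1 x = y"
proof -
  obtain s where s: "\<And>y. s y \<in> X" "\<And>y. L0 (s y) = y" using surj by metis
  have "\<exists>!b. y - L1 (s b) = b"
  proof (rule banach_fix_type[where c = "max 0 \<theta>"], goal_cases)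
    case 3
    show ?case
    proof (intro allI)
      fix b b' :: 'b
      have "norm (L1 (s b' - s b)) \<le> \<theta> * norm (L0 (s b' - s b))" by (intro le diff s)
      also have "\<dots> \<le> max 0 \<theta> * norm (b' - b)" by (simp add: L0 s mult_right_mono)
      finally show "dist (y - L1 (s b)) (y - L1 (s b')) \<le> max 0 \<theta> * dist b b'"
        by (simp add: dist_norm L1 s norm_minus_commute)
    qed
  qed (use \<theta> in auto)
  then obtain b where "y - L1 (s b) = b" by blast
  then have "L0 (s b) + L1 (s b) = y" by (simp add: s algebra_simps)
  then show ?thesis using s by blast
qed

section \<open>From states to functions\<close>

lemma loc_integrable_measurable:
  assumes "loc_integrable v"
  shows "v \<in> borel_measurable Rplus"
proof (rule borel_measurable_LIMSEQ_metric)
  let ?I = "\<lambda>n. {1 / real (Suc n)..real n}"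
  fix n
  have "integrable (lebesgue_on (?I n)) v" using assms by (simp add: loc_integrable_def)
  then have "integrable (lebesgue_on (?I n)) (\<lambda>t. indicator (?I n) t *\<^sub>R v t)"
    by (rule Bochner_Integration.integrable_cong[THEN iffD1, rotated 2]) auto
  then have "integrable Rplus (\<lambda>t. indicator (?I n) t *\<^sub>R v t)"
    by (subst integrable_Rplus_iff_Icc[of "1 / real (Suc n)" "real n"]) auto
  then show "(\<lambda>t. indicator (?I n) t *\<^sub>R v t) \<in> borel_measurable Rplus"
    by (rule borel_measurable_integrable)
next
  let ?I = "\<lambda>n. {1 / real (Suc n)..real n}"
  fix t assume "t \<in> space Rplus"
  then have t: "0 < t" by simp
  obtain n1 where n1: "inverse (real (Suc n1)) < t" using reals_Archimedean[OF t] by auto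
  obtain n2 where n2: "t \<le> real n2" using real_arch_simple by blast
  have "indicator (?I n) t *\<^sub>R v t = v t" if "max n1 n2 \<le> n" for n
  proof -
    have "1 / real (Suc n) \<le> 1 / real (Suc n1)" using that by (intro divide_left_mono) auto
    then have "t \<in> ?I n" using n1 n2 that by (auto simp: inverse_eq_divide)
    then show ?thesis by simp
  qed
  then show "(\<lambda>n. indicator (?I n) t *\<^sub>R v t) \<longlonglongrightarrow> v t"
    by (intro tendsto_eventually eventually_sequentiallyI)
qed

lemma L2_norm_cong_AE:
  assumes "f \<in> borel_measurable Rplus" "g \<in> borel_measurable Rplus" "AE t in Rplus. f t = g t"
  shows "L2_norm f = L2_norm g"
proof -
  note [measurable] = assms(1,2)
  have "AE t in Rplus. (norm (f t))\<^sup>2 = (norm (g t))\<^sup>2" using assms(3) by eventually_elim simp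
  then have "(LINT t|Rplus. (norm (f t))\<^sup>2) = (LINT t|Rplus. (norm (g t))\<^sup>2)"
    by (rule integral_cong_AE[rotated 2]) measurable
  then show ?thesis by (simp add: L2_norm_def)
qed

lemma has_weak_deriv_cong_AE:
  assumes d: "has_weak_deriv n u v" and w: "loc_integrable w" "AE t in Rplus. v t = w t"
  shows "has_weak_deriv n u w"
  unfolding has_weak_deriv_def
proof (intro conjI allI impI)
  show "loc_integrable u" using d by (simp add: has_weak_deriv_def)
  show "loc_integrable w" by fact
  fix \<phi> assume \<phi>: "test_function \<phi>"
  have v: "loc_integrable v" using d by (simp add: has_weak_deriv_def)
  have "AE t in Rplus. \<phi> t *\<^sub>R v t = \<phi> t *\<^sub>R w t" using w(2) by eventually_elim simp
  then have "(LINT t|Rplus. \<phi> t *\<^sub>R v t) = (LINT t|Rplus. \<phi> t *\<^sub>R w t)"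
    by (intro integral_cong_AE borel_measurable_integrable test_function_times_integrable \<phi> v w)
  then show "(LINT t|Rplus. (deriv ^^ n) \<phi> t *\<^sub>R u t) = (-1) ^ n *\<^sub>R (LINT t|Rplus. \<phi> t *\<^sub>R w t)"
    using has_weak_derivD[OF d \<phi>] by simp
qed

lemma has_weak_deriv_diff:
  assumes "has_weak_deriv n u v" "has_weak_deriv n u' v'"
  shows "has_weak_deriv n (\<lambda>t. u t - u' t) (\<lambda>t. v t - v' t)"
proof -
  have li: "loc_integrable u" "loc_integrable v" "loc_integrable u'" "loc_integrable v'"
    using assms by (auto simp: has_weak_deriv_def)
  show ?thesis
    unfolding has_weak_deriv_def
  proof (intro conjI allI impI loc_integrable_diff li)
    fix \<phi> assume \<phi>: "test_function \<phi>"
    note int = test_function_times_integrable[OF \<phi>] test_function_times_integrable[OF test_function_deriv_iter[OF \<phi>]]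
    show "(LINT t|Rplus. (deriv ^^ n) \<phi> t *\<^sub>R (u t - u' t)) = (-1) ^ n *\<^sub>R (LINT t|Rplus. \<phi> t *\<^sub>R (v t - v' t))"
      using has_weak_derivD[OF assms(1) \<phi>] has_weak_derivD[OF assms(2) \<phi>]
      by (simp add: scaleR_diff_right int li)
  qed
qed

lemma funpow_double: "((\<lambda>x. B (B x)) ^^ n) = B ^^ (2 * n)"
  by (induction n) (auto simp: fun_eq_iff)

locale boundary_problem = inverse_sqrt B
  for B :: "'h::{real_inner,banach,second_countable_topology} \<Rightarrow> 'h" +
  fixes A :: "'h \<rightharpoonup> 'h" and K :: "(real \<Rightarrow> 'h) \<Rightarrow> 'h"
  assumes gA: "graph_inv A (\<lambda>x. B (B x))" and gS: "graph_inv (op_sqrt A) B"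
    and K: "bounded_W_H A K" and norm_K: "norm_W_H A K < 1"
begin

abbreviation \<kappa> where "\<kappa> \<equiv> norm_W_H A K"

lemma half_pow: "graph_inv (half_pow A n) (B ^^ n)"
  unfolding half_pow_def by (rule graph_inv_op_pow[OF gS])

lemma pow: "graph_inv (op_pow A n) (B ^^ (2 * n))"
  using graph_inv_op_pow[OF gA, of n] by (simp add: funpow_double)

lemma H_half: "H_half A n = range (B ^^ n)"
  unfolding H_half_def by (rule graph_inv_dom[OF half_pow])

lemma H_norm: "H_norm A n ((B ^^ n) x) = norm x"
  unfolding H_norm_def graph_inv_ap[OF half_pow] ..

lemma K_add: "u \<in> W23 A \<Longrightarrow> v \<in> W23 A \<Longrightarrow> K (\<lambda>t. u t + v t) = K u + K v"
  and K_scaleR: "u \<in> W23 A \<Longrightarrow> K (\<lambda>t. c *\<^sub>R u t) = c *\<^sub>R K u"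
  using K by (auto simp: bounded_W_H_def)

lemma K_quotient_le:
  assumes u: "u \<in> W23 A"
  shows "H_norm A 3 (K u) / W23_norm A u \<le> \<kappa>"
proof -
  obtain c where c: "\<forall>u\<in>W23 A. H_norm A 3 (K u) \<le> c * W23_norm A u"
    using K unfolding bounded_W_H_def by blast
  \<comment> \<open>The maximum with 0 covers functions of norm 0, where the quotient is 0 by
    convention and c might be negative.\<close>
  have "H_norm A 3 (K u) / W23_norm A u \<le> max c 0" if "u \<in> W23 A" for u
  proof (cases "W23_norm A u = 0")
    case False
    then have "0 < W23_norm A u" by (simp add: W23_norm_def less_le)
    then have "H_norm A 3 (K u) / W23_norm A u \<le> c" using bspec[OF c that] by (simp add: divide_le_eq)
    then show ?thesis by simp
  qed simp
  then have bdd: "bdd_above ((\<lambda>u. H_norm A 3 (K u) / W23_norm A u) ` W23 A)" by (rule bdd_aboveI2)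
  show ?thesis unfolding norm_W_H_def by (rule cSUP_upper[OF u bdd])
qed

text \<open>For functions of norm 0 the quotient carries no information, and boundedness of K forces
  K u to have norm 0.\<close>

lemma K_bound:
  assumes u: "u \<in> W23 A"
  shows "H_norm A 3 (K u) \<le> \<kappa> * W23_norm A u"
proof (cases "W23_norm A u = 0")
  case True
  obtain c where "\<forall>u\<in>W23 A. H_norm A 3 (K u) \<le> c * W23_norm A u"
    using K unfolding bounded_W_H_def by blast
  from bspec[OF this u] show ?thesis using True by simp
next
  case False
  then have "0 < W23_norm A u" by (simp add: W23_norm_def less_le)
  then show ?thesis using K_quotient_le[OF u] by (simp add: divide_le_eq)
qed

text \<open>\<open>u = A\<^sup>-\<^sup>3 p\<close> with \<open>u''' = q\<close>; here \<open>A\<^sup>3 u\<close> is defined at every point.\<close>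

definition regular :: "(real \<Rightarrow> 'h) \<Rightarrow> (real \<Rightarrow> 'h) \<Rightarrow> bool" where
  "regular p q \<longleftrightarrow> p \<in> L2 \<and> q \<in> L2 \<and> has_weak_deriv 3 (\<lambda>t. (B ^^ 6) (p t)) q"

lemma regular_W23:
  assumes "regular p q"
  shows "(\<lambda>t. (B ^^ 6) (p t)) \<in> W23 A"
    "W23_norm A (\<lambda>t. (B ^^ 6) (p t)) = sqrt ((L2_norm q)\<^sup>2 + (L2_norm p)\<^sup>2)"
proof -
  have r: "p \<in> L2" "q \<in> L2" "has_weak_deriv 3 (\<lambda>t. (B ^^ 6) (p t)) q" using assms
    by (auto simp: regular_def)
  have ap: "ap (op_pow A 3) ((B ^^ 6) y) = y" for y using graph_inv_ap[OF pow, of 3 y] by simp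
  have dom: "(B ^^ 6) y \<in> dom (op_pow A 3)" for y using graph_inv_dom[OF pow, of 3] by simp
  show "(\<lambda>t. (B ^^ 6) (p t)) \<in> W23 A" unfolding W23_def using r ap dom by auto
  have "has_weak_deriv 3 (\<lambda>t. (B ^^ 6) (p t)) (weak_deriv 3 (\<lambda>t. (B ^^ 6) (p t)))"
    unfolding weak_deriv_def by (rule someI[of _ q]) fact
  then have "loc_integrable (weak_deriv 3 (\<lambda>t. (B ^^ 6) (p t)))" by (simp add: has_weak_deriv_def)
  then have "L2_norm (weak_deriv 3 (\<lambda>t. (B ^^ 6) (p t))) = L2_norm q"
    by (intro L2_norm_cong_AE loc_integrable_measurable L2_D(1) r has_weak_deriv_weak_deriv)
  then show "W23_norm A (\<lambda>t. (B ^^ 6) (p t)) = sqrt ((L2_norm q)\<^sup>2 + (L2_norm p)\<^sup>2)"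
    by (simp add: W23_norm_def ap)
qed

lemma regular_diff:
  assumes "regular p q" "regular p' q'"
  shows "regular (\<lambda>t. p t - p' t) (\<lambda>t. q t - q' t)"
  using has_weak_deriv_diff[of 3 "\<lambda>t. (B ^^ 6) (p t)" q "\<lambda>t. (B ^^ 6) (p' t)" q'] assms
  by (simp add: regular_def L2_diff linear_simps(2)[OF Bk_bl])

lemma regular_uminus: "regular p q \<Longrightarrow> regular (\<lambda>t. - p t) (\<lambda>t. - q t)"
proof -
  assume r: "regular p q"
  have "regular (\<lambda>t. 0) (\<lambda>t. 0)"
    using regular_diff[OF r r] by simp
  from regular_diff[OF this r] show ?thesis by simp
qed

text \<open>A^(3/2) K u as a function of A^3 u, so that the boundary condition becomes an equation
  in H.\<close>

definition trace_K :: "(real \<Rightarrow> 'h) \<Rightarrow> 'h" where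
  "trace_K p = ap (half_pow A 3) (K (\<lambda>t. (B ^^ 6) (p t)))"

lemma trace_K:
  assumes "regular p q"
  shows "K (\<lambda>t. (B ^^ 6) (p t)) = (B ^^ 3) (trace_K p)"
proof -
  have "K (\<lambda>t. (B ^^ 6) (p t)) \<in> H_half A 3"
    using K regular_W23(1)[OF assms] by (simp add: bounded_W_H_def)
  then obtain y where "K (\<lambda>t. (B ^^ 6) (p t)) = (B ^^ 3) y" unfolding H_half by blast
  then show ?thesis by (simp add: trace_K_def graph_inv_ap[OF half_pow])
qed

lemma trace_K_eqI: "regular p q \<Longrightarrow> K (\<lambda>t. (B ^^ 6) (p t)) = (B ^^ 3) y \<Longrightarrow> trace_K p = y"
  using inj_symD(4)[OF Bk, of 3] trace_K by metis

lemma trace_K_diff: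
  assumes "regular p q" "regular p' q'"
  shows "trace_K (\<lambda>t. p t - p' t) = trace_K p - trace_K p'"
proof (rule trace_K_eqI[OF regular_diff[OF assms]])
  interpret B6: bounded_linear "B ^^ 6" by (rule Bk_bl)
  interpret B3: bounded_linear "B ^^ 3" by (rule Bk_bl)
  note W = regular_W23(1)[OF assms(1)] regular_W23(1)[OF assms(2)] regular_W23(1)[OF regular_uminus[OF assms(2)]]
  have "K (\<lambda>t. (B ^^ 6) (p t - p' t)) = K (\<lambda>t. (B ^^ 6) (p t) + (B ^^ 6) (- p' t))"
    by (simp add: B6.diff B6.neg)
  also have "\<dots> = K (\<lambda>t. (B ^^ 6) (p t)) + K (\<lambda>t. (B ^^ 6) (- p' t))"
    by (rule K_add[OF W(1,3)])
  also have "K (\<lambda>t. (B ^^ 6) (- p' t)) = K (\<lambda>t. (-1) *\<^sub>R (B ^^ 6) (p' t))"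
    by (simp add: B6.neg)
  also have "\<dots> = (-1) *\<^sub>R K (\<lambda>t. (B ^^ 6) (p' t))"
    by (rule K_scaleR[OF W(2)])
  finally show "K (\<lambda>t. (B ^^ 6) (p t - p' t)) = (B ^^ 3) (trace_K p - trace_K p')"
    by (simp add: trace_K[OF assms(1)] trace_K[OF assms(2)] B3.diff)
qed

lemma norm_trace_K_le:
  assumes r: "regular p q"
  shows "norm (trace_K p) \<le> \<kappa> * sqrt ((L2_norm q)\<^sup>2 + (L2_norm p)\<^sup>2)"
proof -
  have "norm (trace_K p) = H_norm A 3 (K (\<lambda>t. (B ^^ 6) (p t)))" by (simp add: trace_K[OF r] H_norm)
  then show ?thesis using K_bound[OF regular_W23(1)[OF r]] by (simp add: regular_W23(2)[OF r])
qed

text \<open>K acts on functions, but its linearity and boundedness annihilate differences of norm 0.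
  This makes \<open>trace\<close> additive although \<open>rep_l2\<close> picks representatives
  arbitrarily.\<close>

lemma trace_K_cong:
  assumes "regular p q" "regular p' q'" "AE t in Rplus. p t = p' t" "AE t in Rplus. q t = q' t"
  shows "trace_K p = trace_K p'"
proof -
  have L: "p \<in> L2" "p' \<in> L2" "q \<in> L2" "q' \<in> L2" using assms by (auto simp: regular_def)
  have "L2_norm (\<lambda>t. p t - p' t) = 0" "L2_norm (\<lambda>t. q t - q' t) = 0"
    using assms(3,4) L by (simp_all add: abs_l2_eq_iff flip: norm_abs_l2[OF L2_diff] abs_l2_minus)
  then show ?thesis
    using norm_trace_K_le[OF regular_diff[OF assms(1,2)]] trace_K_diff[OF assms(1,2)] by simp
qed

section \<open>The boundary operator on states and the functions they represent\<close>

definition trace :: "'h state \<Rightarrow> 'h" where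
  "trace x = trace_K (rep_l2 (P0 x))"

text \<open>Applying B^6 to a representative of A^3 u puts the value at every t into the domain of
  A^3, and A^3 recovers the representative exactly.\<close>

definition solution :: "'h state \<Rightarrow> real \<Rightarrow> 'h" where
  "solution x = (\<lambda>t. (B ^^ 6) (rep_l2 (P0 x) t))"

lemma solution_derivatives:
  assumes x: "x \<in> X"
  shows "has_weak_deriv 0 (solution x) (solution x)"
    and "has_weak_deriv 1 (solution x) (\<lambda>t. (B ^^ 4) (rep_l2 (P1 x) t))"
    and "has_weak_deriv 2 (solution x) (\<lambda>t. (B ^^ 2) (rep_l2 (P2 x) t))"
    and "has_weak_deriv 3 (solution x) (rep_l2 (P3 x))"
proof -
  have L: "(\<lambda>t. (B ^^ k) (rep_l2 z t)) \<in> L2" for k z by (rule L2_bounded_linear[OF Bk_bl rep_l2])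
  have eq: "abs_l2 (\<lambda>t. (B ^^ k) (rep_l2 z t)) = (C ^^ k) z" for k z
    using l2_map_funpow_abs[OF B rep_l2[of z], of k] by simp
  show "has_weak_deriv 0 (solution x) (solution x)"
    unfolding solution_def by (intro has_weak_deriv_0 L2_loc_integrable L)
  show 1: "has_weak_deriv 1 (solution x) (\<lambda>t. (B ^^ 4) (rep_l2 (P1 x) t))"
    unfolding solution_def by (intro has_weak_deriv_1_l2 L) (simp add: eq X_weak_derivatives(1)[OF x])
  have 2: "has_weak_deriv 1 (\<lambda>t. (B ^^ 4) (rep_l2 (P1 x) t)) (\<lambda>t. (B ^^ 2) (rep_l2 (P2 x) t))"
    by (intro has_weak_deriv_1_l2 L) (simp add: eq X_weak_derivatives(2)[OF x])
  have 3: "has_weak_deriv 1 (\<lambda>t. (B ^^ 2) (rep_l2 (P2 x) t)) (rep_l2 (P3 x))"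
    by (intro has_weak_deriv_1_l2 L rep_l2) (simp add: eq X_weak_derivatives(3)[OF x])
  show "has_weak_deriv 2 (solution x) (\<lambda>t. (B ^^ 2) (rep_l2 (P2 x) t))"
    using has_weak_deriv_Suc[OF 1 2] by (simp add: numeral_2_eq_2)
  show "has_weak_deriv 3 (solution x) (rep_l2 (P3 x))"
    using has_weak_deriv_Suc[OF 1 has_weak_deriv_Suc[OF 2 3]] by (simp add: numeral_3_eq_3)
qed

lemma regular_state: "x \<in> X \<Longrightarrow> regular (rep_l2 (P0 x)) (rep_l2 (P3 x))"
  using solution_derivatives(4)[of x] by (simp add: regular_def solution_def)

lemma L2_norm_rep: "L2_norm (rep_l2 x) = norm x"
  by (simp flip: norm_abs_l2)

lemma W23_norm_solution:
  assumes "x \<in> X"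
  shows "solution x \<in> W23 A" "W23_norm A (solution x) = norm (data x)"
  using regular_W23[OF regular_state[OF assms]] norm_data_sq[OF assms]
  by (simp_all add: solution_def L2_norm_rep add.commute)

lemma X_diff: "x \<in> X \<Longrightarrow> y \<in> X \<Longrightarrow> x - y \<in> X"
  by (rule subspace_diff[OF subspace_X])

lemma rep_l2_diff: "AE t in Rplus. rep_l2 (x - y) t = rep_l2 x t - rep_l2 y t"
  using rep_abs_l2[OF L2_diff[OF rep_l2 rep_l2], of x y] by (simp flip: abs_l2_minus)

lemma trace_diff:
  assumes "x \<in> X" "y \<in> X"
  shows "trace (x - y) = trace x - trace y"
proof -
  note r = regular_state[OF assms(1)] regular_state[OF assms(2)]
  have "trace (x - y) = trace_K (\<lambda>t. rep_l2 (P0 x) t - rep_l2 (P0 y) t)"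
    unfolding trace_def
    using rep_l2_diff[of "P0 x" "P0 y"] rep_l2_diff[of "P3 x" "P3 y"]
    by (intro trace_K_cong[OF regular_state[OF X_diff[OF assms]] regular_diff[OF r]])
       (simp_all add: linear_simps(2)[OF bounded_linear_P0] linear_simps(2)[OF bounded_linear_P3])
  then show ?thesis by (simp add: trace_K_diff[OF r] trace_def)
qed

lemma norm_trace_le: "x \<in> X \<Longrightarrow> norm (trace x) \<le> \<kappa> * norm (data x)"
  using norm_trace_K_le[OF regular_state, of x] norm_data_sq[of x]
  by (simp add: trace_def L2_norm_rep add.commute)

lemma norm_K_nonneg: "0 \<le> \<kappa>"
proof -
  have "0 \<le> H_norm A 3 (K (solution 0)) / W23_norm A (solution 0)" by (simp add: H_norm_def W23_norm_def)
  also have "\<dots> \<le> \<kappa>"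
    by (rule K_quotient_le[OF W23_norm_solution(1)[OF subspace_0[OF subspace_X]]])
  finally show ?thesis .
qed

text \<open>The condition u'(0) = K u in the form A^(3/2) u'(0) = A^(3/2) K u, free of
  limits.\<close>

definition X_K :: "'h state set" where
  "X_K = {x \<in> X. apply_bcontfun (W3 x) 0 = trace x}"

lemma X_K_diff: "x \<in> X_K \<Longrightarrow> y \<in> X_K \<Longrightarrow> x - y \<in> X_K"
  by (simp add: X_K_def X_diff trace_diff linear_simps(2)[OF bounded_linear_W3])

text \<open>K enters only in the second component, replacing A^(3/2) u'(0) by A^(3/2) (u'(0) - K u).
  Its bound relative to \<open>data\<close> is \<kappa> < 1, so the pair (f, 0) is still
  attained.\<close>

lemma unperturbed_solvable: "\<exists>x\<in>X_K. P3 x - P0 x = f"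
proof -
  have "\<exists>x\<in>X. data x + (0, - trace x) = (f, 0)"
  proof (rule perturbed_surjective[where \<theta> = \<kappa>])
    show "\<exists>x\<in>X. data x = y" for y using data_surj by (metis UNIV_I imageE)
    show "norm ((0, - trace x) :: 'h l2 \<times> 'h) \<le> \<kappa> * norm (data x)" if "x \<in> X" for x
      using norm_trace_le[OF that] by (simp add: norm_Pair)
  qed (auto simp: X_diff linear_simps(2)[OF bounded_linear_data] trace_diff norm_K)
  then obtain x where "x \<in> X" "data x + (0, - trace x) = (f, 0)" by blast
  then have "x \<in> X_K" "P3 x - P0 x = f" by (auto simp: data_def X_K_def)
  then show ?thesis by blast
qed

text \<open>On \<open>X_K\<close> the energy identity reads |u''' - A^3 u|^2 = |data x|^2 - |A^(3/2)
  K u|^2, which is at least (1 - \<kappa>^2) |data x|^2; weakening \<kappa>^2 to \<kappa> gives the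
  factor \<open>C0 \<kappa>\<close>.\<close>

lemma norm_data_le:
  assumes x: "x \<in> X_K"
  shows "norm (data x) \<le> (1 - \<kappa>) powr (-1/2) * norm (P3 x - P0 x)"
proof -
  have X: "x \<in> X" and tr: "apply_bcontfun (W3 x) 0 = trace x" using x by (auto simp: X_K_def)
  have "(norm (trace x))\<^sup>2 \<le> (\<kappa> * norm (data x))\<^sup>2"
    using norm_trace_le[OF X] by (intro power_mono) auto
  also have "\<dots> \<le> \<kappa> * (norm (data x))\<^sup>2"
    using norm_K_nonneg norm_K
      by (auto simp: power_mult_distrib power2_eq_square[of \<kappa>] mult_left_le intro!: mult_right_mono)
  finally have "(1 - \<kappa>) * (norm (data x))\<^sup>2 \<le> (norm (P3 x - P0 x))\<^sup>2"
    using X_energy[OF X] norm_data_sq[OF X] by (simp add: tr algebra_simps)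
  then have "(sqrt (1 - \<kappa>) * norm (data x))\<^sup>2 \<le> (norm (P3 x - P0 x))\<^sup>2"
    using norm_K by (simp add: power_mult_distrib)
  then have "sqrt (1 - \<kappa>) * norm (data x) \<le> norm (P3 x - P0 x)" by (rule power2_le_imp_le) simp
  then have "norm (data x) \<le> 1 / sqrt (1 - \<kappa>) * norm (P3 x - P0 x)" using norm_K
    by (simp add: field_simps)
  moreover have "(1 - \<kappa>) powr (-1/2) = 1 / sqrt (1 - \<kappa>)"
    using norm_K powr_minus_divide[of "1 - \<kappa>" "1/2"] by (simp add: powr_half_sqrt)
  ultimately show ?thesis by (simp only:)
qed

text \<open>On \<open>X_K\<close> the boundary value is A^(3/2) K u, so
  \<open>intermediate_bounds\<close> applies with k = \<kappa>; the common factor (1 -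
  \<kappa>)^(-1/2) is the passage from \<open>data x\<close> to u''' - A^3 u.\<close>

lemma intermediate_estimates:
  assumes x: "x \<in> X_K"
  shows "norm (P0 x) \<le> C0 \<kappa> * norm (P3 x - P0 x)"
    and "norm (P1 x) \<le> C1 \<kappa> * norm (P3 x - P0 x)"
    and "norm (P2 x) \<le> C2 \<kappa> * norm (P3 x - P0 x)"
proof -
  have X: "x \<in> X" and tr: "apply_bcontfun (W3 x) 0 = trace x" using x by (auto simp: X_K_def)
  note n = norm_data_le[OF x]
  have "norm (P0 x) \<le> norm (data x)" by (rule power2_le_imp_le) (simp_all flip: norm_data_sq[OF X])
  then show "norm (P0 x) \<le> C0 \<kappa> * norm (P3 x - P0 x)" using n by (simp add: C0_def)
  have q: "norm (apply_bcontfun (W3 x) 0) \<le> \<kappa> * norm (data x)" using norm_trace_le[OF X]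
    by (simp add: tr)
  note bounds = intermediate_bounds[OF norm_ge_zero norm_ge_zero norm_ge_zero norm_ge_zero norm_ge_zero norm_K_nonneg
      X_first_bound[OF X] X_second_bound[OF X] norm_data_sq[OF X] q]
  show "norm (P1 x) \<le> C1 \<kappa> * norm (P3 x - P0 x)"
    unfolding C1_def using order_trans[OF bounds(2) mult_left_mono[OF n]] by (simp add: mult.assoc)
  have "(1 - \<kappa>) powr (-1/2) = 1 / (1 - \<kappa>) powr (1/2)"
    using powr_minus_divide[of "1 - \<kappa>" "1/2"] by simp
  then show "norm (P2 x) \<le> C2 \<kappa> * norm (P3 x - P0 x)"
    unfolding C2_def using order_trans[OF bounds(1) mult_left_mono[OF n]] norm_K_nonneg
      by (simp add: mult.assoc)
qed

lemma solution_boundary_conditions: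
  assumes x: "x \<in> X_K"
  shows "boundary_conditions A K (solution x)"
proof -
  have X: "x \<in> X" and tr: "apply_bcontfun (W3 x) 0 = trace x" using x by (auto simp: X_K_def)
  \<comment> \<open>Equal pairings with all test functions identify a continuous component almost
    everywhere with B applied to the class.\<close>
  have ae: "AE t in Rplus. apply_bcontfun w t = B (rep_l2 z t)"
    if "\<And>\<phi>. test_function \<phi> \<Longrightarrow> l2_pair \<phi> (C z) = bc_pair \<phi> w" for w z
  proof -
    have L: "(\<lambda>t. B (rep_l2 z t)) \<in> L2" by (rule L2_bounded_linear[OF inj_symD(1)[OF B] rep_l2])
    note li = bcontfun_loc_integrable[of w] L2_loc_integrable[OF L]
    have "AE t in Rplus. apply_bcontfun w t - B (rep_l2 z t) = 0"
    proof (rule fundamental_lemma[OF loc_integrable_diff[OF li]])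
      fix \<phi> assume \<phi>: "test_function \<phi>"
      have "C z = abs_l2 (\<lambda>t. B (rep_l2 z t))"
        using l2_map_abs[OF inj_symD(1)[OF B] rep_l2, of z] by simp
      then have "(LINT t|Rplus. \<phi> t *\<^sub>R B (rep_l2 z t)) = bc_pair \<phi> w"
        using that[OF \<phi>] by (simp add: l2_pair_abs test_function_L2 \<phi> L)
      then show "(LINT t|Rplus. \<phi> t *\<^sub>R (apply_bcontfun w t - B (rep_l2 z t))) = 0"
        by (simp add: scaleR_diff_right test_function_times_integrable[OF \<phi>] li bc_pair_def)
    qed
    then show ?thesis by simp
  qed
  have ae5: "AE t in Rplus. apply_bcontfun (W5 x) t = B (rep_l2 (P0 x) t)"
    and ae3: "AE t in Rplus. apply_bcontfun (W3 x) t = B (rep_l2 (P1 x) t)"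
    by (rule ae, erule X_traces[OF X])+
  \<comment> \<open>Continuous representatives of u and u' as B^5 A^(5/2) u and B^3 A^(3/2) u'. The
    norm of order 5/2 of the first is the plain norm of \<open>W5 x\<close>, and that of order 3/2
    of u' - K u is the plain norm of \<open>W3 x\<close> minus \<open>trace x\<close>.\<close>
  let ?v = "\<lambda>t. (B ^^ 5) (apply_bcontfun (W5 x) t)"
    and ?v' = "\<lambda>t. (B ^^ 3) (apply_bcontfun (W3 x) t)"
  have swap: "(B ^^ n) (B y) = (B ^^ Suc n) y" for n y by (simp add: funpow_swap1)
  have cont: "continuous_on S (\<lambda>t. (B ^^ k) (apply_bcontfun w t))" for S k w
    by (intro bounded_linear.continuous_on[OF Bk_bl]) simp
  have lim: "((\<lambda>t. apply_bcontfun w t) \<longlongrightarrow> apply_bcontfun w 0) (at_right 0)"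
    for w :: "real \<Rightarrow>\<^sub>C 'h"
  proof -
    have "(apply_bcontfun w \<longlongrightarrow> apply_bcontfun w 0) (at 0)"
      using continuous_on_apply_bcontfun[of UNIV w] unfolding continuous_on_def by blast
    then show ?thesis by (rule tendsto_within_subset) simp
  qed
  have Ku: "K (solution x) = (B ^^ 3) (trace x)"
    using trace_K[OF regular_state[OF X]] by (simp add: solution_def trace_def)
  have "AE t in Rplus. ?v t = solution x t"
    using ae5 by eventually_elim (simp add: solution_def swap)
  moreover have "has_weak_deriv 1 (solution x) ?v'"
  proof (rule has_weak_deriv_cong_AE[OF solution_derivatives(2)[OF X]])
    show "loc_integrable ?v'"
      unfolding loc_integrable_def by (intro allI impI integrable_lebesgue_on_Icc cont)
    show "AE t in Rplus. (B ^^ 4) (rep_l2 (P1 x) t) = ?v' t"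
      using ae3 by eventually_elim (simp add: swap)
  qed
  moreover have "((\<lambda>t. H_norm A 5 (?v t)) \<longlongrightarrow> 0) (at_right 0)"
    unfolding H_norm using tendsto_norm[OF lim[of "W5 x"]] X_initial[OF X] by simp
  moreover have "((\<lambda>t. H_norm A 3 (?v' t - K (solution x))) \<longlongrightarrow> 0) (at_right 0)"
  proof -
    have "H_norm A 3 (?v' t - K (solution x)) = norm (apply_bcontfun (W3 x) t - trace x)" for t
      unfolding Ku linear_simps(2)[OF Bk_bl, symmetric] by (rule H_norm)
    moreover have "((\<lambda>t. norm (apply_bcontfun (W3 x) t - trace x)) \<longlongrightarrow> norm (apply_bcontfun (W3 x) 0 - trace x)) (at_right 0)"
      by (intro tendsto_intros lim)
    ultimately show ?thesis by (simp add: tr)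
  qed
  ultimately show ?thesis
    unfolding boundary_conditions_def H_half
    by (intro exI[of _ ?v] exI[of _ ?v'] conjI cont allI impI rangeI)
qed

text \<open>The lower order terms are \<open>D j\<close> applied to A^j u^(3-j), that is, bounded
  operators acting on components of the state; the second contraction takes place on
  \<open>X_K\<close> with relative bound \<alpha>.\<close>

lemma regularly_solvable_if_small:
  fixes A' D :: "nat \<Rightarrow> 'h \<rightharpoonup> 'h"
  assumes D: "\<forall>j\<in>{1..3}. D j = A' j \<circ>\<^sub>m op_pow (op_inv A) j"
    and bd: "\<forall>j\<in>{1..3}. bounded_op (D j)"
    and \<alpha>: "\<alpha> = C0 \<kappa> * onorm (ap (D 3)) + C1 \<kappa> * onorm (ap (D 2)) + C2 \<kappa> * onorm (ap (D 1))" "\<alpha> < 1"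
  shows "regularly_solvable A A' K"
proof -
  have bl: "bounded_linear (ap (D j))" if "j \<in> {1..3}" for j using bd that by (auto simp: bounded_op_def)
  have inv_pow: "op_pow (op_inv A) j y = Some ((B ^^ (2 * j)) y)" for j y
  proof -
    have "op_inv A = (\<lambda>y. Some (B (B y)))" by (rule graph_inv_op_inv[OF gA])
    then have "op_pow (op_inv A) j y = Some (((\<lambda>x. B (B x)) ^^ j) y)"
      by (induction j) (auto simp: map_comp_def)
    then show ?thesis by (simp only: funpow_double)
  qed
  \<comment> \<open>That \<open>D j\<close> is everywhere defined means that \<open>A' j\<close> is
    defined on the whole domain of A^j.\<close>
  have A'D: "A' j ((B ^^ (2 * j)) y) = Some (ap (D j) y)" if j: "j \<in> {1..3}" for j y
  proof -
    have "y \<in> dom (D j)" using bd j by (auto simp: bounded_op_def)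
    then have "D j y = Some (ap (D j) y)" by auto
    moreover have "D j y = A' j ((B ^^ (2 * j)) y)"
      using D[rule_format, OF j] by (simp add: map_comp_def inv_pow)
    ultimately show ?thesis by simp
  qed
  define L1 where "L1 x = l2_map (ap (D 3)) (P0 x) + l2_map (ap (D 2)) (P1 x) + l2_map (ap (D 1)) (P2 x)"
    for x
  have L1_le: "norm (L1 x) \<le> \<alpha> * norm (P3 x - P0 x)" if x: "x \<in> X_K" for x
  proof -
    note est = intermediate_estimates[OF x]
    have le: "norm (l2_map (ap (D j)) z) \<le> onorm (ap (D j)) * norm z" if "j \<in> {1..3}" for j z
      by (intro norm_l2_map_le bl onorm that)
    have le': "norm (l2_map (ap (D j)) z) \<le> onorm (ap (D j)) * (c * norm (P3 x - P0 x))"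
      if "j \<in> {1..3}" "norm z \<le> c * norm (P3 x - P0 x)" for j z c
      using order_trans[OF le[OF that(1)] mult_left_mono[OF that(2) onorm_pos_le[OF bl[OF that(1)]]]] .
    have "norm (L1 x) \<le> norm (l2_map (ap (D 3)) (P0 x)) + norm (l2_map (ap (D 2)) (P1 x)) + norm (l2_map (ap (D 1)) (P2 x))"
      unfolding L1_def by (intro norm_triangle_mono order_refl)
    also have "\<dots> \<le> onorm (ap (D 3)) * (C0 \<kappa> * norm (P3 x - P0 x)) + onorm (ap (D 2)) * (C1 \<kappa> * norm (P3 x - P0 x))
        + onorm (ap (D 1)) * (C2 \<kappa> * norm (P3 x - P0 x))"
      by (intro add_mono le' est) auto
    also have "\<dots> = \<alpha> * norm (P3 x - P0 x)" by (simp add: \<alpha>(1) algebra_simps)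
    finally show ?thesis .
  qed
  have solve: "\<exists>x\<in>X_K. (P3 x - P0 x) + L1 x = f" for f
  proof (rule perturbed_surjective[where \<theta> = \<alpha>])
    show "L1 (x - y) = L1 x - L1 y" for x y
      by (simp add: L1_def linear_simps(2)[OF bounded_linear_P0] linear_simps(2)[OF bounded_linear_P1]
          linear_simps(2)[OF bounded_linear_P2] linear_simps(2)[OF bounded_linear_l2_map[OF bl]])
    show "P3 (x - y) - P0 (x - y) = P3 x - P0 x - (P3 y - P0 y)" for x y :: "'h state"
      by (simp add: linear_simps(2)[OF bounded_linear_P0] linear_simps(2)[OF bounded_linear_P3])
  qed (use X_K_diff unperturbed_solvable L1_le \<alpha>(2) in auto)
  \<comment> \<open>The first factor is that of \<open>norm_data_le\<close>; the second comes from
    |u''' - A^3 u| \<le> |f| + \<alpha> |u''' - A^3 u|.\<close>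
  define M where "M = (1 - \<kappa>) powr (-1/2) / (1 - \<alpha>)"
  show ?thesis unfolding regularly_solvable_def
  proof (intro exI[of _ M] ballI)
    fix f :: "real \<Rightarrow> 'h" assume f: "f \<in> L2"
    obtain x where x: "x \<in> X_K" "(P3 x - P0 x) + L1 x = abs_l2 f" using solve by blast
    then have X: "x \<in> X" by (simp add: X_K_def)
    let ?u = "solution x"
    have "W23_norm A ?u \<le> M * L2_norm f"
    proof -
      have "norm (P3 x - P0 x) \<le> norm (abs_l2 f) + norm (L1 x)"
        unfolding x(2)[symmetric] by (metis add_diff_cancel_right' norm_triangle_ineq4)
      then have "(1 - \<alpha>) * norm (P3 x - P0 x) \<le> L2_norm f"
        using L1_le[OF x(1)] by (simp add: norm_abs_l2 f algebra_simps)
      then have "norm (P3 x - P0 x) \<le> L2_norm f / (1 - \<alpha>)" using \<alpha>(2)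
        by (simp add: field_simps)
      then have "(1 - \<kappa>) powr (-1/2) * norm (P3 x - P0 x) \<le> M * L2_norm f"
        unfolding M_def times_divide_eq_left times_divide_eq_right[symmetric] by (intro mult_left_mono) auto
      then show ?thesis using norm_data_le[OF x(1)] W23_norm_solution(2)[OF X] by simp
    qed
    moreover have "regular_solution A A' f ?u"
      unfolding regular_solution_def
    proof
      show "?u \<in> W23 A" by (rule W23_norm_solution[OF X])
      note d = solution_derivatives[OF X, THEN has_weak_deriv_weak_deriv]
      have L: "(\<lambda>t. ap (D j) (rep_l2 z t)) \<in> L2" if "j \<in> {1..3}" for j z
        by (rule L2_bounded_linear[OF bl[OF that] rep_l2])
      have lm: "l2_map (ap (D j)) z = abs_l2 (\<lambda>t. ap (D j) (rep_l2 z t))" if "j \<in> {1..3}" for j z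
        using l2_map_abs[OF bl[OF that] rep_l2, of z] by simp
      let ?g = "\<lambda>t. (rep_l2 (P3 x) t - rep_l2 (P0 x) t) + (ap (D 3) (rep_l2 (P0 x) t)
        + ap (D 2) (rep_l2 (P1 x) t) + ap (D 1) (rep_l2 (P2 x) t))"
      have "abs_l2 ?g = abs_l2 f"
        using x(2) by (simp add: L1_def lm L L2_diff L2_add flip: abs_l2_plus abs_l2_minus)
      then have g: "AE t in Rplus. ?g t = f t"
        by (subst (asm) abs_l2_eq_iff) (auto intro!: L2_add L2_diff L f)
      show "AE t in Rplus. (\<forall>j\<in>{1..3}. weak_deriv (3 - j) ?u t \<in> dom (A' j))
          \<and> weak_deriv 3 ?u t - ap (op_pow A 3) (?u t)
              + (\<Sum>j = 1..3. ap (A' j) (weak_deriv (3 - j) ?u t)) = f t"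
        using d g
      proof eventually_elim
        case (elim t)
        have j: "{1..3} = {1, 2, 3 :: nat}" by auto
        have "A' 1 (weak_deriv 2 ?u t) = Some (ap (D 1) (rep_l2 (P2 x) t))"
          "A' 2 (weak_deriv 1 ?u t) = Some (ap (D 2) (rep_l2 (P1 x) t))"
          "A' 3 (weak_deriv 0 ?u t) = Some (ap (D 3) (rep_l2 (P0 x) t))"
          using A'D[of 1] A'D[of 2] A'D[of 3] elim by (simp_all add: solution_def)
        moreover have "ap (op_pow A 3) (?u t) = rep_l2 (P0 x) t"
          using graph_inv_ap[OF pow, of 3] by (simp add: solution_def)
        ultimately show ?case using elim unfolding j by (simp add: algebra_simps domI)
      qed
    qed
    ultimately show "\<exists>u. regular_solution A A' f u \<and> boundary_conditions A K u \<and> W23_norm A u \<le> M * L2_norm f"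
      using solution_boundary_conditions[OF x(1)] by blast
  qed
qed

end

theorem theorem4:
  fixes A :: "'h::{real_inner,banach,second_countable_topology} \<rightharpoonup> 'h"
    and A' :: "nat \<Rightarrow> 'h \<rightharpoonup> 'h"
    and B :: "nat \<Rightarrow> 'h \<rightharpoonup> 'h"
    and K :: "(real \<Rightarrow> 'h) \<Rightarrow> 'h"
    and \<mu>\<^sub>0 \<kappa> \<alpha> :: real
  assumes "self_adjoint A" and "\<mu>\<^sub>0 > 0" and "op_ge A \<mu>\<^sub>0"
    and "bounded_W_H A K" and "\<kappa> = norm_W_H A K" and "\<kappa> < 1"
    and "\<forall>j\<in>{1..3}. linear_op (A' j)"
    and "\<forall>j\<in>{1..3}. B j = A' j \<circ>\<^sub>m op_pow (op_inv A) j"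
    and "\<forall>j\<in>{1..3}. bounded_op (B j)"
    and "\<alpha> = C0 \<kappa> * onorm (ap (B 3)) + C1 \<kappa> * onorm (ap (B 2)) + C2 \<kappa> * onorm (ap (B 1))"
    and "\<alpha> < 1"
  shows "regularly_solvable A A' K"
proof -
  obtain S where S: "inj_sym S" "graph_inv (op_sqrt A) S" "graph_inv A (\<lambda>x. S (S x))"
    using inverse_sqrt_exists[OF assms(1-3)] by blast
  interpret boundary_problem S A K
    by unfold_locales (use S assms(4-6) in auto)
  show ?thesis
    by (rule regularly_solvable_if_small[of B A' \<alpha>]) (use assms(5,8-11) in auto)
qed

end
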